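(* Let $k$ be a commutative ring, $S=k[x_1,\ldots,x_n]$, $\prec$ a monomial order, $\Delta\subset\mathbb{N}^n$ a standard set of finite size $d\ge1$, and $N\subset\mathbb{N}^n$ a standard set containing $\Delta$. Let $R=k[T_{\alpha,\beta};\alpha\in N\cup N^{(1)},\beta\in\Delta]$ and let $I^\Delta\subset R$ be the ideal defined in the context. Then the functor $\mathcal{H}{\rm ilb}^{\prec\Delta}_{S/k}$ is represented by the affine scheme ${\rm Hilb}^{\prec\Delta}_{S/k}={\rm Spec}\,R^{\prec\Delta}$, where $R^{\prec\Delta}=R/I^{\prec\Delta}$ and $$I^{\prec\Delta}=I^\Delta+(T_{\alpha,\beta};\ \alpha\in N\cup N^{(1)},\ \beta\in\Delta,\ \alpha\prec\beta).$$
   Context: All rings are commutative with $1$; $x^\alpha=x_1^{\alpha_1}\cdots x_n^{\alpha_n}$ for $\alpha\in\mathbb{N}^n$, $B[x]=B[x_1,\ldots,x_n]$; $\prec$ also denotes the induced order on exponents; $e_i$ is the $i$-th standard basis vector and $\delta$ the Kronecker delta. A standard set is a subset $N\subset\mathbb{N}^n$ with $(\mathbb{N}^n-N)+\mathbb{N}^n\subset\mathbb{N}^n-N$. Its border is $\mathscr{B}(N)=\bigcup_{i=1}^n(N+e_i)-N$. Put $N^{(1)}=\mathscr{B}(N)$ and $N^{(2)}=\mathscr{B}(N\cup N^{(1)})$. $I^\Delta=I^\Delta_1+I^\Delta_2+I^\Delta_3\subset R$, where: $I^\Delta_1$ is generated by all $T_{\alpha,\beta}-\delta_{\alpha,\beta}$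 with $\alpha,\beta\in\Delta$; $I^\Delta_2$ is generated by all $T_{\alpha+\lambda,\beta}-\sum_{\gamma\in\Delta}T_{\alpha,\gamma}T_{\gamma+\lambda,\beta}$ with $\alpha\in N\cup N^{(1)}$, $\lambda\in\{e_1,\ldots,e_n\}$, $\alpha+\lambda\in N\cup N^{(1)}$, $\beta\in\Delta$; $I^\Delta_3$ is generated by all $\sum_{\gamma\in\Delta}T_{\alpha,\gamma}T_{\gamma+\lambda,\beta}-\sum_{\gamma\in\Delta}T_{\alpha',\gamma}T_{\gamma+\lambda',\beta}$ with $\alpha,\alpha'\in N^{(1)}$, $\lambda,\lambda'\in\{e_1,\ldots,e_n\}$, $\alpha+\lambda=\alpha'+\lambda'\in N^{(2)}$, $\beta\in\Delta$. For an ideal $I\subset B[x]$, the standard set attached to $I$ is the complement in $\mathbb{N}^n$ of the set of leading exponents (w.r.t. $\prec$) of nonzero elements of $I$. $I$ is monic if for each monomial $x^\alpha$ the ideal of $B$ consisting of $0$ and all leading coefficients of those $f\in I-\{0\}$ with leading exponent $\alpha$ is the zero ideal or the unit ideal. The functor $\mathcal{H}{\rm ilb}^{\prec\Delta}_{S/k}:(k\text{-Alg})\to({\rm Sets})$ sends $B$ to the set of surjective $B$-algebra homomorphisms $\phi:B[x]\to Q$ such that $\ker\phi$ is monic with attached standard set $\Delta$, modulo $\phi\sim\phi'$ iff $\ker\phi=\ker\phi'$ (one-element set for $B=0$ by convention), with functoriality by base change. A homomorphism $R^{\prec\Delta}\to B$, $T_{\alpha,\beta}\mapsto a_{\alpha,\beta}$,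 corresponds to the class of $\phi$ with $\phi(x^\alpha)=\sum_{\beta\in\Delta}a_{\alpha,\beta}\phi(x^\beta)$ for $\alpha\in N\cup N^{(1)}$. *)

theory Defs
  imports
    "HOL-Analysis.Finite_Cartesian_Product"
    "HOL-Library.Multiset"
    "HOL-Algebra.QuotRing"
    "HOL-Algebra.Module"
begin

text \<open>
  Rings are \<^locale>\<open>cring\<close>s, so the zero ring is allowed, and algebras over \<open>K\<close> are
  modules \<open>B\<close> with \<open>algebra K B\<close>.  Exponents are vectors of type \<^typ>\<open>nat ^ 'n\<close>, and
  \<open>axis i 1\<close> is the standard basis vector \<open>e\<^sub>i\<close>.
\<close>

text \<open>Homomorphisms are extensional functions, so that equal homomorphisms are equal in HOL.\<close>

definition alg_hom ::
  "('k, 'r) ring_scheme \<Rightarrow> ('k, 'a, 'p) module_scheme \<Rightarrow> ('k, 'b, 'q) module_scheme \<Rightarrow> ('a \<Rightarrow> 'b) set"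
  where "alg_hom K A B =
    {h \<in> ring_hom A B. h \<in> extensional (carrier A) \<and>
      (\<forall>c\<in>carrier K. \<forall>x\<in>carrier A. h (c \<odot>\<^bsub>A\<^esub> x) = c \<odot>\<^bsub>B\<^esub> h x)}"

text \<open>
  The library quotient \<^const>\<open>FactRing\<close> drops the scalar multiplication; here it is put back,
  in the style of \<^const>\<open>rcoset_mult\<close>.
\<close>

definition quot_algebra :: "('k, 'a, 'p) module_scheme \<Rightarrow> 'a set \<Rightarrow> ('k, 'a set) module"
  where "quot_algebra A I =
    ring.extend (A Quot I) (module.fields (\<lambda>c X. \<Union>x\<in>X. I +>\<^bsub>A\<^esub> (c \<odot>\<^bsub>A\<^esub> x)))"

text \<open>
  The monoid algebra \<open>A[M]\<close>: finitely supported functions from \<open>M\<close> to \<open>A\<close>, extended by zero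
  outside \<open>carrier M\<close>, with convolution.
\<close>

definition monoid_algebra ::
  "('a, 'r) ring_scheme \<Rightarrow> ('m, 's) monoid_scheme \<Rightarrow> ('a, 'm \<Rightarrow> 'a) module"
  where "monoid_algebra A M =
    \<lparr>carrier = {p. (\<forall>u. p u \<in> carrier A) \<and> (\<forall>u. u \<notin> carrier M \<longrightarrow> p u = \<zero>\<^bsub>A\<^esub>)
        \<and> finite {u. p u \<noteq> \<zero>\<^bsub>A\<^esub>}},
     mult = (\<lambda>p q w. finsum A (\<lambda>(u, v). p u \<otimes>\<^bsub>A\<^esub> q v)
        {(u, v). p u \<noteq> \<zero>\<^bsub>A\<^esub> \<and> q v \<noteq> \<zero>\<^bsub>A\<^esub> \<and> u \<otimes>\<^bsub>M\<^esub> v = w}),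
     one = (\<lambda>u. if u = \<one>\<^bsub>M\<^esub> then \<one>\<^bsub>A\<^esub> else \<zero>\<^bsub>A\<^esub>),
     zero = (\<lambda>u. \<zero>\<^bsub>A\<^esub>),
     add = (\<lambda>p q u. p u \<oplus>\<^bsub>A\<^esub> q u),
     smult = (\<lambda>c p u. c \<otimes>\<^bsub>A\<^esub> p u)\<rparr>"

definition single :: "('a, 'r) ring_scheme \<Rightarrow> 'm \<Rightarrow> 'm \<Rightarrow> 'a"
  where "single A w = (\<lambda>u. if u = w then \<one>\<^bsub>A\<^esub> else \<zero>\<^bsub>A\<^esub>)"

definition exponent_monoid :: "'m::comm_monoid_add set \<Rightarrow> 'm monoid"
  where "exponent_monoid S = \<lparr>carrier = S, mult = (+), one = 0\<rparr>"

text \<open>\<open>B[x\<^sub>1,\<dots>,x\<^sub>n]\<close>; the monomial with exponent \<open>\<alpha>\<close> is \<open>single B \<alpha>\<close>.\<close>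

definition poly_algebra :: "('b, 'r) ring_scheme \<Rightarrow> ('b, nat ^ 'n::finite \<Rightarrow> 'b) module"
  where "poly_algebra B = monoid_algebra B (exponent_monoid UNIV)"

text \<open>
  The polynomial ring over \<open>K\<close> in a possibly infinite set \<open>V\<close> of variables; monomials are
  multisets of variables.
\<close>

definition var_poly_algebra :: "('k, 'r) ring_scheme \<Rightarrow> 'v set \<Rightarrow> ('k, 'v multiset \<Rightarrow> 'k) module"
  where "var_poly_algebra K V = monoid_algebra K (exponent_monoid {m. set_mset m \<subseteq> V})"

definition monomial_order :: "(nat ^ 'n::finite \<Rightarrow> nat ^ 'n \<Rightarrow> bool) \<Rightarrow> bool"
  where "monomial_order lt \<longleftrightarrow>
    irreflp lt \<and> transp lt \<and> totalp lt \<and> wfp lt \<and>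
    (\<forall>\<alpha> \<beta> \<gamma>. lt \<alpha> \<beta> \<longrightarrow> lt (\<alpha> + \<gamma>) (\<beta> + \<gamma>))"

definition standard_set :: "(nat ^ 'n::finite) set \<Rightarrow> bool"
  where "standard_set N \<longleftrightarrow> (\<forall>\<alpha> \<gamma>. \<alpha> \<notin> N \<longrightarrow> \<alpha> + \<gamma> \<notin> N)"

definition border :: "(nat ^ 'n::finite) set \<Rightarrow> (nat ^ 'n) set"
  where "border N = (\<Union>i. (\<lambda>\<alpha>. \<alpha> + axis i 1) ` N) - N"

definition border2 :: "(nat ^ 'n::finite) set \<Rightarrow> (nat ^ 'n) set"
  where "border2 N = border (N \<union> border N)"

text \<open>Only meaningful for nonzero \<open>p\<close>.\<close>

definition lead_exp ::
  "('b, 'r) ring_scheme \<Rightarrow> (nat ^ 'n::finite \<Rightarrow> nat ^ 'n \<Rightarrow> bool) \<Rightarrow> (nat ^ 'n \<Rightarrow> 'b) \<Rightarrow> nat ^ 'n"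
  where "lead_exp B lt p =
    (THE \<alpha>. p \<alpha> \<noteq> \<zero>\<^bsub>B\<^esub> \<and> (\<forall>\<beta>. p \<beta> \<noteq> \<zero>\<^bsub>B\<^esub> \<and> \<beta> \<noteq> \<alpha> \<longrightarrow> lt \<beta> \<alpha>))"

definition attached_standard_set ::
  "('b, 'r) ring_scheme \<Rightarrow> (nat ^ 'n::finite \<Rightarrow> nat ^ 'n \<Rightarrow> bool) \<Rightarrow> (nat ^ 'n \<Rightarrow> 'b) set \<Rightarrow> (nat ^ 'n) set"
  where "attached_standard_set B lt I = - (lead_exp B lt ` (I - {\<zero>\<^bsub>poly_algebra B\<^esub>}))"

definition lead_coeff_ideal ::
  "('b, 'r) ring_scheme \<Rightarrow> (nat ^ 'n::finite \<Rightarrow> nat ^ 'n \<Rightarrow> bool) \<Rightarrow> (nat ^ 'n \<Rightarrow> 'b) set \<Rightarrow> nat ^ 'n \<Rightarrow> 'b set"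
  where "lead_coeff_ideal B lt I \<alpha> =
    {\<zero>\<^bsub>B\<^esub>} \<union> {p \<alpha> | p. p \<in> I - {\<zero>\<^bsub>poly_algebra B\<^esub>} \<and> lead_exp B lt p = \<alpha>}"

definition monic_ideal ::
  "('b, 'r) ring_scheme \<Rightarrow> (nat ^ 'n::finite \<Rightarrow> nat ^ 'n \<Rightarrow> bool) \<Rightarrow> (nat ^ 'n \<Rightarrow> 'b) set \<Rightarrow> bool"
  where "monic_ideal B lt I \<longleftrightarrow>
    (\<forall>\<alpha>. lead_coeff_ideal B lt I \<alpha> = {\<zero>\<^bsub>B\<^esub>} \<or> lead_coeff_ideal B lt I \<alpha> = carrier B)"

text \<open>
  A \<open>B\<close>-algebra \<open>Q\<close> with a map \<open>\<phi> : B[x] \<rightarrow> Q\<close>.  Elements of \<open>Q\<close> have the type of sets of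
  polynomials: the residue class ring \<open>B[x]/ker \<phi>\<close> lives there, so up to isomorphism every
  surjection onto a \<open>B\<close>-algebra of whatever type occurs.
\<close>

type_synonym ('b, 'n) presentation =
  "('b, (nat ^ 'n \<Rightarrow> 'b) set) module \<times> ((nat ^ 'n \<Rightarrow> 'b) \<Rightarrow> (nat ^ 'n \<Rightarrow> 'b) set)"

text \<open>
  Over the zero ring \<open>B\<close> nothing is asked of the kernel.  All surjections then have the same
  kernel, so \<open>hilb\<close> is a one-element set, which is the convention for \<open>B = 0\<close>.
\<close>

definition hilb_presentations ::
  "('b, 'r) ring_scheme \<Rightarrow> (nat ^ 'n::finite \<Rightarrow> nat ^ 'n \<Rightarrow> bool) \<Rightarrow> (nat ^ 'n) set \<Rightarrow> ('b, 'n) presentation set"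
  where "hilb_presentations B lt \<Delta> =
    {(Q, \<phi>). algebra B Q \<and> \<phi> \<in> alg_hom B (poly_algebra B) Q \<and>
      \<phi> ` carrier (poly_algebra B) = carrier Q \<and>
      (carrier B = {\<zero>\<^bsub>B\<^esub>} \<or>
        monic_ideal B lt (a_kernel (poly_algebra B) Q \<phi>) \<and>
        attached_standard_set B lt (a_kernel (poly_algebra B) Q \<phi>) = \<Delta>)}"

definition hilb_equiv ::
  "('b, 'r) ring_scheme \<Rightarrow> (nat ^ 'n::finite \<Rightarrow> nat ^ 'n \<Rightarrow> bool) \<Rightarrow> (nat ^ 'n) set \<Rightarrow> ('b, 'n) presentation rel"
  where "hilb_equiv B lt \<Delta> =
    {((Q, \<phi>), (Q', \<phi>')). (Q, \<phi>) \<in> hilb_presentations B lt \<Delta> \<and>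
      (Q', \<phi>') \<in> hilb_presentations B lt \<Delta> \<and>
      a_kernel (poly_algebra B) Q \<phi> = a_kernel (poly_algebra B) Q' \<phi>'}"

definition hilb ::
  "('b, 'r) ring_scheme \<Rightarrow> (nat ^ 'n::finite \<Rightarrow> nat ^ 'n \<Rightarrow> bool) \<Rightarrow> (nat ^ 'n) set \<Rightarrow> ('b, 'n) presentation set set"
  where "hilb B lt \<Delta> = hilb_presentations B lt \<Delta> // hilb_equiv B lt \<Delta>"

text \<open>
  Base change along \<open>f : B \<rightarrow> B'\<close>: \<open>Q \<otimes>\<^sub>B B'\<close> is the free \<open>B'\<close>-module on the generators \<open>q \<otimes> 1 = single B' q\<close>, multiplied by
  \<open>(q \<otimes> 1) (q' \<otimes> 1) = q q' \<otimes> 1\<close>, modulo additivity in \<open>q\<close> and \<open>b q \<otimes> 1 = f b (q \<otimes> 1)\<close>.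
\<close>

definition base_change_ideal ::
  "('b, 'r) ring_scheme \<Rightarrow> ('c, 's) ring_scheme \<Rightarrow> ('b \<Rightarrow> 'c) \<Rightarrow> ('b, 'q, 'p) module_scheme \<Rightarrow> ('q \<Rightarrow> 'c) set"
  where "base_change_ideal B B' f Q = (let A = monoid_algebra B' Q in
    Idl\<^bsub>A\<^esub> ({single B' (q \<oplus>\<^bsub>Q\<^esub> q') \<ominus>\<^bsub>A\<^esub> (single B' q \<oplus>\<^bsub>A\<^esub> single B' q') | q q'.
            q \<in> carrier Q \<and> q' \<in> carrier Q}
        \<union> {single B' (b \<odot>\<^bsub>Q\<^esub> q) \<ominus>\<^bsub>A\<^esub> (f b \<odot>\<^bsub>A\<^esub> single B' q) | b q.
            b \<in> carrier B \<and> q \<in> carrier Q}))"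

definition base_change ::
  "('b, 'r) ring_scheme \<Rightarrow> ('c, 's) ring_scheme \<Rightarrow> ('b \<Rightarrow> 'c) \<Rightarrow> ('b, 'q, 'p) module_scheme \<Rightarrow>
    ('c, ('q \<Rightarrow> 'c) set) module"
  where "base_change B B' f Q = quot_algebra (monoid_algebra B' Q) (base_change_ideal B B' f Q)"

text \<open>The map \<open>\<phi> \<otimes> id : B'[x] \<rightarrow> Q \<otimes>\<^sub>B B'\<close>, \<open>\<Sum> c\<^sub>\<alpha> x\<^sup>\<alpha> \<mapsto> \<Sum> c\<^sub>\<alpha> (\<phi>(x\<^sup>\<alpha>) \<otimes> 1)\<close>.\<close>

definition base_change_map ::
  "('b, 'r) ring_scheme \<Rightarrow> ('c, 's) ring_scheme \<Rightarrow> ('b \<Rightarrow> 'c) \<Rightarrow> ('b, 'q, 'p) module_scheme \<Rightarrow>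
    ((nat ^ 'n::finite \<Rightarrow> 'b) \<Rightarrow> 'q) \<Rightarrow> (nat ^ 'n \<Rightarrow> 'c) \<Rightarrow> ('q \<Rightarrow> 'c) set"
  where "base_change_map B B' f Q \<phi> p = (let A = monoid_algebra B' Q in
    base_change_ideal B B' f Q +>\<^bsub>A\<^esub>
      (\<Oplus>\<^bsub>A\<^esub>\<alpha>\<in>{\<alpha>. p \<alpha> \<noteq> \<zero>\<^bsub>B'\<^esub>}. p \<alpha> \<odot>\<^bsub>A\<^esub> single B' (\<phi> (single B \<alpha>))))"

text \<open>
  The class of \<open>\<phi>\<close> goes to the class of \<open>\<phi> \<otimes> id\<close>.  The ring \<open>Q \<otimes>\<^sub>B B'\<close> has another element type
  than the members of the class, which is therefore given by the kernel of \<open>\<phi> \<otimes> id\<close>.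
\<close>

definition hilb_map ::
  "('b, 'r) ring_scheme \<Rightarrow> ('c, 's) ring_scheme \<Rightarrow> (nat ^ 'n::finite \<Rightarrow> nat ^ 'n \<Rightarrow> bool) \<Rightarrow> (nat ^ 'n) set \<Rightarrow>
    ('b \<Rightarrow> 'c) \<Rightarrow> ('b, 'n) presentation set \<Rightarrow> ('c, 'n) presentation set"
  where "hilb_map B B' lt \<Delta> f X =
    {(Q', \<phi>') \<in> hilb_presentations B' lt \<Delta>. \<exists>(Q, \<phi>)\<in>X.
      a_kernel (poly_algebra B') Q' \<phi>' =
      a_kernel (poly_algebra B') (base_change B B' f Q) (base_change_map B B' f Q \<phi>)}"

definition T_index :: "(nat ^ 'n::finite) set \<Rightarrow> (nat ^ 'n) set \<Rightarrow> ((nat ^ 'n) \<times> (nat ^ 'n)) set"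
  where "T_index N \<Delta> = (N \<union> border N) \<times> \<Delta>"

definition R_ring ::
  "('k, 'r) ring_scheme \<Rightarrow> (nat ^ 'n::finite) set \<Rightarrow> (nat ^ 'n) set \<Rightarrow>
    ('k, ((nat ^ 'n) \<times> (nat ^ 'n)) multiset \<Rightarrow> 'k) module"
  where "R_ring K N \<Delta> = var_poly_algebra K (T_index N \<Delta>)"

definition T_var ::
  "('k, 'r) ring_scheme \<Rightarrow> nat ^ 'n::finite \<Rightarrow> nat ^ 'n \<Rightarrow> ((nat ^ 'n) \<times> (nat ^ 'n)) multiset \<Rightarrow> 'k"
  where "T_var K \<alpha> \<beta> = single K {#(\<alpha>, \<beta>)#}"

definition T_product_sum ::
  "('k, 'r) ring_scheme \<Rightarrow> (nat ^ 'n::finite) set \<Rightarrow> (nat ^ 'n) set \<Rightarrow>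
    nat ^ 'n \<Rightarrow> nat ^ 'n \<Rightarrow> nat ^ 'n \<Rightarrow> ((nat ^ 'n) \<times> (nat ^ 'n)) multiset \<Rightarrow> 'k"
  where "T_product_sum K N \<Delta> \<alpha> e \<beta> =
    (\<Oplus>\<^bsub>R_ring K N \<Delta>\<^esub>\<gamma>\<in>\<Delta>. T_var K \<alpha> \<gamma> \<otimes>\<^bsub>R_ring K N \<Delta>\<^esub> T_var K (\<gamma> + e) \<beta>)"

definition I1 ::
  "('k, 'r) ring_scheme \<Rightarrow> (nat ^ 'n::finite) set \<Rightarrow> (nat ^ 'n) set \<Rightarrow>
    (((nat ^ 'n) \<times> (nat ^ 'n)) multiset \<Rightarrow> 'k) set"
  where "I1 K N \<Delta> = (let R = R_ring K N \<Delta> in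
    Idl\<^bsub>R\<^esub> {T_var K \<alpha> \<beta> \<ominus>\<^bsub>R\<^esub> (if \<alpha> = \<beta> then \<one>\<^bsub>R\<^esub> else \<zero>\<^bsub>R\<^esub>) | \<alpha> \<beta>. \<alpha> \<in> \<Delta> \<and> \<beta> \<in> \<Delta>})"

definition I2 ::
  "('k, 'r) ring_scheme \<Rightarrow> (nat ^ 'n::finite) set \<Rightarrow> (nat ^ 'n) set \<Rightarrow>
    (((nat ^ 'n) \<times> (nat ^ 'n)) multiset \<Rightarrow> 'k) set"
  where "I2 K N \<Delta> = (let R = R_ring K N \<Delta> in
    Idl\<^bsub>R\<^esub> {T_var K (\<alpha> + e) \<beta> \<ominus>\<^bsub>R\<^esub> T_product_sum K N \<Delta> \<alpha> e \<beta> | \<alpha> e \<beta>.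
      \<alpha> \<in> N \<union> border N \<and> e \<in> range (\<lambda>i. axis i 1) \<and> \<alpha> + e \<in> N \<union> border N \<and> \<beta> \<in> \<Delta>})"

definition I3 ::
  "('k, 'r) ring_scheme \<Rightarrow> (nat ^ 'n::finite) set \<Rightarrow> (nat ^ 'n) set \<Rightarrow>
    (((nat ^ 'n) \<times> (nat ^ 'n)) multiset \<Rightarrow> 'k) set"
  where "I3 K N \<Delta> = (let R = R_ring K N \<Delta> in
    Idl\<^bsub>R\<^esub> {T_product_sum K N \<Delta> \<alpha> e \<beta> \<ominus>\<^bsub>R\<^esub> T_product_sum K N \<Delta> \<alpha>' e' \<beta> | \<alpha> e \<alpha>' e' \<beta>.
      \<alpha> \<in> border N \<and> \<alpha>' \<in> border N \<and> e \<in> range (\<lambda>i. axis i 1) \<and> e' \<in> range (\<lambda>i. axis i 1) \<and>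
      \<alpha> + e = \<alpha>' + e' \<and> \<alpha> + e \<in> border2 N \<and> \<beta> \<in> \<Delta>})"

definition I_Delta ::
  "('k, 'r) ring_scheme \<Rightarrow> (nat ^ 'n::finite) set \<Rightarrow> (nat ^ 'n) set \<Rightarrow>
    (((nat ^ 'n) \<times> (nat ^ 'n)) multiset \<Rightarrow> 'k) set"
  where "I_Delta K N \<Delta> =
    I1 K N \<Delta> <+>\<^bsub>R_ring K N \<Delta>\<^esub> I2 K N \<Delta> <+>\<^bsub>R_ring K N \<Delta>\<^esub> I3 K N \<Delta>"

definition I_prec_Delta ::
  "('k, 'r) ring_scheme \<Rightarrow> (nat ^ 'n::finite \<Rightarrow> nat ^ 'n \<Rightarrow> bool) \<Rightarrow> (nat ^ 'n) set \<Rightarrow> (nat ^ 'n) set \<Rightarrow>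
    (((nat ^ 'n) \<times> (nat ^ 'n)) multiset \<Rightarrow> 'k) set"
  where "I_prec_Delta K lt N \<Delta> =
    I_Delta K N \<Delta> <+>\<^bsub>R_ring K N \<Delta>\<^esub>
    Idl\<^bsub>R_ring K N \<Delta>\<^esub> {T_var K \<alpha> \<beta> | \<alpha> \<beta>. \<alpha> \<in> N \<union> border N \<and> \<beta> \<in> \<Delta> \<and> lt \<alpha> \<beta>}"

definition R_prec_Delta ::
  "('k, 'r) ring_scheme \<Rightarrow> (nat ^ 'n::finite \<Rightarrow> nat ^ 'n \<Rightarrow> bool) \<Rightarrow> (nat ^ 'n) set \<Rightarrow> (nat ^ 'n) set \<Rightarrow>
    ('k, (((nat ^ 'n) \<times> (nat ^ 'n)) multiset \<Rightarrow> 'k) set) module"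
  where "R_prec_Delta K lt N \<Delta> = quot_algebra (R_ring K N \<Delta>) (I_prec_Delta K lt N \<Delta>)"

definition T_class ::
  "('k, 'r) ring_scheme \<Rightarrow> (nat ^ 'n::finite \<Rightarrow> nat ^ 'n \<Rightarrow> bool) \<Rightarrow> (nat ^ 'n) set \<Rightarrow> (nat ^ 'n) set \<Rightarrow>
    nat ^ 'n \<Rightarrow> nat ^ 'n \<Rightarrow> (((nat ^ 'n) \<times> (nat ^ 'n)) multiset \<Rightarrow> 'k) set"
  where "T_class K lt N \<Delta> \<alpha> \<beta> = I_prec_Delta K lt N \<Delta> +>\<^bsub>R_ring K N \<Delta>\<^esub> T_var K \<alpha> \<beta>"

text \<open>
  The point of \<open>hilb B\<close> attached to \<open>h : R\<^sup>\<prec>\<^sup>\<Delta> \<rightarrow> B\<close>, as the set of all presentations with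
  \<open>\<phi>(x\<^sup>\<alpha>) = \<Sum>\<^sub>\<beta> h(T\<^sub>\<alpha>\<^sub>,\<^sub>\<beta>) \<phi>(x\<^sup>\<beta>)\<close>.  That this set is a single equivalence class
  is not built into the definition.
\<close>

definition hilb_point ::
  "('k, 'r) ring_scheme \<Rightarrow> (nat ^ 'n::finite \<Rightarrow> nat ^ 'n \<Rightarrow> bool) \<Rightarrow> (nat ^ 'n) set \<Rightarrow> (nat ^ 'n) set \<Rightarrow>
    ('b, 's) ring_scheme \<Rightarrow> ((((nat ^ 'n) \<times> (nat ^ 'n)) multiset \<Rightarrow> 'k) set \<Rightarrow> 'b) \<Rightarrow> ('b, 'n) presentation set"
  where "hilb_point K lt N \<Delta> B h =
    {(Q, \<phi>) \<in> hilb_presentations B lt \<Delta>. \<forall>\<alpha>\<in>N \<union> border N.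
      \<phi> (single B \<alpha>) =
        (\<Oplus>\<^bsub>Q\<^esub>\<beta>\<in>\<Delta>. h (T_class K lt N \<Delta> \<alpha> \<beta>) \<odot>\<^bsub>Q\<^esub> \<phi> (single B \<beta>))}"

end

theory Submission
  imports Defs
begin

text \<open>
  A point of the functor over \<open>B\<close> is a matrix \<open>a\<close> of normal forms \<open>x\<^sup>\<alpha> \<equiv> \<Sum>\<^sub>\<beta> a\<^sub>\<alpha>\<^sub>\<beta> x\<^sup>\<beta>\<close>.
  Given a solution \<open>a\<close> of the equations defining \<open>I\<^sup>\<prec>\<^sup>\<Delta>\<close>, let \<open>M\<^sub>i\<close> be the matrix with rows
  \<open>a\<^sub>\<gamma>\<^sub>+\<^sub>e\<^sub>i\<close>, \<open>\<gamma> \<in> \<Delta>\<close>.  The generators of \<open>I\<^sup>\<Delta>\<^sub>2\<close> and \<open>I\<^sup>\<Delta>\<^sub>3\<close> say exactly that the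
  \<open>M\<^sub>i\<close> commute and that \<open>a\<^sub>\<alpha>\<close> is the row of \<open>M\<^sup>\<alpha>\<close> with index \<open>0\<close>, so \<open>B\<^sup>\<Delta>\<close> becomes a cyclic
  \<open>B[x]\<close>-module generated by \<open>x\<^sup>0\<close>, and the annihilator of the generator is the wanted ideal.  The
  vanishing of \<open>a\<^sub>\<alpha>\<^sub>\<beta>\<close> for \<open>\<alpha> \<prec> \<beta>\<close> propagates to all powers of the \<open>M\<^sub>i\<close>, which makes the
  ideal monic with standard set \<open>\<Delta>\<close>.  Conversely a monic ideal with standard set \<open>\<Delta>\<close> has unique
  normal forms, and uniqueness forces the equations.
\<close>

section \<open>Monoid algebras\<close>

text \<open>A class contains surjections onto arbitrary algebras, so points are compared through
  kernels: each matrix has a canonical presentation B[x]/K, and a presentation belongs to the matrix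
  iff its kernel is K. Base change is the delicate place, because the tensor product is a quotient
  of the large algebra B'[Q]; the kernel is found by mapping both into that quotient and out of it.

  Existence of normal forms modulo a monic ideal is a division process, which ends because the order
  is well-founded; the same induction gives the vanishing for \<alpha> \<prec> \<beta>.

  B[x], the ring in the variables T and B'[Q] are all monoid algebras. One calculus serves them:
  linear maps with arbitrary values on the basis, which are evaluated on a product one factor at a
  time and which separate elements. The coordinates of a normal form are such functionals, and the
  ideal of a matrix is their common kernel.\<close>

lemma (in abelian_monoid) finsum_swap:
  assumes "finite S" "finite T" "\<And>u v. u \<in> S \<Longrightarrow> v \<in> T \<Longrightarrow> g u v \<in> carrier G"
  shows "(\<Oplus>u\<in>S. \<Oplus>v\<in>T. g u v) = (\<Oplus>v\<in>T. \<Oplus>u\<in>S. g u v)"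
  using assms
proof (induction S rule: finite_induct)
  case empty
  then show ?case by simp
next
  case (insert x S)
  have "(\<Oplus>u\<in>insert x S. \<Oplus>v\<in>T. g u v) = (\<Oplus>v\<in>T. g x v) \<oplus> (\<Oplus>u\<in>S. \<Oplus>v\<in>T. g u v)"
    using insert by (intro finsum_insert) (auto intro!: finsum_closed)
  also have "\<dots> = (\<Oplus>v\<in>T. g x v) \<oplus> (\<Oplus>v\<in>T. \<Oplus>u\<in>S. g u v)"
    using insert by simp
  also have "\<dots> = (\<Oplus>v\<in>T. g x v \<oplus> (\<Oplus>u\<in>S. g u v))"
    using insert by (intro finsum_addf[symmetric]) (auto intro!: finsum_closed)
  also have "\<dots> = (\<Oplus>v\<in>T. \<Oplus>u\<in>insert x S. g u v)"
    using insert by (intro finsum_cong' refl) (auto intro!: finsum_insert[symmetric] finsum_closed)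
  finally show ?case .
qed

lemma (in abelian_monoid) finsum_single:
  assumes "finite S" "w \<in> S" "x \<in> carrier G"
  shows "(\<Oplus>u\<in>S. if u = w then x else \<zero>) = x"
  using add.finprod_singleton[of w S "\<lambda>_. x"] assms by (simp add: eq_commute)

text \<open>Only additive behaviour is asked of \<open>h\<close>, since one map to which this is
  applied, q \<mapsto> q \<otimes> 1 in the base change, is merely semilinear.\<close>

lemma finsum_additive:
  assumes "abelian_monoid G" "abelian_monoid H" "h \<in> carrier G \<rightarrow> carrier H" "h \<zero>\<^bsub>G\<^esub> = \<zero>\<^bsub>H\<^esub>"
    "\<And>x y. x \<in> carrier G \<Longrightarrow> y \<in> carrier G \<Longrightarrow> h (x \<oplus>\<^bsub>G\<^esub> y) = h x \<oplus>\<^bsub>H\<^esub> h y"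
    "finite S" "g \<in> S \<rightarrow> carrier G"
  shows "h (\<Oplus>\<^bsub>G\<^esub>u\<in>S. g u) = (\<Oplus>\<^bsub>H\<^esub>u\<in>S. h (g u))"
proof -
  interpret G: abelian_monoid G by fact
  interpret H: abelian_monoid H by fact
  have [simp]: "h x \<in> carrier H" if "x \<in> carrier G" for x using that assms(3) by auto
  show ?thesis
    using assms(6,7)
    by (induction S rule: finite_induct) (auto simp: assms(4,5) Pi_def)
qed

lemma (in abelian_group) minus_eq_zero_iff:
  "x \<in> carrier G \<Longrightarrow> y \<in> carrier G \<Longrightarrow> x \<ominus> y = \<zero> \<longleftrightarrow> x = y"
  by (metis a_minus_def add.inv_solve_right' l_zero zero_closed)

lemma (in module) finsum_smult_rdistr:
  assumes "finite S" "x \<in> carrier M" "\<And>u. u \<in> S \<Longrightarrow> g u \<in> carrier R"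
  shows "(\<Oplus>u\<in>S. g u) \<odot>\<^bsub>M\<^esub> x = (\<Oplus>\<^bsub>M\<^esub>u\<in>S. g u \<odot>\<^bsub>M\<^esub> x)"
  using assms
proof (induction S rule: finite_induct)
  case (insert u S)
  then have "(\<Oplus>u\<in>insert u S. g u) \<odot>\<^bsub>M\<^esub> x = (g u \<oplus> (\<Oplus>u\<in>S. g u)) \<odot>\<^bsub>M\<^esub> x"
    by (simp add: Pi_def)
  then show ?case
    using insert by (simp add: Pi_def smult_l_distr)
qed simp

text \<open>Restriction of scalars along \<open>f\<close>. For \<open>f = id\<close> it is the ring
  as a module over itself, the target of linear functionals; for a composite B \<rightarrow> B'
  \<rightarrow> C it lets a B'-algebra receive maps from B-algebras.\<close>

definition algebra_via :: "('a \<Rightarrow> 'c) \<Rightarrow> ('c, 'r) ring_scheme \<Rightarrow> ('a, 'c) module"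
  where "algebra_via f C =
    \<lparr>carrier = carrier C, mult = mult C, one = one C, zero = zero C, add = add C,
     smult = (\<lambda>a x. f a \<otimes>\<^bsub>C\<^esub> x)\<rparr>"

lemma algebra_via_simps [simp]:
  "carrier (algebra_via f C) = carrier C" "mult (algebra_via f C) = mult C"
  "one (algebra_via f C) = one C" "zero (algebra_via f C) = zero C"
  "add (algebra_via f C) = add C" "a \<odot>\<^bsub>algebra_via f C\<^esub> x = f a \<otimes>\<^bsub>C\<^esub> x"
  "finsum (algebra_via f C) = finsum C"
  by (auto simp: algebra_via_def finsum_def finprod_def fun_eq_iff)

lemma algebra_algebra_via:
  assumes "cring A" "cring C" "f \<in> ring_hom A C"
  shows "algebra A (algebra_via f C)"
proof -
  interpret A: cring A by fact
  interpret C: cring C by fact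
  interpret h: ring_hom_cring A C f 
    using assms by (simp add: ring_hom_cring.intro ring_hom_cring_axioms.intro)
  have "cring (algebra_via f C)"
  proof (rule cringI)
    show "abelian_group (algebra_via f C)"
      proof (rule abelian_groupI)
      fix x assume "x \<in> carrier (algebra_via f C)"
      then show "\<exists>y\<in>carrier (algebra_via f C). y \<oplus>\<^bsub>algebra_via f C\<^esub> x = \<zero>\<^bsub>algebra_via f C\<^esub>"
        using C.l_neg by (intro bexI[of _ "\<ominus>\<^bsub>C\<^esub> x"]) auto
    qed (auto simp: C.a_ac)
    show "comm_monoid (algebra_via f C)"
      by (rule comm_monoidI) (auto simp: C.m_assoc intro: C.m_comm)
  qed (auto simp: C.l_distr)
  then show ?thesis
    using assms by (intro algebraI) (auto simp: C.l_distr C.r_distr C.m_assoc)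
qed

text \<open>The linear map out of the free module on the monoid that sends the basis element
  \<open>single A u\<close> to \<open>l u\<close>. No multiplicativity of \<open>l\<close> is built
  in, so functionals such as coefficients are covered.\<close>

definition lin_ext ::
  "('a, 'r) ring_scheme \<Rightarrow> ('a, 'c, 's) module_scheme \<Rightarrow> ('m \<Rightarrow> 'c) \<Rightarrow> ('m \<Rightarrow> 'a) \<Rightarrow> 'c"
  where "lin_ext A C l p = (\<Oplus>\<^bsub>C\<^esub>u\<in>{u. p u \<noteq> \<zero>\<^bsub>A\<^esub>}. p u \<odot>\<^bsub>C\<^esub> l u)"

lemma carrier_monoid_algebra:
  "p \<in> carrier (monoid_algebra A M) \<longleftrightarrow>
    (\<forall>u. p u \<in> carrier A) \<and> (\<forall>u. u \<notin> carrier M \<longrightarrow> p u = \<zero>\<^bsub>A\<^esub>) \<and> finite {u. p u \<noteq> \<zero>\<^bsub>A\<^esub>}"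
  by (simp add: monoid_algebra_def)

lemma monoid_algebra_simps [simp]:
  "\<zero>\<^bsub>monoid_algebra A M\<^esub> = (\<lambda>u. \<zero>\<^bsub>A\<^esub>)"
  "p \<oplus>\<^bsub>monoid_algebra A M\<^esub> q = (\<lambda>u. p u \<oplus>\<^bsub>A\<^esub> q u)"
  "c \<odot>\<^bsub>monoid_algebra A M\<^esub> p = (\<lambda>u. c \<otimes>\<^bsub>A\<^esub> p u)"
  by (simp_all add: monoid_algebra_def)

lemma one_monoid_algebra: "\<one>\<^bsub>monoid_algebra A M\<^esub> = single A \<one>\<^bsub>M\<^esub>"
  by (auto simp: monoid_algebra_def single_def)

text \<open>Three instances are used: exponents give B[x], multisets of variables give the ring in
  the T, and the multiplicative monoid of an algebra Q gives the algebra B'[Q] behind the tensor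
  product.\<close>

locale monoid_ring = A: cring A + M: comm_monoid M for A (structure) and M (structure)
begin

abbreviation "P \<equiv> monoid_algebra A M"

lemma carrierD:
  assumes "p \<in> carrier P"
  shows "p u \<in> carrier A" "p u \<noteq> \<zero>\<^bsub>A\<^esub> \<Longrightarrow> u \<in> carrier M" "finite {u. p u \<noteq> \<zero>\<^bsub>A\<^esub>}"
  using assms by (auto simp: carrier_monoid_algebra)

lemma single_closed [simp, intro]: "w \<in> carrier M \<Longrightarrow> single A w \<in> carrier P"
  by (auto simp: carrier_monoid_algebra single_def)

lemma module_P: "module A P"
proof (rule moduleI)
  show "abelian_group P"
  proof (rule abelian_groupI)
    fix p q assume "p \<in> carrier P" "q \<in> carrier P"
    then show "p \<oplus>\<^bsub>P\<^esub> q \<in> carrier P"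
      by (auto simp: carrier_monoid_algebra
          intro!: finite_subset[of _ "{u. p u \<noteq> \<zero>\<^bsub>A\<^esub>} \<union> {u. q u \<noteq> \<zero>\<^bsub>A\<^esub>}"])
  next
    fix p assume p: "p \<in> carrier P"
    show "\<exists>q\<in>carrier P. q \<oplus>\<^bsub>P\<^esub> p = \<zero>\<^bsub>P\<^esub>"
    proof
      show "(\<lambda>u. \<ominus>\<^bsub>A\<^esub> p u) \<in> carrier P"
        using p by (auto simp: carrier_monoid_algebra
            intro!: finite_subset[of _ "{u. p u \<noteq> \<zero>\<^bsub>A\<^esub>}"])
      show "(\<lambda>u. \<ominus>\<^bsub>A\<^esub> p u) \<oplus>\<^bsub>P\<^esub> p = \<zero>\<^bsub>P\<^esub>"
        using p by (auto simp: carrier_monoid_algebra A.l_neg)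
    qed
  qed (auto simp: carrier_monoid_algebra A.a_ac)
next
  fix a p assume "a \<in> carrier A" "p \<in> carrier P"
  then show "a \<odot>\<^bsub>P\<^esub> p \<in> carrier P"
    by (auto simp: carrier_monoid_algebra intro!: finite_subset[of _ "{u. p u \<noteq> \<zero>\<^bsub>A\<^esub>}"])
qed (auto simp: carrier_monoid_algebra A.l_distr A.r_distr A.m_assoc A.is_cring)

text \<open>Enlarging the index set beyond the support lets elements with different supports be
  summed over one set.\<close>

lemma lin_ext_eq:
  assumes "module A C" "p \<in> carrier P" "l \<in> carrier M \<rightarrow> carrier C"
    "finite S" "{u. p u \<noteq> \<zero>\<^bsub>A\<^esub>} \<subseteq> S" "S \<subseteq> carrier M"
  shows "lin_ext A C l p = (\<Oplus>\<^bsub>C\<^esub>u\<in>S. p u \<odot>\<^bsub>C\<^esub> l u)"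
proof -
  interpret C: module A C by fact
  show ?thesis
    unfolding lin_ext_def using assms carrierD(1)[OF assms(2)]
    by (intro C.M.add.finprod_mono_neutral_cong_left) (auto simp: subset_eq Pi_def)
qed

lemma lin_ext_closed [intro, simp]:
  assumes "module A C" "p \<in> carrier P" "l \<in> carrier M \<rightarrow> carrier C"
  shows "lin_ext A C l p \<in> carrier C"
proof -
  interpret C: module A C by fact
  show ?thesis
    unfolding lin_ext_def using assms carrierD[OF assms(2)]
    by (intro C.M.finsum_closed) auto
qed

lemma lin_ext_cong:
  assumes "module A C" "p \<in> carrier P" "l \<in> carrier M \<rightarrow> carrier C"
    "\<And>u. u \<in> carrier M \<Longrightarrow> l u = l' u"
  shows "lin_ext A C l p = lin_ext A C l' p"
proof -
  interpret C: module A C by fact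
  have "l' u \<in> carrier C" if "u \<in> carrier M" for u
    using assms that by (metis PiE)
  then show ?thesis
    unfolding lin_ext_def using assms carrierD[OF assms(2)]
    by (intro C.M.finsum_cong') auto
qed

lemma lin_ext_add:
  assumes "module A C" "p \<in> carrier P" "q \<in> carrier P" "l \<in> carrier M \<rightarrow> carrier C"
  shows "lin_ext A C l (p \<oplus>\<^bsub>P\<^esub> q) = lin_ext A C l p \<oplus>\<^bsub>C\<^esub> lin_ext A C l q"
proof -
  interpret C: module A C by fact
  interpret P: module A P by (rule module_P)
  define S where "S = {u. p u \<noteq> \<zero>\<^bsub>A\<^esub>} \<union> {u. q u \<noteq> \<zero>\<^bsub>A\<^esub>}"
  have S: "finite S" "{u. p u \<noteq> \<zero>\<^bsub>A\<^esub>} \<subseteq> S" "{u. q u \<noteq> \<zero>\<^bsub>A\<^esub>} \<subseteq> S"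
    "{u. (p \<oplus>\<^bsub>P\<^esub> q) u \<noteq> \<zero>\<^bsub>A\<^esub>} \<subseteq> S" "S \<subseteq> carrier M"
    using assms(2,3) by (auto simp: S_def carrier_monoid_algebra)
  have [simp]: "l u \<in> carrier C" if "u \<in> S" for u
    using assms(4) S that by auto
  have "lin_ext A C l (p \<oplus>\<^bsub>P\<^esub> q) = (\<Oplus>\<^bsub>C\<^esub>u\<in>S. (p \<oplus>\<^bsub>P\<^esub> q) u \<odot>\<^bsub>C\<^esub> l u)"
    using S assms by (intro lin_ext_eq P.M.a_closed) auto
  also have "\<dots> = (\<Oplus>\<^bsub>C\<^esub>u\<in>S. p u \<odot>\<^bsub>C\<^esub> l u \<oplus>\<^bsub>C\<^esub> q u \<odot>\<^bsub>C\<^esub> l u)"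
    using carrierD(1)[OF assms(2)] carrierD(1)[OF assms(3)]
    by (intro C.M.finsum_cong') (auto simp: C.smult_l_distr)
  also have "\<dots> = (\<Oplus>\<^bsub>C\<^esub>u\<in>S. p u \<odot>\<^bsub>C\<^esub> l u) \<oplus>\<^bsub>C\<^esub> (\<Oplus>\<^bsub>C\<^esub>u\<in>S. q u \<odot>\<^bsub>C\<^esub> l u)"
    using carrierD(1)[OF assms(2)] carrierD(1)[OF assms(3)] S(1)
    by (intro C.M.finsum_addf) auto
  finally show ?thesis
    using S assms by (simp add: lin_ext_eq[OF _ _ _ S(1)])
qed

lemma lin_ext_smult:
  assumes "module A C" "p \<in> carrier P" "a \<in> carrier A" "l \<in> carrier M \<rightarrow> carrier C"
  shows "lin_ext A C l (a \<odot>\<^bsub>P\<^esub> p) = a \<odot>\<^bsub>C\<^esub> lin_ext A C l p"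
proof -
  interpret C: module A C by fact
  interpret P: module A P by (rule module_P)
  define S where "S = {u. p u \<noteq> \<zero>\<^bsub>A\<^esub>}"
  have S: "finite S" "{u. p u \<noteq> \<zero>\<^bsub>A\<^esub>} \<subseteq> S" 
    "{u. (a \<odot>\<^bsub>P\<^esub> p) u \<noteq> \<zero>\<^bsub>A\<^esub>} \<subseteq> S" "S \<subseteq> carrier M"
    using assms(2,3) by (auto simp: S_def carrier_monoid_algebra)
  have [simp]: "l u \<in> carrier C" if "u \<in> S" for u
    using assms(4) S that by auto
  have "lin_ext A C l (a \<odot>\<^bsub>P\<^esub> p) = (\<Oplus>\<^bsub>C\<^esub>u\<in>S. (a \<odot>\<^bsub>P\<^esub> p) u \<odot>\<^bsub>C\<^esub> l u)"
    using S assms by (intro lin_ext_eq P.smult_closed) auto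
  also have "\<dots> = (\<Oplus>\<^bsub>C\<^esub>u\<in>S. a \<odot>\<^bsub>C\<^esub> (p u \<odot>\<^bsub>C\<^esub> l u))"
    using carrierD(1)[OF assms(2)] assms
    by (intro C.M.finsum_cong') (auto simp: C.smult_assoc1)
  also have "\<dots> = a \<odot>\<^bsub>C\<^esub> (\<Oplus>\<^bsub>C\<^esub>u\<in>S. p u \<odot>\<^bsub>C\<^esub> l u)"
    using carrierD(1)[OF assms(2)] S(1) assms
    by (intro C.finsum_smult_ldistr[symmetric]) auto
  finally show ?thesis
    using S assms by (simp add: lin_ext_eq[OF _ _ _ S(1)])
qed

lemma lin_ext_single:
  assumes "module A C" "w \<in> carrier M" "l \<in> carrier M \<rightarrow> carrier C"
  shows "lin_ext A C l (single A w) = l w"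
proof -
  interpret C: module A C by fact
  have "lin_ext A C l (single A w) = (\<Oplus>\<^bsub>C\<^esub>u\<in>{w}. single A w u \<odot>\<^bsub>C\<^esub> l u)"
    using assms single_closed[OF assms(2)] by (intro lin_ext_eq) (auto simp: single_def)
  then show ?thesis using assms by (auto simp: single_def Pi_def)
qed

text \<open>If all values on the basis are combinations of finitely many fixed vectors, then so is
  the value at \<open>p\<close>, and each coefficient is a functional of \<open>p\<close>. This is
  how \<open>coord\<close> becomes the coefficient of a normal form.\<close>

lemma lin_ext_finsum:
  assumes "module A C" "p \<in> carrier P" "finite D" "y \<in> D \<rightarrow> carrier C"
    "\<And>u v. u \<in> carrier M \<Longrightarrow> v \<in> D \<Longrightarrow> g u v \<in> carrier A"
  shows "lin_ext A C (\<lambda>u. \<Oplus>\<^bsub>C\<^esub>v\<in>D. g u v \<odot>\<^bsub>C\<^esub> y v) p =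
    (\<Oplus>\<^bsub>C\<^esub>v\<in>D. lin_ext A (algebra_via id A) (\<lambda>u. g u v) p \<odot>\<^bsub>C\<^esub> y v)"
proof -
  interpret C: module A C by fact
  define S where "S = {u. p u \<noteq> \<zero>\<^bsub>A\<^esub>}"
  have S: "finite S" "S \<subseteq> carrier M"
    using assms(2) by (auto simp: S_def carrier_monoid_algebra)
  have [simp]: "y v \<in> carrier C" if "v \<in> D" for v using assms that by auto
  have [simp]: "g u v \<in> carrier A" if "u \<in> S" "v \<in> D" for u v using assms(5) S that by auto
  note [simp] = carrierD(1)[OF assms(2)]
  have "lin_ext A C (\<lambda>u. \<Oplus>\<^bsub>C\<^esub>v\<in>D. g u v \<odot>\<^bsub>C\<^esub> y v) p
      = (\<Oplus>\<^bsub>C\<^esub>u\<in>S. \<Oplus>\<^bsub>C\<^esub>v\<in>D. (p u \<otimes>\<^bsub>A\<^esub> g u v) \<odot>\<^bsub>C\<^esub> y v)"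
    unfolding lin_ext_def S_def[symmetric] using assms(3)
    by (intro C.M.finsum_cong')
       (auto simp: C.finsum_smult_ldistr C.smult_assoc1 Pi_def intro!: C.M.finsum_closed C.M.finsum_cong')
  also have "\<dots> = (\<Oplus>\<^bsub>C\<^esub>v\<in>D. \<Oplus>\<^bsub>C\<^esub>u\<in>S. (p u \<otimes>\<^bsub>A\<^esub> g u v) \<odot>\<^bsub>C\<^esub> y v)"
    using S assms(3) by (intro C.M.finsum_swap) auto
  also have "\<dots> = (\<Oplus>\<^bsub>C\<^esub>v\<in>D. lin_ext A (algebra_via id A) (\<lambda>u. g u v) p \<odot>\<^bsub>C\<^esub> y v)"
    unfolding lin_ext_def S_def[symmetric] using S(1)
    by (intro C.M.finsum_cong')
       (auto simp: C.finsum_smult_rdistr intro!: C.M.finsum_closed A.finsum_closed)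
  finally show ?thesis .
qed

text \<open>The index set of the convolution depends on \<open>w\<close>. With an indicator in the
  summand it becomes the product of the two supports, so that sums can be interchanged.\<close>

lemma mult_P_eq:
  assumes "p \<in> carrier P" "q \<in> carrier P"
  shows "(p \<otimes>\<^bsub>P\<^esub> q) w =
    (\<Oplus>\<^bsub>A\<^esub>u\<in>{u. p u \<noteq> \<zero>\<^bsub>A\<^esub>}. \<Oplus>\<^bsub>A\<^esub>v\<in>{v. q v \<noteq> \<zero>\<^bsub>A\<^esub>}. if u \<otimes>\<^bsub>M\<^esub> v = w then p u \<otimes>\<^bsub>A\<^esub> q v else \<zero>\<^bsub>A\<^esub>)"
proof -
  define S where "S = {u. p u \<noteq> \<zero>\<^bsub>A\<^esub>}"
  define T where "T = {v. q v \<noteq> \<zero>\<^bsub>A\<^esub>}"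
  have fin: "finite S" "finite T" using assms by (auto simp: S_def T_def carrierD)
  note [simp] = carrierD(1)[OF assms(1)] carrierD(1)[OF assms(2)]
  have "(p \<otimes>\<^bsub>P\<^esub> q) w = finsum A (\<lambda>(u, v). p u \<otimes>\<^bsub>A\<^esub> q v) (\<Union>u\<in>S. Pair u ` {v\<in>T. u \<otimes>\<^bsub>M\<^esub> v = w})"
    unfolding monoid_algebra_def by (auto simp: S_def T_def intro!: arg_cong[where f = "finsum A _"])
  also have "\<dots> = (\<Oplus>\<^bsub>A\<^esub>u\<in>S. finsum A (\<lambda>(u, v). p u \<otimes>\<^bsub>A\<^esub> q v) (Pair u ` {v\<in>T. u \<otimes>\<^bsub>M\<^esub> v = w}))"
    using fin by (intro A.add.finprod_UN_disjoint) (auto simp: pairwise_def disjnt_def)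
  also have "\<dots> = (\<Oplus>\<^bsub>A\<^esub>u\<in>S. \<Oplus>\<^bsub>A\<^esub>v\<in>{v\<in>T. u \<otimes>\<^bsub>M\<^esub> v = w}. p u \<otimes>\<^bsub>A\<^esub> q v)"
  proof (rule A.finsum_cong'[OF refl])
    fix u
    show "finsum A (\<lambda>(u, v). p u \<otimes>\<^bsub>A\<^esub> q v) (Pair u ` {v\<in>T. u \<otimes>\<^bsub>M\<^esub> v = w})
        = (\<Oplus>\<^bsub>A\<^esub>v\<in>{v\<in>T. u \<otimes>\<^bsub>M\<^esub> v = w}. p u \<otimes>\<^bsub>A\<^esub> q v)"
      by (subst A.finsum_reindex) (auto simp: inj_on_def)
  qed (auto intro!: A.finsum_closed)
  also have "\<dots> = (\<Oplus>\<^bsub>A\<^esub>u\<in>S. \<Oplus>\<^bsub>A\<^esub>v\<in>T. if u \<otimes>\<^bsub>M\<^esub> v = w then p u \<otimes>\<^bsub>A\<^esub> q v else \<zero>\<^bsub>A\<^esub>)"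
  proof (rule A.finsum_cong'[OF refl])
    fix u
    show "(\<Oplus>\<^bsub>A\<^esub>v\<in>{v\<in>T. u \<otimes>\<^bsub>M\<^esub> v = w}. p u \<otimes>\<^bsub>A\<^esub> q v)
        = (\<Oplus>\<^bsub>A\<^esub>v\<in>T. if u \<otimes>\<^bsub>M\<^esub> v = w then p u \<otimes>\<^bsub>A\<^esub> q v else \<zero>\<^bsub>A\<^esub>)"
      by (rule A.add.finprod_mono_neutral_cong_left) (use fin in auto)
  qed (auto intro!: A.finsum_closed)
  finally show ?thesis by (simp add: S_def T_def)
qed

lemma mult_P_closed:
  assumes "p \<in> carrier P" "q \<in> carrier P"
  shows "p \<otimes>\<^bsub>P\<^esub> q \<in> carrier P"
    and "{w. (p \<otimes>\<^bsub>P\<^esub> q) w \<noteq> \<zero>\<^bsub>A\<^esub>} \<subseteq> (\<lambda>(u, v). u \<otimes>\<^bsub>M\<^esub> v) ` ({u. p u \<noteq> \<zero>\<^bsub>A\<^esub>} \<times> {v. q v \<noteq> \<zero>\<^bsub>A\<^esub>})"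
proof -
  note [simp] = carrierD(1)[OF assms(1)] carrierD(1)[OF assms(2)]
  show *: "{w. (p \<otimes>\<^bsub>P\<^esub> q) w \<noteq> \<zero>\<^bsub>A\<^esub>} \<subseteq> (\<lambda>(u, v). u \<otimes>\<^bsub>M\<^esub> v) ` ({u. p u \<noteq> \<zero>\<^bsub>A\<^esub>} \<times> {v. q v \<noteq> \<zero>\<^bsub>A\<^esub>})"
  proof (rule subsetI, rule ccontr)
    fix w assume w: "w \<in> {w. (p \<otimes>\<^bsub>P\<^esub> q) w \<noteq> \<zero>\<^bsub>A\<^esub>}"
      "w \<notin> (\<lambda>(u, v). u \<otimes>\<^bsub>M\<^esub> v) ` ({u. p u \<noteq> \<zero>\<^bsub>A\<^esub>} \<times> {v. q v \<noteq> \<zero>\<^bsub>A\<^esub>})"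
    then have "u \<otimes>\<^bsub>M\<^esub> v \<noteq> w" if "p u \<noteq> \<zero>\<^bsub>A\<^esub>" "q v \<noteq> \<zero>\<^bsub>A\<^esub>" for u v
      using that by auto
    then have "(p \<otimes>\<^bsub>P\<^esub> q) w = \<zero>\<^bsub>A\<^esub>"
      unfolding mult_P_eq[OF assms] by (intro A.add.finprod_one_eqI) auto
    with w show False by simp
  qed
  have "(p \<otimes>\<^bsub>P\<^esub> q) w \<in> carrier A" for w
    unfolding mult_P_eq[OF assms] by (intro A.finsum_closed) auto
  moreover have "(\<lambda>(u, v). u \<otimes>\<^bsub>M\<^esub> v) ` ({u. p u \<noteq> \<zero>\<^bsub>A\<^esub>} \<times> {v. q v \<noteq> \<zero>\<^bsub>A\<^esub>}) \<subseteq> carrier M"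
    using carrierD(2)[OF assms(1)] carrierD(2)[OF assms(2)] by auto
  moreover have "finite ((\<lambda>(u, v). u \<otimes>\<^bsub>M\<^esub> v) ` ({u. p u \<noteq> \<zero>\<^bsub>A\<^esub>} \<times> {v. q v \<noteq> \<zero>\<^bsub>A\<^esub>}))"
    using carrierD(3)[OF assms(1)] carrierD(3)[OF assms(2)] by auto
  ultimately show "p \<otimes>\<^bsub>P\<^esub> q \<in> carrier P"
    using * unfolding carrier_monoid_algebra by (meson finite_subset subsetD mem_Collect_eq)
qed

text \<open>Summing over \<open>w\<close> undoes the convolution: for each pair of basis elements
  only w = u v survives. A functional on products is thus a functional in each factor in turn, which
  reduces ring laws to laws of the monoid.\<close>

lemma lin_ext_mult:
  assumes "module A C" "p \<in> carrier P" "q \<in> carrier P" "l \<in> carrier M \<rightarrow> carrier C"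
  shows "lin_ext A C l (p \<otimes>\<^bsub>P\<^esub> q) = lin_ext A C (\<lambda>u. lin_ext A C (\<lambda>v. l (u \<otimes>\<^bsub>M\<^esub> v)) q) p"
proof -
  interpret C: module A C by fact
  define S where "S = {u. p u \<noteq> \<zero>\<^bsub>A\<^esub>}"
  define T where "T = {v. q v \<noteq> \<zero>\<^bsub>A\<^esub>}"
  define W where "W = (\<lambda>(u, v). u \<otimes>\<^bsub>M\<^esub> v) ` (S \<times> T)"
  have fin: "finite S" "finite T" "finite W" and sub: "S \<subseteq> carrier M" "T \<subseteq> carrier M"
    using carrierD[OF assms(2)] carrierD[OF assms(3)] by (auto simp: S_def T_def W_def)
  then have subW: "W \<subseteq> carrier M" by (auto simp: W_def)
  note [simp] = carrierD(1)[OF assms(2)] carrierD(1)[OF assms(3)]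
  have [simp]: "l w \<in> carrier C" if "w \<in> carrier M" for w using that assms(4) by auto
  have [simp]: "u \<in> carrier M" if "u \<in> S" for u using that sub by auto
  have [simp]: "u \<in> carrier M" if "u \<in> T" for u using that sub by auto
  have [simp]: "u \<in> carrier M" if "u \<in> W" for u using that subW by auto
  have "lin_ext A C l (p \<otimes>\<^bsub>P\<^esub> q) = (\<Oplus>\<^bsub>C\<^esub>w\<in>W. (p \<otimes>\<^bsub>P\<^esub> q) w \<odot>\<^bsub>C\<^esub> l w)"
    using assms fin subW mult_P_closed[OF assms(2,3)]
    by (intro lin_ext_eq) (auto simp: W_def S_def T_def)
  also have "\<dots> = (\<Oplus>\<^bsub>C\<^esub>w\<in>W. \<Oplus>\<^bsub>C\<^esub>u\<in>S. \<Oplus>\<^bsub>C\<^esub>v\<in>T. (if u \<otimes>\<^bsub>M\<^esub> v = w then p u \<otimes>\<^bsub>A\<^esub> q v else \<zero>\<^bsub>A\<^esub>) \<odot>\<^bsub>C\<^esub> l w)"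
    unfolding mult_P_eq[OF assms(2,3)] S_def[symmetric] T_def[symmetric] using fin
    by (intro C.M.finsum_cong') (auto simp: C.finsum_smult_rdistr
        intro!: C.M.finsum_closed C.M.finsum_cong' A.finsum_closed)
  also have "\<dots> = (\<Oplus>\<^bsub>C\<^esub>u\<in>S. \<Oplus>\<^bsub>C\<^esub>v\<in>T. \<Oplus>\<^bsub>C\<^esub>w\<in>W. (if u \<otimes>\<^bsub>M\<^esub> v = w then p u \<otimes>\<^bsub>A\<^esub> q v else \<zero>\<^bsub>A\<^esub>) \<odot>\<^bsub>C\<^esub> l w)"
    using fin by (subst C.M.finsum_swap)
      (auto intro!: C.M.finsum_closed C.M.finsum_cong' C.M.finsum_swap)
  also have "\<dots> = (\<Oplus>\<^bsub>C\<^esub>u\<in>S. \<Oplus>\<^bsub>C\<^esub>v\<in>T. p u \<odot>\<^bsub>C\<^esub> (q v \<odot>\<^bsub>C\<^esub> l (u \<otimes>\<^bsub>M\<^esub> v)))"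
  proof (intro C.M.finsum_cong' refl)
    fix u v assume uv: "u \<in> S" "v \<in> T"
    then have "(\<Oplus>\<^bsub>C\<^esub>w\<in>W. (if u \<otimes>\<^bsub>M\<^esub> v = w then p u \<otimes>\<^bsub>A\<^esub> q v else \<zero>\<^bsub>A\<^esub>) \<odot>\<^bsub>C\<^esub> l w)
       = (\<Oplus>\<^bsub>C\<^esub>w\<in>W. if w = u \<otimes>\<^bsub>M\<^esub> v then (p u \<otimes>\<^bsub>A\<^esub> q v) \<odot>\<^bsub>C\<^esub> l (u \<otimes>\<^bsub>M\<^esub> v) else \<zero>\<^bsub>C\<^esub>)"
      by (intro C.M.finsum_cong') auto
    also have "\<dots> = p u \<odot>\<^bsub>C\<^esub> (q v \<odot>\<^bsub>C\<^esub> l (u \<otimes>\<^bsub>M\<^esub> v))"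
      using uv fin by (subst C.M.finsum_single) (auto simp: W_def C.smult_assoc1)
    finally show "(\<Oplus>\<^bsub>C\<^esub>w\<in>W. (if u \<otimes>\<^bsub>M\<^esub> v = w then p u \<otimes>\<^bsub>A\<^esub> q v else \<zero>\<^bsub>A\<^esub>) \<odot>\<^bsub>C\<^esub> l w)
       = p u \<odot>\<^bsub>C\<^esub> (q v \<odot>\<^bsub>C\<^esub> l (u \<otimes>\<^bsub>M\<^esub> v))" .
  qed (auto intro!: C.M.finsum_closed)
  also have "\<dots> = (\<Oplus>\<^bsub>C\<^esub>u\<in>S. p u \<odot>\<^bsub>C\<^esub> (\<Oplus>\<^bsub>C\<^esub>v\<in>T. q v \<odot>\<^bsub>C\<^esub> l (u \<otimes>\<^bsub>M\<^esub> v)))"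
    using fin by (intro C.M.finsum_cong') (auto intro!: C.M.finsum_closed simp: C.finsum_smult_ldistr)
  finally show ?thesis by (simp add: lin_ext_def S_def T_def)
qed

lemma module_self: "module A (algebra_via id A)"
  using algebra_algebra_via[of A A id] A.is_cring by (simp add: algebra.axioms)

lemma lin_self_closed [intro, simp]:
  assumes "p \<in> carrier P" "l \<in> carrier M \<rightarrow> carrier A"
  shows "lin_ext A (algebra_via id A) l p \<in> carrier A"
  using lin_ext_closed[OF module_self, of p l] assms by simp

lemma lin_ext_coeff:
  assumes "p \<in> carrier P"
  shows "lin_ext A (algebra_via id A) (\<lambda>u. if u = w then \<one>\<^bsub>A\<^esub> else \<zero>\<^bsub>A\<^esub>) p = p w"
proof (cases "p w = \<zero>\<^bsub>A\<^esub>")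
  case True
  then show ?thesis
    using assms carrierD(1)[OF assms] unfolding lin_ext_def by (auto intro!: A.add.finprod_one_eqI)
next
  case False
  have "lin_ext A (algebra_via id A) (\<lambda>u. if u = w then \<one>\<^bsub>A\<^esub> else \<zero>\<^bsub>A\<^esub>) p
      = (\<Oplus>\<^bsub>A\<^esub>u\<in>{u. p u \<noteq> \<zero>\<^bsub>A\<^esub>}. if u = w then p w else \<zero>\<^bsub>A\<^esub>)"
    unfolding lin_ext_def using carrierD(1)[OF assms]
    by (simp, intro A.finsum_cong') auto
  then show ?thesis
    using False carrierD[OF assms] by (simp add: A.finsum_single)
qed

text \<open>The coefficient at \<open>w\<close> is itself the functional whose values are the
  indicator of \<open>w\<close>, so functionals separate elements.\<close>

lemma eqI_lin_ext:
  assumes "p \<in> carrier P" "q \<in> carrier P"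
    "\<And>l. l \<in> carrier M \<rightarrow> carrier A \<Longrightarrow> lin_ext A (algebra_via id A) l p = lin_ext A (algebra_via id A) l q"
  shows "p = q"
proof
  fix w show "p w = q w"
    using assms(3)[of "\<lambda>u. if u = w then \<one>\<^bsub>A\<^esub> else \<zero>\<^bsub>A\<^esub>"] lin_ext_coeff[OF assms(1)]
      lin_ext_coeff[OF assms(2)] by auto
qed

text \<open>The laws of multiplication other than commutativity are tested on functionals, where
  associativity becomes that of the monoid. Commutativity is compared coefficientwise, by
  interchanging the two sums.\<close>

lemma algebra_P: "algebra A P"
proof -
  interpret P: module A P by (rule module_P)
  let ?A = "algebra_via id A"
  note mod = module_self
  have assoc: "(p \<otimes>\<^bsub>P\<^esub> q) \<otimes>\<^bsub>P\<^esub> r = p \<otimes>\<^bsub>P\<^esub> (q \<otimes>\<^bsub>P\<^esub> r)"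
    if pqr: "p \<in> carrier P" "q \<in> carrier P" "r \<in> carrier P" for p q r
  proof (rule eqI_lin_ext)
    fix l assume l: "l \<in> carrier M \<rightarrow> carrier A"
    have [simp]: "(\<lambda>v. l (u \<otimes>\<^bsub>M\<^esub> v)) \<in> carrier M \<rightarrow> carrier A" if "u \<in> carrier M" for u
      using that l by auto
    have [simp]: "lin_ext A ?A (\<lambda>v. l (u \<otimes>\<^bsub>M\<^esub> v)) r \<in> carrier A" if "u \<in> carrier M" for u
      using that l pqr by (intro lin_self_closed) auto
    have 1: "(\<lambda>v. lin_ext A ?A (\<lambda>x. l (u \<otimes>\<^bsub>M\<^esub> v \<otimes>\<^bsub>M\<^esub> x)) r) \<in> carrier M \<rightarrow> carrier A"
      if "u \<in> carrier M" for u
      using that by auto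
    have "lin_ext A ?A l (p \<otimes>\<^bsub>P\<^esub> q \<otimes>\<^bsub>P\<^esub> r)
        = lin_ext A ?A (\<lambda>u. lin_ext A ?A (\<lambda>v. lin_ext A ?A (\<lambda>x. l (u \<otimes>\<^bsub>M\<^esub> v \<otimes>\<^bsub>M\<^esub> x)) r) q) p"
      using pqr l by (simp add: lin_ext_mult[OF mod] mult_P_closed Pi_def)
    also have "\<dots> = lin_ext A ?A (\<lambda>u. lin_ext A ?A (\<lambda>v. lin_ext A ?A (\<lambda>x. l (u \<otimes>\<^bsub>M\<^esub> (v \<otimes>\<^bsub>M\<^esub> x))) r) q) p"
      using pqr l lin_self_closed[OF pqr(2) 1]
      by (intro lin_ext_cong mod) (auto simp: M.m_assoc intro!: lin_ext_cong mod)
    also have "\<dots> = lin_ext A ?A l (p \<otimes>\<^bsub>P\<^esub> (q \<otimes>\<^bsub>P\<^esub> r))"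
      using pqr l
      by (subst lin_ext_mult[OF mod])
         (auto intro!: lin_ext_cong lin_ext_closed mod mult_P_closed
           simp: lin_ext_mult[OF mod] mult_P_closed)
    finally show "lin_ext A ?A l (p \<otimes>\<^bsub>P\<^esub> q \<otimes>\<^bsub>P\<^esub> r) = lin_ext A ?A l (p \<otimes>\<^bsub>P\<^esub> (q \<otimes>\<^bsub>P\<^esub> r))" .
  qed (auto intro!: mult_P_closed pqr)
  have comm: "p \<otimes>\<^bsub>P\<^esub> q = q \<otimes>\<^bsub>P\<^esub> p" if "p \<in> carrier P" "q \<in> carrier P" for p q
  proof
    note [simp] = carrierD(1)[OF that(1)] carrierD(1)[OF that(2)]
    fix w
    have "(p \<otimes>\<^bsub>P\<^esub> q) w = (\<Oplus>\<^bsub>A\<^esub>v\<in>{v. q v \<noteq> \<zero>\<^bsub>A\<^esub>}. \<Oplus>\<^bsub>A\<^esub>u\<in>{u. p u \<noteq> \<zero>\<^bsub>A\<^esub>}.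
        if u \<otimes>\<^bsub>M\<^esub> v = w then p u \<otimes>\<^bsub>A\<^esub> q v else \<zero>\<^bsub>A\<^esub>)"
      unfolding mult_P_eq[OF that] using that by (intro A.finsum_swap) (auto simp: carrierD(3))
    also have "\<dots> = (q \<otimes>\<^bsub>P\<^esub> p) w"
      unfolding mult_P_eq[OF that(2,1)]
    proof (intro A.finsum_cong' refl)
      fix v u assume "u \<in> {u. p u \<noteq> \<zero>\<^bsub>A\<^esub>}" "v \<in> {v. q v \<noteq> \<zero>\<^bsub>A\<^esub>}"
      then have "u \<otimes>\<^bsub>M\<^esub> v = v \<otimes>\<^bsub>M\<^esub> u"
        using carrierD(2)[OF that(1)] carrierD(2)[OF that(2)] by (intro M.m_comm) auto
      then show "(if u \<otimes>\<^bsub>M\<^esub> v = w then p u \<otimes>\<^bsub>A\<^esub> q v else \<zero>\<^bsub>A\<^esub>)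
          = (if v \<otimes>\<^bsub>M\<^esub> u = w then q v \<otimes>\<^bsub>A\<^esub> p u else \<zero>\<^bsub>A\<^esub>)"
        by (simp add: A.m_comm)
    qed (auto intro!: A.finsum_closed)
    finally show "(p \<otimes>\<^bsub>P\<^esub> q) w = (q \<otimes>\<^bsub>P\<^esub> p) w" .
  qed
  have one: "\<one>\<^bsub>P\<^esub> \<otimes>\<^bsub>P\<^esub> p = p" if "p \<in> carrier P" for p
    using that
    by (intro eqI_lin_ext)
       (auto intro!: mult_P_closed lin_ext_cong
         simp: one_monoid_algebra lin_ext_mult[OF mod] lin_ext_single[OF mod] mod Pi_def)
  have lin_closed: "(\<lambda>u. lin_ext A ?A (\<lambda>v. l (u \<otimes>\<^bsub>M\<^esub> v)) q) \<in> carrier M \<rightarrow> carrier ?A"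
    if "l \<in> carrier M \<rightarrow> carrier A" "q \<in> carrier P" for l q
    using that by (auto intro!: lin_self_closed)
  have distr: "(p \<oplus>\<^bsub>P\<^esub> q) \<otimes>\<^bsub>P\<^esub> r = p \<otimes>\<^bsub>P\<^esub> r \<oplus>\<^bsub>P\<^esub> q \<otimes>\<^bsub>P\<^esub> r"
    if pqr: "p \<in> carrier P" "q \<in> carrier P" "r \<in> carrier P" for p q r
  proof (rule eqI_lin_ext)
    fix l assume "l \<in> carrier M \<rightarrow> carrier A"
    then have l: "l \<in> carrier M \<rightarrow> carrier ?A" by simp
    show "lin_ext A ?A l ((p \<oplus>\<^bsub>P\<^esub> q) \<otimes>\<^bsub>P\<^esub> r) = lin_ext A ?A l (p \<otimes>\<^bsub>P\<^esub> r \<oplus>\<^bsub>P\<^esub> q \<otimes>\<^bsub>P\<^esub> r)"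
      using l pqr lin_closed[of l r]
      by (simp only: lin_ext_mult[OF mod _ _ l] lin_ext_add[OF mod _ _ l] lin_ext_add[OF mod]
          P.M.a_closed mult_P_closed algebra_via_simps)
  qed (intro mult_P_closed P.M.a_closed pqr)+
  have assoc2: "(a \<odot>\<^bsub>P\<^esub> p) \<otimes>\<^bsub>P\<^esub> q = a \<odot>\<^bsub>P\<^esub> (p \<otimes>\<^bsub>P\<^esub> q)"
    if apq: "a \<in> carrier A" "p \<in> carrier P" "q \<in> carrier P" for a p q
  proof (rule eqI_lin_ext)
    fix l assume "l \<in> carrier M \<rightarrow> carrier A"
    then have l: "l \<in> carrier M \<rightarrow> carrier ?A" by simp
    show "lin_ext A ?A l ((a \<odot>\<^bsub>P\<^esub> p) \<otimes>\<^bsub>P\<^esub> q) = lin_ext A ?A l (a \<odot>\<^bsub>P\<^esub> (p \<otimes>\<^bsub>P\<^esub> q))"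
      using l apq lin_closed[of l q]
      by (simp only: lin_ext_mult[OF mod _ _ l] lin_ext_smult[OF mod _ _ l] lin_ext_smult[OF mod]
          P.smult_closed mult_P_closed algebra_via_simps)
  qed (intro mult_P_closed P.smult_closed apq)+
  have "cring P"
  proof (intro cringI P.M.abelian_group_axioms comm_monoidI)
    show "\<one>\<^bsub>P\<^esub> \<in> carrier P" by (simp add: one_monoid_algebra)
  qed (intro mult_P_closed assoc one comm distr; assumption)+
  then show ?thesis
    using P.module_axioms assoc2 by (simp add: algebra_def algebra_axioms_def del: monoid_algebra_simps)
qed

lemma single_mult:
  assumes "u \<in> carrier M" "v \<in> carrier M"
  shows "single A u \<otimes>\<^bsub>P\<^esub> single A v = single A (u \<otimes>\<^bsub>M\<^esub> v)"
  using assms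
  by (intro eqI_lin_ext)
     (auto intro!: mult_P_closed simp: lin_ext_mult[OF module_self] lin_ext_single[OF module_self] Pi_def)

lemma lin_ext_hom:
  assumes "module A C" "module A D" "h \<in> carrier C \<rightarrow> carrier D"
    "\<And>x y. x \<in> carrier C \<Longrightarrow> y \<in> carrier C \<Longrightarrow> h (x \<oplus>\<^bsub>C\<^esub> y) = h x \<oplus>\<^bsub>D\<^esub> h y"
    "\<And>a x. a \<in> carrier A \<Longrightarrow> x \<in> carrier C \<Longrightarrow> h (a \<odot>\<^bsub>C\<^esub> x) = a \<odot>\<^bsub>D\<^esub> h x"
    "p \<in> carrier P" "l \<in> carrier M \<rightarrow> carrier C"
  shows "h (lin_ext A C l p) = lin_ext A D (\<lambda>u. h (l u)) p"
proof -
  interpret C: module A C by fact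
  interpret D: module A D by fact
  note [simp] = carrierD(1)[OF assms(6)]
  have [simp]: "h x \<in> carrier D" if "x \<in> carrier C" for x using that assms(3) by auto
  have h0: "h \<zero>\<^bsub>C\<^esub> = \<zero>\<^bsub>D\<^esub>"
    using assms(5)[of "\<zero>\<^bsub>A\<^esub>" "\<zero>\<^bsub>C\<^esub>"] by simp
  have l: "l u \<in> carrier C" if "p u \<noteq> \<zero>\<^bsub>A\<^esub>" for u
    using that carrierD(2)[OF assms(6)] assms(7) by auto
  have "h (lin_ext A C l p) = (\<Oplus>\<^bsub>D\<^esub>u\<in>{u. p u \<noteq> \<zero>\<^bsub>A\<^esub>}. h (p u \<odot>\<^bsub>C\<^esub> l u))"
    unfolding lin_ext_def
    by (rule finsum_additive) (use carrierD(3)[OF assms(6)] l assms(3,4) h0 in \<open>auto intro: C.M.abelian_monoid_axioms D.M.abelian_monoid_axioms\<close>)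
  also have "\<dots> = lin_ext A D (\<lambda>u. h (l u)) p"
    unfolding lin_ext_def by (intro D.M.finsum_cong') (use l in \<open>auto simp: assms(5)\<close>)
  finally show ?thesis .
qed

lemma lin_ext_single_eq:
  assumes "p \<in> carrier P"
  shows "lin_ext A P (single A) p = p"
proof (rule eqI_lin_ext)
  fix l assume l: "l \<in> carrier M \<rightarrow> carrier A"
  have "lin_ext A (algebra_via id A) l (lin_ext A P (single A) p)
      = lin_ext A (algebra_via id A) (\<lambda>u. lin_ext A (algebra_via id A) l (single A u)) p"
    using assms l by (intro lin_ext_hom[where h = "lin_ext A (algebra_via id A) l"] module_P module_self)
      (auto simp: lin_ext_add[OF module_self] lin_ext_smult[OF module_self]
        simp del: monoid_algebra_simps)
  also have "\<dots> = lin_ext A (algebra_via id A) l p"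
    using assms l by (intro lin_ext_cong module_self) (auto simp: lin_ext_single[OF module_self])
  finally show "lin_ext A (algebra_via id A) l (lin_ext A P (single A) p) = lin_ext A (algebra_via id A) l p" .
qed (use assms in \<open>auto intro!: lin_ext_closed module_P\<close>)

lemma alg_hom_eq_lin_ext:
  assumes "algebra A C" "h \<in> alg_hom A P C" "p \<in> carrier P"
  shows "h p = lin_ext A C (\<lambda>u. h (single A u)) p"
proof -
  interpret C: algebra A C by fact
  have "h (lin_ext A P (single A) p) = lin_ext A C (\<lambda>u. h (single A u)) p"
    using assms by (intro lin_ext_hom[where h = h] module_P C.module)
      (auto simp: alg_hom_def ring_hom_add ring_hom_closed simp del: monoid_algebra_simps)
  then show ?thesis using lin_ext_single_eq assms by simp
qed

lemma alg_hom_eqI: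
  assumes "algebra A C" "h \<in> alg_hom A P C" "h' \<in> alg_hom A P C"
    "\<And>u. u \<in> carrier M \<Longrightarrow> h (single A u) = h' (single A u)"
  shows "h = h'"
proof (rule extensionalityI)
  show "h \<in> extensional (carrier P)" "h' \<in> extensional (carrier P)"
    using assms by (auto simp: alg_hom_def)
  fix p assume p: "p \<in> carrier P"
  interpret C: algebra A C by fact
  have "lin_ext A C (\<lambda>u. h (single A u)) p = lin_ext A C (\<lambda>u. h' (single A u)) p"
    using assms p by (intro lin_ext_cong C.module) (auto simp: alg_hom_def ring_hom_closed)
  then show "h p = h' p"
    using alg_hom_eq_lin_ext assms p by metis
qed

text \<open>The universal property of the monoid algebra. Multiplication by a fixed element of
  \<open>C\<close> is linear and so moves through \<open>lin_ext\<close>, first with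
  \<open>l u\<close> on the left and then with the whole second factor on the right.\<close>

lemma lin_ext_alg_hom:
  assumes "algebra A C" "l \<in> carrier M \<rightarrow> carrier C" "l \<one>\<^bsub>M\<^esub> = \<one>\<^bsub>C\<^esub>"
    "\<And>u v. u \<in> carrier M \<Longrightarrow> v \<in> carrier M \<Longrightarrow> l (u \<otimes>\<^bsub>M\<^esub> v) = l u \<otimes>\<^bsub>C\<^esub> l v"
  shows "restrict (lin_ext A C l) (carrier P) \<in> alg_hom A P C"
proof -
  interpret C: algebra A C by fact
  interpret P: algebra A P by (rule algebra_P)
  note [simp] = lin_ext_closed[OF C.module]
  have [simp]: "l u \<in> carrier C" if "u \<in> carrier M" for u using that assms(2) by auto
  have "lin_ext A C l (p \<otimes>\<^bsub>P\<^esub> q) = lin_ext A C l p \<otimes>\<^bsub>C\<^esub> lin_ext A C l q"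
    if "p \<in> carrier P" "q \<in> carrier P" for p q
  proof -
    have "lin_ext A C l (p \<otimes>\<^bsub>P\<^esub> q) = lin_ext A C (\<lambda>u. lin_ext A C (\<lambda>v. l (u \<otimes>\<^bsub>M\<^esub> v)) q) p"
      using that assms by (intro lin_ext_mult C.module)
    also have "\<dots> = lin_ext A C (\<lambda>u. l u \<otimes>\<^bsub>C\<^esub> lin_ext A C l q) p"
    proof (intro lin_ext_cong C.module that)
      fix u assume u: "u \<in> carrier M"
      have "l u \<otimes>\<^bsub>C\<^esub> lin_ext A C l q = lin_ext A C (\<lambda>v. l u \<otimes>\<^bsub>C\<^esub> l v) q"
        using that u assms(2) by (intro lin_ext_hom[where h = "\<lambda>x. l u \<otimes>\<^bsub>C\<^esub> x"] C.module)
          (auto simp: C.r_distr C.smult_assoc2 C.m_comm[of "l u"])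
      also have "\<dots> = lin_ext A C (\<lambda>v. l (u \<otimes>\<^bsub>M\<^esub> v)) q"
        using that u assms by (intro lin_ext_cong C.module) auto
      finally show "lin_ext A C (\<lambda>v. l (u \<otimes>\<^bsub>M\<^esub> v)) q = l u \<otimes>\<^bsub>C\<^esub> lin_ext A C l q" by simp
    qed (use that assms in \<open>auto intro!: lin_ext_closed C.module\<close>)
    also have "\<dots> = lin_ext A C l p \<otimes>\<^bsub>C\<^esub> lin_ext A C l q"
      using that assms(2) by (intro lin_ext_hom[symmetric, where h = "\<lambda>x. x \<otimes>\<^bsub>C\<^esub> lin_ext A C l q"] C.module)
        (auto simp: C.l_distr C.smult_assoc2)
    finally show ?thesis .
  qed
  then show ?thesis
    using assms P.smult_closed P.M.a_closed
    by (auto simp: alg_hom_def lin_ext_add[OF C.module] lin_ext_smult[OF C.module]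
        one_monoid_algebra lin_ext_single[OF C.module] single_closed[OF M.one_closed]
        intro!: ring_hom_memI simp del: monoid_algebra_simps)
qed

end

section \<open>Algebra homomorphisms and quotients\<close>

lemma alg_homD:
  assumes "h \<in> alg_hom K A B"
  shows "h \<in> ring_hom A B" "h \<in> extensional (carrier A)"
    "\<And>c x. c \<in> carrier K \<Longrightarrow> x \<in> carrier A \<Longrightarrow> h (c \<odot>\<^bsub>A\<^esub> x) = c \<odot>\<^bsub>B\<^esub> h x"
  using assms by (auto simp: alg_hom_def)

lemma alg_homI:
  assumes "h \<in> ring_hom A B" "h \<in> extensional (carrier A)"
    "\<And>c x. c \<in> carrier K \<Longrightarrow> x \<in> carrier A \<Longrightarrow> h (c \<odot>\<^bsub>A\<^esub> x) = c \<odot>\<^bsub>B\<^esub> h x"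
  shows "h \<in> alg_hom K A B"
  using assms by (auto simp: alg_hom_def)

lemma alg_hom_ring_hom_cring:
  assumes "algebra K A" "algebra K B" "h \<in> alg_hom K A B"
  shows "ring_hom_cring A B h"
  using assms by (auto simp: ring_hom_cring_def ring_hom_cring_axioms_def alg_hom_def algebra.M_cring)

lemma alg_hom_compose:
  assumes "h \<in> alg_hom K A B" "g \<in> alg_hom K B C" "algebra K A"
  shows "compose (carrier A) g h \<in> alg_hom K A C"
proof -
  interpret A: algebra K A by fact
  show ?thesis
  proof (rule alg_homI)
    show "compose (carrier A) g h \<in> ring_hom A C"
      using alg_homD(1)[OF assms(1)] alg_homD(1)[OF assms(2)]
      by (intro ring_hom_memI)
         (auto simp: compose_eq ring_hom_closed ring_hom_add ring_hom_mult ring_hom_one)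
    show "compose (carrier A) g h (c \<odot>\<^bsub>A\<^esub> x) = c \<odot>\<^bsub>C\<^esub> compose (carrier A) g h x"
      if "c \<in> carrier K" "x \<in> carrier A" for c x
      using that assms by (auto simp: compose_eq alg_hom_def ring_hom_closed)
  qed auto
qed

lemma a_kernel_iff:
  assumes "algebra K A" "algebra K B" "h \<in> alg_hom K A B"
  shows "x \<in> a_kernel A B h \<longleftrightarrow> x \<in> carrier A \<and> h x = \<zero>\<^bsub>B\<^esub>"
  by (auto simp: a_kernel_def' )

lemma a_kernel_ideal:
  assumes "algebra K A" "algebra K B" "h \<in> alg_hom K A B"
  shows "ideal (a_kernel A B h) A"
proof -
  interpret ring_hom_cring A B h by (rule alg_hom_ring_hom_cring) fact+
  show ?thesis
    by (intro ring_hom_ring.kernel_is_ideal ring_hom_ringI2) (auto intro: R.ring_axioms S.ring_axioms homh)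
qed

locale algebra_ideal = algebra K A + ideal I A for K (structure) and A (structure) and I
begin

abbreviation "Q \<equiv> quot_algebra A I"

lemma quot_simps [simp]:
  "carrier Q = carrier (A Quot I)" "mult Q = mult (A Quot I)" "one Q = I +>\<^bsub>A\<^esub> \<one>\<^bsub>A\<^esub>"
  "zero Q = I" "add Q = add (A Quot I)"
  by (simp_all add: quot_algebra_def ring.defs module.defs FactRing_def)

lemma quot_carrier: "carrier Q = (\<lambda>x. I +>\<^bsub>A\<^esub> x) ` carrier A"
  by (auto simp: FactRing_def A_RCOSETS_defs a_r_coset_def)

lemma coset_closed [simp, intro]: "x \<in> carrier A \<Longrightarrow> I +>\<^bsub>A\<^esub> x \<in> carrier Q"
  unfolding quot_carrier by blast

lemma coset_eq_iff:
  "x \<in> carrier A \<Longrightarrow> y \<in> carrier A \<Longrightarrow> I +>\<^bsub>A\<^esub> x = I +>\<^bsub>A\<^esub> y \<longleftrightarrow> x \<ominus>\<^bsub>A\<^esub> y \<in> I"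
  using quotient_eq_iff_same_a_r_cos[OF is_ideal] by blast

lemma coset_zero_iff: "x \<in> carrier A \<Longrightarrow> I +>\<^bsub>A\<^esub> x = I \<longleftrightarrow> x \<in> I"
  using a_rcos_zero[OF is_ideal] rcos_const_imp_mem by blast

text \<open>Scalars act through the ideal property, as c x = (c 1) x.\<close>

lemma smult_closed_I: "c \<in> carrier K \<Longrightarrow> x \<in> I \<Longrightarrow> c \<odot>\<^bsub>A\<^esub> x \<in> I"
  using smult_assoc2[of c "\<one>\<^bsub>A\<^esub>" x] I_l_closed[of x "c \<odot>\<^bsub>A\<^esub> \<one>\<^bsub>A\<^esub>"] by (simp add: Icarr)

text \<open>The scalar multiplication is a union over all representatives. They all give the same
  set, because \<open>I\<close> is stable under scalars, and so the union is one coset.\<close>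

lemma quot_smult:
  assumes "c \<in> carrier K" "x \<in> carrier A"
  shows "c \<odot>\<^bsub>Q\<^esub> (I +>\<^bsub>A\<^esub> x) = I +>\<^bsub>A\<^esub> (c \<odot>\<^bsub>A\<^esub> x)"
proof -
  have eq: "c \<odot>\<^bsub>Q\<^esub> (I +>\<^bsub>A\<^esub> x) = (\<Union>y\<in>I +>\<^bsub>A\<^esub> x. I +>\<^bsub>A\<^esub> (c \<odot>\<^bsub>A\<^esub> y))"
    by (simp add: quot_algebra_def ring.defs module.defs)
  have "I +>\<^bsub>A\<^esub> (c \<odot>\<^bsub>A\<^esub> y) = I +>\<^bsub>A\<^esub> (c \<odot>\<^bsub>A\<^esub> x)" if y: "y \<in> I +>\<^bsub>A\<^esub> x" for y
  proof -
    obtain i where i: "i \<in> I" "y = i \<oplus>\<^bsub>A\<^esub> x" using y by (auto simp: a_r_coset_def')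
    then have "c \<odot>\<^bsub>A\<^esub> y \<ominus>\<^bsub>A\<^esub> c \<odot>\<^bsub>A\<^esub> x = c \<odot>\<^bsub>A\<^esub> i"
      using assms by (simp add: smult_r_distr Icarr a_minus_def M.a_assoc M.r_neg)
    then show ?thesis
      using assms i by (subst coset_eq_iff) (auto simp: Icarr smult_closed_I)
  qed
  moreover have "x \<in> I +>\<^bsub>A\<^esub> x" using assms by (simp add: a_rcos_self)
  ultimately show ?thesis unfolding eq by blast
qed

lemma coset_ring_hom: "(\<lambda>x. I +>\<^bsub>A\<^esub> x) \<in> ring_hom A Q"
  using rcos_ring_hom by (simp add: ring_hom_def FactRing_def)

lemma quot_add: "x \<in> carrier A \<Longrightarrow> y \<in> carrier A \<Longrightarrow> (I +>\<^bsub>A\<^esub> x) \<oplus>\<^bsub>Q\<^esub> (I +>\<^bsub>A\<^esub> y) = I +>\<^bsub>A\<^esub> (x \<oplus>\<^bsub>A\<^esub> y)"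
  and quot_mult: "x \<in> carrier A \<Longrightarrow> y \<in> carrier A \<Longrightarrow> (I +>\<^bsub>A\<^esub> x) \<otimes>\<^bsub>Q\<^esub> (I +>\<^bsub>A\<^esub> y) = I +>\<^bsub>A\<^esub> (x \<otimes>\<^bsub>A\<^esub> y)"
  using coset_ring_hom by (simp_all add: ring_hom_def)

lemma cring_quot: "cring Q"
proof -
  interpret q: cring "A Quot I" by (rule quotient_is_cring) (rule M_cring)
  have z: "\<zero>\<^bsub>A Quot I\<^esub> = I" "\<one>\<^bsub>A Quot I\<^esub> = I +>\<^bsub>A\<^esub> \<one>\<^bsub>A\<^esub>" by (simp_all add: FactRing_def)
  note [simp] = q.zero_closed[unfolded z] q.one_closed[unfolded z] q.l_zero[unfolded z]
     q.l_one[unfolded z]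
  show ?thesis
  proof (rule cringI)
    show "abelian_group Q"
    proof (rule abelian_groupI)
      fix x assume "x \<in> carrier Q"
      then show "\<exists>y\<in>carrier Q. y \<oplus>\<^bsub>Q\<^esub> x = \<zero>\<^bsub>Q\<^esub>"
        using q.l_neg[unfolded z] by (intro bexI[of _ "\<ominus>\<^bsub>A Quot I\<^esub> x"]) (auto simp: z)
    qed (simp_all add: q.a_ac z)
    show "comm_monoid Q"
      by (rule comm_monoidI) (simp_all add: q.m_ac q.r_one[unfolded z])
  qed (simp add: q.l_distr)
qed

lemma algebra_quot: "algebra K Q"
proof (rule algebraI)
  show "cring K" by (rule R_cring)
  show "cring Q" by (rule cring_quot)
next
  fix c x assume "c \<in> carrier K" "x \<in> carrier Q"
  then show "c \<odot>\<^bsub>Q\<^esub> x \<in> carrier Q"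
    unfolding quot_carrier by (auto simp: quot_smult simp del: quot_simps)
next
  fix c d x assume "c \<in> carrier K" "d \<in> carrier K" "x \<in> carrier Q"
  then show "(c \<oplus>\<^bsub>K\<^esub> d) \<odot>\<^bsub>Q\<^esub> x = c \<odot>\<^bsub>Q\<^esub> x \<oplus>\<^bsub>Q\<^esub> d \<odot>\<^bsub>Q\<^esub> x"
    "(c \<otimes>\<^bsub>K\<^esub> d) \<odot>\<^bsub>Q\<^esub> x = c \<odot>\<^bsub>Q\<^esub> (d \<odot>\<^bsub>Q\<^esub> x)"
    unfolding quot_carrier
    by (auto simp: quot_smult quot_add smult_l_distr smult_assoc1 simp del: quot_simps)
next
  fix c x y assume "c \<in> carrier K" "x \<in> carrier Q" "y \<in> carrier Q"
  then show "c \<odot>\<^bsub>Q\<^esub> (x \<oplus>\<^bsub>Q\<^esub> y) = c \<odot>\<^bsub>Q\<^esub> x \<oplus>\<^bsub>Q\<^esub> c \<odot>\<^bsub>Q\<^esub> y"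
    "(c \<odot>\<^bsub>Q\<^esub> x) \<otimes>\<^bsub>Q\<^esub> y = c \<odot>\<^bsub>Q\<^esub> (x \<otimes>\<^bsub>Q\<^esub> y)"
    unfolding quot_carrier
    by (auto simp: quot_smult quot_add quot_mult smult_r_distr smult_assoc2 simp del: quot_simps)
next
  fix x assume "x \<in> carrier Q"
  then show "\<one>\<^bsub>K\<^esub> \<odot>\<^bsub>Q\<^esub> x = x"
    unfolding quot_carrier by (auto simp: quot_smult simp del: quot_simps)
qed

lemma coset_alg_hom: "restrict (\<lambda>x. I +>\<^bsub>A\<^esub> x) (carrier A) \<in> alg_hom K A Q"
  using coset_ring_hom
  by (intro alg_homI) (auto simp: ring_hom_def quot_smult)

lemma kernel_coset: "a_kernel A Q (restrict (\<lambda>x. I +>\<^bsub>A\<^esub> x) (carrier A)) = I"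
  by (auto simp: a_kernel_def' coset_zero_iff Icarr)

end

text \<open>Descent along a surjection that need not be a residue map: it serves for the quotient by
  the ideal of equations and for an arbitrary presentation. \<open>G\<close> evaluates
  \<open>F\<close> at a chosen preimage; two preimages differ by an element that \<open>p\<close>
  kills.\<close>

lemma alg_hom_factor:
  assumes "algebra K A" "algebra K B" "algebra K C" "p \<in> alg_hom K A B" "p ` carrier A = carrier B"
    "F \<in> alg_hom K A C" "\<And>x. x \<in> carrier A \<Longrightarrow> p x = \<zero>\<^bsub>B\<^esub> \<Longrightarrow> F x = \<zero>\<^bsub>C\<^esub>"
  obtains G where "G \<in> alg_hom K B C" "\<And>x. x \<in> carrier A \<Longrightarrow> G (p x) = F x"
proof -
  interpret A: algebra K A by fact
  interpret B: algebra K B by fact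
  interpret C: algebra K C by fact
  interpret p: ring_hom_cring A B p by (rule alg_hom_ring_hom_cring) fact+
  interpret F: ring_hom_cring A C F by (rule alg_hom_ring_hom_cring) fact+
  define s where "s y = (SOME x. x \<in> carrier A \<and> p x = y)" for y
  have s: "s y \<in> carrier A" "p (s y) = y" if "y \<in> carrier B" for y
  proof -
    have "\<exists>x. x \<in> carrier A \<and> p x = y"
      using that assms(5) by (metis imageE)
    from someI_ex[OF this] show "s y \<in> carrier A" "p (s y) = y"
      unfolding s_def by simp_all
  qed
  have F_eq: "F x = F y" if "x \<in> carrier A" "y \<in> carrier A" "p x = p y" for x y
  proof -
    have "p (x \<ominus>\<^bsub>A\<^esub> y) = \<zero>\<^bsub>B\<^esub>" using that by (simp add: a_minus_def B.M.r_neg)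
    then have "F x \<ominus>\<^bsub>C\<^esub> F y = \<zero>\<^bsub>C\<^esub>" using assms(7)[of "x \<ominus>\<^bsub>A\<^esub> y"] that by (simp add: a_minus_def)
    then show ?thesis using that by (simp add: C.M.minus_eq_zero_iff)
  qed
  define G where "G = restrict (\<lambda>y. F (s y)) (carrier B)"
  have G: "G (p x) = F x" if "x \<in> carrier A" for x
    using that s by (auto simp: G_def intro!: F_eq)
  have "G \<in> alg_hom K B C"
  proof (rule alg_homI)
    show "G \<in> ring_hom B C"
    proof (rule ring_hom_memI)
      show "G \<one>\<^bsub>B\<^esub> = \<one>\<^bsub>C\<^esub>" using G[of "\<one>\<^bsub>A\<^esub>"] by simp
      fix x y assume "x \<in> carrier B" "y \<in> carrier B"
      then obtain a b where ab: "a \<in> carrier A" "b \<in> carrier A" "x = p a" "y = p b"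
        using assms(5) by blast
      show "G x \<in> carrier C" using ab by (simp add: G)
      show "G (x \<otimes>\<^bsub>B\<^esub> y) = G x \<otimes>\<^bsub>C\<^esub> G y" using ab G[of "a \<otimes>\<^bsub>A\<^esub> b"] by (simp add: G)
      show "G (x \<oplus>\<^bsub>B\<^esub> y) = G x \<oplus>\<^bsub>C\<^esub> G y" using ab G[of "a \<oplus>\<^bsub>A\<^esub> b"] by (simp add: G)
    qed
    fix c x assume c: "c \<in> carrier K" "x \<in> carrier B"
    then obtain a where ab: "a \<in> carrier A" "x = p a"
      using assms(5) by blast
    then show "G (c \<odot>\<^bsub>B\<^esub> x) = c \<odot>\<^bsub>C\<^esub> G x"
      using c G[of "c \<odot>\<^bsub>A\<^esub> a"] alg_homD(3)[OF assms(4), of c a] alg_homD(3)[OF assms(6), of c a]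
      by (simp add: G)
  qed (simp add: G_def)
  then show ?thesis using G that by blast
qed

section \<open>Exponents\<close>

declare One_nat_def [simp del]

lemma exponent_monoid_simps [simp]:
  "carrier (exponent_monoid S) = S" "mult (exponent_monoid S) = (+)" "one (exponent_monoid S) = 0"
  by (simp_all add: exponent_monoid_def)

lemma comm_monoid_exponent_monoid:
  "0 \<in> S \<Longrightarrow> (\<And>u v. u \<in> S \<Longrightarrow> v \<in> S \<Longrightarrow> u + v \<in> S) \<Longrightarrow> comm_monoid (exponent_monoid S)"
  by (rule comm_monoidI) (auto simp: ac_simps)

text \<open>Induction on the total degree: a nonzero exponent has a positive coordinate, so some
  unit vector can be subtracted.\<close>

lemma exponent_induct [case_names zero step]:
  fixes \<alpha> :: "nat ^ 'n::finite"
  assumes "P 0" "\<And>\<alpha> i. P \<alpha> \<Longrightarrow> P (\<alpha> + axis i 1)"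
  shows "P \<alpha>"
proof (induction "\<Sum>i\<in>UNIV. \<alpha> $ i" arbitrary: \<alpha>)
  case 0
  then have "\<alpha> = 0" by (simp add: vec_eq_iff)
  then show ?case using assms(1) by simp
next
  case (Suc m)
  then obtain i where i: "\<alpha> $ i > 0"
    by (metis gr0I nat.distinct(1) sum.neutral)
  define \<alpha>' where "\<alpha>' = \<alpha> - axis i 1"
  have \<alpha>: "\<alpha> = \<alpha>' + axis i 1" using i by (auto simp: \<alpha>'_def vec_eq_iff axis_def)
  have "(\<Sum>j\<in>UNIV. \<alpha> $ j) = (\<Sum>j\<in>UNIV. \<alpha>' $ j) + (\<Sum>j\<in>UNIV. (axis i 1 :: nat ^ 'n) $ j)"
    by (simp add: \<alpha> sum.distrib)
  moreover have "(\<Sum>j\<in>UNIV. (axis i 1 :: nat ^ 'n) $ j) = 1"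
    by (simp add: axis_def)
  ultimately have "P \<alpha>'" using Suc by simp
  then show ?case using \<alpha> assms(2) by simp
qed

lemma standard_setD: "standard_set N \<Longrightarrow> \<alpha> + \<gamma> \<in> N \<Longrightarrow> \<alpha> \<in> N"
  by (auto simp: standard_set_def)

text \<open>Coordinate j of \<alpha> and coordinate i of \<beta> are positive, so both can still be
  lowered; the two steps form a square that \<open>\<gamma>\<close> closes at the bottom.\<close>

lemma add_axis_eqD:
  fixes \<alpha> \<beta> :: "nat ^ 'n::finite"
  assumes "\<alpha> + axis i 1 = \<beta> + axis j 1" "i \<noteq> j"
  shows "\<exists>\<gamma>. \<alpha> = \<gamma> + axis j 1 \<and> \<beta> = \<gamma> + axis i 1"
proof -
  have *: "\<alpha> $ k + axis i 1 $ k = \<beta> $ k + axis j 1 $ k" for k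
    using assms(1) by (metis vector_add_component)
  have "\<alpha> $ j = \<beta> $ j + 1" "\<beta> $ i = \<alpha> $ i + 1" using *[of j] *[of i] assms(2) by (auto simp: axis_def)
  moreover have "\<alpha> $ k = \<beta> $ k" if "k \<noteq> i" "k \<noteq> j" for k using *[of k] that by (auto simp: axis_def)
  \<comment> \<open>Subtraction of exponents is truncated, and exact here because
    \<open>\<alpha> $ j\<close> is positive.\<close>
  ultimately have "\<alpha> = (\<alpha> - axis j 1) + axis j 1 \<and> \<beta> = (\<alpha> - axis j 1) + axis i 1"
    using assms(2) by (auto simp: vec_eq_iff axis_def)
  then show ?thesis by blast
qed

text \<open>One unit step down suffices. If the exponent is \<beta> + e_j with \<beta> in N and the
  step is along e_i with i \<noteq> j, the square closes at some \<delta> below \<beta>; then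
  \<delta> is in N and the lowered exponent is \<delta> + e_j.\<close>

lemma standard_set_Un_border:
  fixes N :: "(nat ^ 'n::finite) set"
  assumes N: "standard_set N"
  shows "standard_set (N \<union> border N)"
proof -
  have "\<alpha> \<in> N \<union> border N" if "\<alpha> + \<gamma> \<in> N \<union> border N" for \<alpha> \<gamma>
    using that
  proof (induction \<gamma> rule: exponent_induct)
    case (step \<gamma> i)
    have "\<alpha> + \<gamma> \<in> N \<union> border N"
    proof (cases "\<alpha> + \<gamma> + axis i 1 \<in> N")
      case False
      then obtain \<beta> j where \<beta>: "\<beta> \<in> N" "\<alpha> + \<gamma> + axis i 1 = \<beta> + axis j 1"
        using step.prems by (auto simp: border_def add.assoc)
      show ?thesis
      proof (cases "i = j")
        case False
        then obtain \<delta> where "\<alpha> + \<gamma> = \<delta> + axis j 1" "\<beta> = \<delta> + axis i 1"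
          using add_axis_eqD \<beta>(2) by blast
        then show ?thesis using standard_setD[OF N] \<beta>(1) by (auto simp: border_def)
      qed (use \<beta> in simp)
    qed (use standard_setD[OF N] in auto)
    then show ?case by (rule step.IH)
  qed simp
  then show ?thesis by (auto simp: standard_set_def)
qed

lemma add_axis_in_border: "\<alpha> \<in> N \<Longrightarrow> \<alpha> + axis i 1 \<in> N \<union> border N"
  by (auto simp: border_def)

lemma add_axis_in_border2:
  "\<alpha> \<in> N \<union> border N \<Longrightarrow> \<alpha> + axis i 1 \<notin> N \<union> border N \<Longrightarrow> \<alpha> + axis i 1 \<in> border2 N"
  by (auto simp: border2_def border_def[of "N \<union> border N"])

lemma funpow_commute:
  assumes "f \<circ> g = g \<circ> f"
  shows "(f ^^ m) \<circ> (g ^^ n) = (g ^^ n) \<circ> (f ^^ m)"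
proof -
  have 1: "f \<circ> (g ^^ n) = (g ^^ n) \<circ> f" for n
    by (induction n) (auto simp: fun_eq_iff assms[unfolded fun_eq_iff, simplified])
  show ?thesis
    by (induction m) (use 1[of n] in \<open>auto simp: fun_eq_iff\<close>)
qed

section \<open>Monomial orders and leading exponents\<close>

locale monomial_ordering =
  fixes lt :: "nat ^ 'n::finite \<Rightarrow> nat ^ 'n \<Rightarrow> bool"
  assumes monomial_order: "monomial_order lt"
begin

lemma lt_irrefl: "\<not> lt \<alpha> \<alpha>"
  using monomial_order by (auto simp: monomial_order_def irreflp_def)

lemma lt_trans: "lt \<alpha> \<beta> \<Longrightarrow> lt \<beta> \<gamma> \<Longrightarrow> lt \<alpha> \<gamma>"
  using monomial_order unfolding monomial_order_def transp_def by blast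

lemma lt_total: "\<alpha> \<noteq> \<beta> \<Longrightarrow> lt \<alpha> \<beta> \<or> lt \<beta> \<alpha>"
  using monomial_order unfolding monomial_order_def totalp_on_def by blast

lemma lt_add: "lt \<alpha> \<beta> \<Longrightarrow> lt (\<alpha> + \<gamma>) (\<beta> + \<gamma>)"
  using monomial_order unfolding monomial_order_def by blast

lemma wfp_lt: "wfp lt"
  using monomial_order unfolding monomial_order_def by blast

lemma lead_expI:
  assumes "p \<alpha> \<noteq> \<zero>\<^bsub>B\<^esub>" "\<And>\<beta>. p \<beta> \<noteq> \<zero>\<^bsub>B\<^esub> \<Longrightarrow> \<beta> \<noteq> \<alpha> \<Longrightarrow> lt \<beta> \<alpha>"
  shows "lead_exp B lt p = \<alpha>"
  unfolding lead_exp_def using assms lt_irrefl lt_trans by (intro the_equality) blast+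

lemma finite_has_max:
  assumes "finite S" "S \<noteq> {}"
  shows "\<exists>\<alpha>\<in>S. \<forall>\<beta>\<in>S. \<beta> \<noteq> \<alpha> \<longrightarrow> lt \<beta> \<alpha>"
  using assms
proof (induction S rule: finite_ne_induct)
  case (insert x S)
  then obtain \<alpha> where "\<alpha> \<in> S" "\<forall>\<beta>\<in>S. \<beta> \<noteq> \<alpha> \<longrightarrow> lt \<beta> \<alpha>" by blast
  then show ?case using lt_total[of x \<alpha>] lt_trans by (metis insert_iff)
qed simp

lemma lead_exp:
  assumes "finite {\<alpha>. p \<alpha> \<noteq> \<zero>\<^bsub>B\<^esub>}" "p \<noteq> (\<lambda>_. \<zero>\<^bsub>B\<^esub>)"
  shows "p (lead_exp B lt p) \<noteq> \<zero>\<^bsub>B\<^esub>" "\<And>\<beta>. p \<beta> \<noteq> \<zero>\<^bsub>B\<^esub> \<Longrightarrow> \<beta> \<noteq> lead_exp B lt p \<Longrightarrow> lt \<beta> (lead_exp B lt p)"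
proof -
  have "{\<alpha>. p \<alpha> \<noteq> \<zero>\<^bsub>B\<^esub>} \<noteq> {}" using assms(2) by auto
  then obtain \<alpha> where \<alpha>: "p \<alpha> \<noteq> \<zero>\<^bsub>B\<^esub>" "\<And>\<beta>. p \<beta> \<noteq> \<zero>\<^bsub>B\<^esub> \<Longrightarrow> \<beta> \<noteq> \<alpha> \<Longrightarrow> lt \<beta> \<alpha>"
    using finite_has_max[OF assms(1)] by blast
  moreover have "lead_exp B lt p = \<alpha>" by (rule lead_expI) (use \<alpha> in auto)
  ultimately show "p (lead_exp B lt p) \<noteq> \<zero>\<^bsub>B\<^esub>"
    "\<And>\<beta>. p \<beta> \<noteq> \<zero>\<^bsub>B\<^esub> \<Longrightarrow> \<beta> \<noteq> lead_exp B lt p \<Longrightarrow> lt \<beta> (lead_exp B lt p)" by auto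
qed

end

section \<open>Standing data and the polynomial ring over B\<close>

locale hilb_data = monomial_ordering lt for lt :: "nat ^ 'n::finite \<Rightarrow> nat ^ 'n \<Rightarrow> bool" +
  fixes \<Delta> N :: "(nat ^ 'n) set"
  assumes standard_\<Delta>: "standard_set \<Delta>" and finite_\<Delta> [simp]: "finite \<Delta>" and \<Delta>_nonempty: "\<Delta> \<noteq> {}"
    and standard_N: "standard_set N" and \<Delta>_le_N: "\<Delta> \<subseteq> N"
begin

lemma zero_in_\<Delta> [simp]: "0 \<in> \<Delta>"
  using \<Delta>_nonempty standard_setD[OF standard_\<Delta>, of 0] by auto

lemma \<Delta>_in_N: "\<beta> \<in> \<Delta> \<Longrightarrow> \<beta> \<in> N \<union> border N"
  using \<Delta>_le_N by auto

lemma \<Delta>_add_axis: "\<beta> \<in> \<Delta> \<Longrightarrow> \<beta> + axis i 1 \<in> N \<union> border N"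
  using \<Delta>_le_N add_axis_in_border by blast

end

locale poly_data = hilb_data lt \<Delta> N + B: cring B
  for lt :: "nat ^ 'n::finite \<Rightarrow> nat ^ 'n \<Rightarrow> bool" and \<Delta> N and B :: "('b, 'r) ring_scheme" (structure)
begin

abbreviation "PB \<equiv> poly_algebra B :: ('b, nat ^ 'n \<Rightarrow> 'b) module"

abbreviation "B1 \<equiv> algebra_via id B"

sublocale P: monoid_ring B "exponent_monoid (UNIV :: (nat ^ 'n) set)"
  rewrites "monoid_algebra B (exponent_monoid (UNIV :: (nat ^ 'n) set)) = PB"
    and "carrier (exponent_monoid (UNIV :: (nat ^ 'n) set)) = UNIV"
    and "mult (exponent_monoid (UNIV :: (nat ^ 'n) set)) = (+)"
    and "one (exponent_monoid (UNIV :: (nat ^ 'n) set)) = 0"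
proof -
  show "monoid_ring B (exponent_monoid (UNIV :: (nat ^ 'n) set))"
    by (intro monoid_ring.intro B.is_cring comm_monoid_exponent_monoid) auto
qed (auto simp: poly_algebra_def)

lemma zero_PB: "\<zero>\<^bsub>PB\<^esub> = (\<lambda>_. \<zero>\<^bsub>B\<^esub>)"
  by (simp add: poly_algebra_def)

lemma single_in_PB [simp, intro]: "single B \<alpha> \<in> carrier PB"
  by (rule P.single_closed) simp

sublocale PA: algebra B PB
  by (rule P.algebra_P)

end

section \<open>Normal form matrices and the commuting multiplication maps\<close>

locale border_matrix = poly_data lt \<Delta> N B
  for lt :: "nat ^ 'n::finite \<Rightarrow> nat ^ 'n \<Rightarrow> bool" and \<Delta> N and B :: "('b, 'r) ring_scheme" (structure) +
  fixes a :: "nat ^ 'n \<Rightarrow> nat ^ 'n \<Rightarrow> 'b"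
  assumes a_closed: "\<alpha> \<in> N \<union> border N \<Longrightarrow> \<beta> \<in> \<Delta> \<Longrightarrow> a \<alpha> \<beta> \<in> carrier B"
    and a_unit: "\<alpha> \<in> \<Delta> \<Longrightarrow> \<beta> \<in> \<Delta> \<Longrightarrow> a \<alpha> \<beta> = (if \<alpha> = \<beta> then \<one>\<^bsub>B\<^esub> else \<zero>\<^bsub>B\<^esub>)"
    and a_step: "\<alpha> \<in> N \<union> border N \<Longrightarrow> \<alpha> + axis i 1 \<in> N \<union> border N \<Longrightarrow> \<beta> \<in> \<Delta> \<Longrightarrow>
      a (\<alpha> + axis i 1) \<beta> = (\<Oplus>\<^bsub>B\<^esub>\<gamma>\<in>\<Delta>. a \<alpha> \<gamma> \<otimes>\<^bsub>B\<^esub> a (\<gamma> + axis i 1) \<beta>)"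
    and a_border: "\<alpha> \<in> border N \<Longrightarrow> \<alpha>' \<in> border N \<Longrightarrow> \<alpha> + axis i 1 = \<alpha>' + axis j 1 \<Longrightarrow>
      \<alpha> + axis i 1 \<in> border2 N \<Longrightarrow> \<beta> \<in> \<Delta> \<Longrightarrow>
      (\<Oplus>\<^bsub>B\<^esub>\<gamma>\<in>\<Delta>. a \<alpha> \<gamma> \<otimes>\<^bsub>B\<^esub> a (\<gamma> + axis i 1) \<beta>) = (\<Oplus>\<^bsub>B\<^esub>\<gamma>\<in>\<Delta>. a \<alpha>' \<gamma> \<otimes>\<^bsub>B\<^esub> a (\<gamma> + axis j 1) \<beta>)"
    and a_order: "\<alpha> \<in> N \<union> border N \<Longrightarrow> \<beta> \<in> \<Delta> \<Longrightarrow> lt \<alpha> \<beta> \<Longrightarrow> a \<alpha> \<beta> = \<zero>\<^bsub>B\<^esub>"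
begin

lemma a_axis_closed [simp]: "\<gamma> \<in> \<Delta> \<Longrightarrow> \<beta> \<in> \<Delta> \<Longrightarrow> a (\<gamma> + axis i 1) \<beta> \<in> carrier B"
  by (intro a_closed \<Delta>_add_axis)

text \<open>The equations only see entries with row in N \<union> N^(1) and column in \<Delta>,
  since \<gamma> + e_i stays in N \<union> N^(1) for \<gamma> in \<Delta>. Matrices that come from
  homomorphisms are controlled only there.\<close>

lemma border_matrix_cong:
  assumes eq: "\<And>\<alpha> \<beta>. \<alpha> \<in> N \<union> border N \<Longrightarrow> \<beta> \<in> \<Delta> \<Longrightarrow> a' \<alpha> \<beta> = a \<alpha> \<beta>"
  shows "border_matrix lt \<Delta> N B a'"
proof -
  have sum_eq: "(\<Oplus>\<^bsub>B\<^esub>\<gamma>\<in>\<Delta>. a' \<alpha> \<gamma> \<otimes>\<^bsub>B\<^esub> a' (\<gamma> + axis i 1) \<beta>)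
      = (\<Oplus>\<^bsub>B\<^esub>\<gamma>\<in>\<Delta>. a \<alpha> \<gamma> \<otimes>\<^bsub>B\<^esub> a (\<gamma> + axis i 1) \<beta>)"
    if "\<alpha> \<in> N \<union> border N" "\<beta> \<in> \<Delta>" for \<alpha> \<beta> i
    using that eq[OF that(1)] eq[OF \<Delta>_add_axis that(2)] a_closed[OF that(1)] a_axis_closed[OF _ that(2)]
    by (intro B.finsum_cong'[OF refl]) auto
  show ?thesis
  proof
    fix \<alpha> \<beta> assume \<alpha>\<beta>: "\<alpha> \<in> N \<union> border N" "\<beta> \<in> \<Delta>"
    show "a' \<alpha> \<beta> \<in> carrier B" using a_closed[OF \<alpha>\<beta>] eq[OF \<alpha>\<beta>] by simp
    show "a' \<alpha> \<beta> = \<zero>\<^bsub>B\<^esub>" if "lt \<alpha> \<beta>"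
      using a_order[OF \<alpha>\<beta> that] eq[OF \<alpha>\<beta>] by simp
    show "a' (\<alpha> + axis i 1) \<beta> = (\<Oplus>\<^bsub>B\<^esub>\<gamma>\<in>\<Delta>. a' \<alpha> \<gamma> \<otimes>\<^bsub>B\<^esub> a' (\<gamma> + axis i 1) \<beta>)"
      if "\<alpha> + axis i 1 \<in> N \<union> border N" for i
      unfolding sum_eq[OF \<alpha>\<beta>] using a_step[OF \<alpha>\<beta>(1) that \<alpha>\<beta>(2)] eq[OF that \<alpha>\<beta>(2)] by simp
  next
    fix \<alpha> \<beta> assume \<alpha>\<beta>: "\<alpha> \<in> \<Delta>" "\<beta> \<in> \<Delta>"
    show "a' \<alpha> \<beta> = (if \<alpha> = \<beta> then \<one>\<^bsub>B\<^esub> else \<zero>\<^bsub>B\<^esub>)"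
      using a_unit[OF \<alpha>\<beta>] eq[OF \<Delta>_in_N[OF \<alpha>\<beta>(1)] \<alpha>\<beta>(2)] by simp
  next
    fix \<alpha> \<alpha>' :: "nat ^ 'n" and i j \<beta>
    assume asm: "\<alpha> \<in> border N" "\<alpha>' \<in> border N" "\<alpha> + axis i 1 = \<alpha>' + axis j 1"
      "\<alpha> + axis i 1 \<in> border2 N" "\<beta> \<in> \<Delta>"
    show "(\<Oplus>\<^bsub>B\<^esub>\<gamma>\<in>\<Delta>. a' \<alpha> \<gamma> \<otimes>\<^bsub>B\<^esub> a' (\<gamma> + axis i 1) \<beta>)
        = (\<Oplus>\<^bsub>B\<^esub>\<gamma>\<in>\<Delta>. a' \<alpha>' \<gamma> \<otimes>\<^bsub>B\<^esub> a' (\<gamma> + axis j 1) \<beta>)"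
      unfolding sum_eq[OF UnI2[OF asm(1)] asm(5)] sum_eq[OF UnI2[OF asm(2)] asm(5)]
      by (rule a_border[OF asm])
  qed
qed

text \<open>Both sides are x^(\<gamma> + e_i + e_j) reduced along two paths. Inside N \<union> N^(1)
  \<open>a_step\<close> evaluates both. Otherwise neither \<gamma> + e_i nor \<gamma> + e_j is in N,
  since one step from N stays in N \<union> N^(1); so both are in the border, their common successor
  is in N^(2), and \<open>a_border\<close> applies.\<close>

lemma mult_matrices_commute:
  assumes "\<gamma> \<in> \<Delta>" "\<beta> \<in> \<Delta>"
  shows "(\<Oplus>\<^bsub>B\<^esub>\<delta>\<in>\<Delta>. a (\<gamma> + axis i 1) \<delta> \<otimes>\<^bsub>B\<^esub> a (\<delta> + axis j 1) \<beta>)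
       = (\<Oplus>\<^bsub>B\<^esub>\<delta>\<in>\<Delta>. a (\<gamma> + axis j 1) \<delta> \<otimes>\<^bsub>B\<^esub> a (\<delta> + axis i 1) \<beta>)"
proof (cases "\<gamma> + axis i 1 + axis j 1 \<in> N \<union> border N")
  case True
  moreover have eq: "\<gamma> + axis i 1 + axis j 1 = \<gamma> + axis j 1 + axis i 1" by (simp add: ac_simps)
  ultimately have "\<gamma> + axis j 1 + axis i 1 \<in> N \<union> border N" by simp
  from a_step[OF \<Delta>_add_axis[OF assms(1)] True assms(2)] a_step[OF \<Delta>_add_axis[OF assms(1)] this assms(2)]
  show ?thesis
    unfolding eq by (rule trans[OF sym])
next
  case False
  have eq: "\<gamma> + axis i 1 + axis j 1 = \<gamma> + axis j 1 + axis i 1" by (simp add: ac_simps)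
  have "\<gamma> + axis i 1 \<in> N \<union> border N" "\<gamma> + axis j 1 \<in> N \<union> border N"
    using assms \<Delta>_add_axis by blast+
  moreover have "\<gamma> + axis i 1 \<notin> N" "\<gamma> + axis j 1 \<notin> N"
    using False add_axis_in_border eq by metis+
  ultimately show ?thesis
    using False eq assms add_axis_in_border2[of "\<gamma> + axis i 1" N j]
    by (intro a_border) auto
qed

text \<open>Vectors are extended by zero, so that equality in B^\<Delta> is equality of
  functions.\<close>

definition vecs :: "(nat ^ 'n \<Rightarrow> 'b) set"
  where "vecs = {v. (\<forall>\<beta>\<in>\<Delta>. v \<beta> \<in> carrier B) \<and> (\<forall>\<beta>. \<beta> \<notin> \<Delta> \<longrightarrow> v \<beta> = \<zero>\<^bsub>B\<^esub>)}"

text \<open>Multiplication by \<open>x\<^sub>i\<close> on \<open>B\<^sup>\<Delta>\<close>.  It is the identity outside \<open>B\<^sup>\<Delta>\<close>, so that these maps commute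
  as functions on the whole type.\<close>

definition act :: "'n \<Rightarrow> (nat ^ 'n \<Rightarrow> 'b) \<Rightarrow> nat ^ 'n \<Rightarrow> 'b"
  where "act i v = (if v \<in> vecs
    then (\<lambda>\<beta>. if \<beta> \<in> \<Delta> then (\<Oplus>\<^bsub>B\<^esub>\<gamma>\<in>\<Delta>. v \<gamma> \<otimes>\<^bsub>B\<^esub> a (\<gamma> + axis i 1) \<beta>) else \<zero>\<^bsub>B\<^esub>) else v)"

lemma act_vecs: "v \<in> vecs \<Longrightarrow> act i v \<in> vecs"
  by (auto simp: act_def vecs_def intro!: B.finsum_closed)

text \<open>Vectors are rows and matrices act from the right: the result is v M_j M_i.\<close>

lemma act_act:
  assumes "v \<in> vecs" "\<beta> \<in> \<Delta>"
  shows "act i (act j v) \<beta> =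
    (\<Oplus>\<^bsub>B\<^esub>\<gamma>\<in>\<Delta>. v \<gamma> \<otimes>\<^bsub>B\<^esub> (\<Oplus>\<^bsub>B\<^esub>\<delta>\<in>\<Delta>. a (\<gamma> + axis j 1) \<delta> \<otimes>\<^bsub>B\<^esub> a (\<delta> + axis i 1) \<beta>))"
proof -
  have [simp]: "v \<gamma> \<in> carrier B" if "\<gamma> \<in> \<Delta>" for \<gamma> using assms that by (auto simp: vecs_def)
  have "act i (act j v) \<beta> = (\<Oplus>\<^bsub>B\<^esub>\<delta>\<in>\<Delta>. (\<Oplus>\<^bsub>B\<^esub>\<gamma>\<in>\<Delta>. v \<gamma> \<otimes>\<^bsub>B\<^esub> a (\<gamma> + axis j 1) \<delta>) \<otimes>\<^bsub>B\<^esub> a (\<delta> + axis i 1) \<beta>)"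
    using assms act_vecs[OF assms(1), of j]
    by (simp add: act_def[of i] act_def[of j]) (intro B.finsum_cong', auto intro!: B.finsum_closed)
  also have "\<dots> = (\<Oplus>\<^bsub>B\<^esub>\<delta>\<in>\<Delta>. \<Oplus>\<^bsub>B\<^esub>\<gamma>\<in>\<Delta>. v \<gamma> \<otimes>\<^bsub>B\<^esub> a (\<gamma> + axis j 1) \<delta> \<otimes>\<^bsub>B\<^esub> a (\<delta> + axis i 1) \<beta>)"
    using assms by (intro B.finsum_cong'[OF refl]) (auto simp: B.finsum_ldistr intro!: B.finsum_closed)
  also have "\<dots> = (\<Oplus>\<^bsub>B\<^esub>\<gamma>\<in>\<Delta>. \<Oplus>\<^bsub>B\<^esub>\<delta>\<in>\<Delta>. v \<gamma> \<otimes>\<^bsub>B\<^esub> a (\<gamma> + axis j 1) \<delta> \<otimes>\<^bsub>B\<^esub> a (\<delta> + axis i 1) \<beta>)"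
    using assms by (intro B.finsum_swap) auto
  also have "\<dots> = (\<Oplus>\<^bsub>B\<^esub>\<gamma>\<in>\<Delta>. v \<gamma> \<otimes>\<^bsub>B\<^esub> (\<Oplus>\<^bsub>B\<^esub>\<delta>\<in>\<Delta>. a (\<gamma> + axis j 1) \<delta> \<otimes>\<^bsub>B\<^esub> a (\<delta> + axis i 1) \<beta>))"
    using assms
    by (intro B.finsum_cong'[OF refl])
       (auto simp: B.finsum_rdistr B.m_assoc intro!: B.finsum_closed B.finsum_cong')
  finally show ?thesis .
qed

lemma act_commute: "act i \<circ> act j = act j \<circ> act i"
proof (rule ext)
  fix v
  show "(act i \<circ> act j) v = (act j \<circ> act i) v"
  proof (cases "v \<in> vecs")
    case True
    have "act i (act j v) \<beta> = act j (act i v) \<beta>" for \<beta>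
    proof (cases "\<beta> \<in> \<Delta>")
      case \<beta>: True
      have [simp]: "v \<gamma> \<in> carrier B" if "\<gamma> \<in> \<Delta>" for \<gamma> using True that by (auto simp: vecs_def)
      show ?thesis
        unfolding act_act[OF True \<beta>] using \<beta>
        by (intro B.finsum_cong'[OF refl])
           (auto simp: mult_matrices_commute[of _ \<beta> i j] intro!: B.finsum_closed)
    next
      case False
      have "act i (act j v) \<in> vecs" "act j (act i v) \<in> vecs" using True by (simp_all add: act_vecs)
      then show ?thesis using False by (simp add: vecs_def)
    qed
    then show ?thesis by auto
  next
    case False
    then show ?thesis by (simp add: act_def)
  qed
qed

text \<open>The coordinates of 1 = x^0, the cyclic generator; 0 lies in \<Delta> because \<Delta> is
  standard and nonempty.\<close>

definition e0 :: "nat ^ 'n \<Rightarrow> 'b" where "e0 = (\<lambda>\<beta>. if \<beta> = 0 then \<one>\<^bsub>B\<^esub> else \<zero>\<^bsub>B\<^esub>)"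

text \<open>\<open>c \<alpha> \<beta>\<close> is the coefficient of \<open>x\<^sup>\<beta>\<close> in the normal form of \<open>x\<^sup>\<alpha>\<close>.\<close>

definition c :: "nat ^ 'n \<Rightarrow> nat ^ 'n \<Rightarrow> 'b"
  where "c \<alpha> = Finite_Set.fold (\<lambda>i. act i ^^ (\<alpha> $ i)) e0 UNIV"

lemma comp_fun_commute_act: "comp_fun_commute_on UNIV (\<lambda>i. act i ^^ (\<alpha> $ i))"
  by unfold_locales (rule funpow_commute[OF act_commute])

text \<open>Since the factors commute, factor i can be applied last in the fold, and the remaining
  factors do not see coordinate i.\<close>

lemma c_step: "c (\<alpha> + axis i 1) = act i (c \<alpha>)"
proof -
  let ?f = "\<lambda>\<alpha> i. act i ^^ (\<alpha> $ i)"
  have *: "c \<alpha> = (act i ^^ (\<alpha> $ i)) (Finite_Set.fold (?f \<alpha>) e0 (UNIV - {i}))" for \<alpha>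
    using comp_fun_commute_on.fold_rec[OF comp_fun_commute_act subset_refl finite_class.finite_UNIV UNIV_I, of \<alpha> e0 i]
    unfolding c_def by simp
  have "Finite_Set.fold (?f (\<alpha> + axis i 1)) e0 (UNIV - {i}) = Finite_Set.fold (?f \<alpha>) e0 (UNIV - {i})"
  proof (rule fold_closed_eq[where B = UNIV])
    show "(act j ^^ ((\<alpha> + axis i 1) $ j)) v = (act j ^^ (\<alpha> $ j)) v" if "j \<in> UNIV - {i}" for j v
      using that by (simp add: axis_def)
  qed auto
  moreover have "(\<alpha> + axis i 1) $ i = Suc (\<alpha> $ i)" by (simp add: axis_def)
  ultimately show ?thesis by (simp add: * del: vector_add_component)
qed

lemma c_zero: "c 0 = e0"
proof -
  have "Finite_Set.fold (\<lambda>i. act i ^^ ((0::nat ^ 'n) $ i)) e0 S = e0" if "finite S" for S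
    using that
  proof (induction S rule: finite_induct)
    case (insert i S)
    show ?case
      unfolding comp_fun_commute_on.fold_insert[OF comp_fun_commute_act subset_UNIV insert.hyps] insert.IH
      by simp
  qed simp
  then show ?thesis by (simp add: c_def)
qed

lemma c_vecs: "c \<alpha> \<in> vecs"
proof (induction \<alpha> rule: exponent_induct)
  case zero
  then show ?case by (auto simp: c_zero e0_def vecs_def)
qed (simp add: c_step act_vecs)

lemma c_closed [simp, intro]: "\<beta> \<in> \<Delta> \<Longrightarrow> c \<alpha> \<beta> \<in> carrier B"
  using c_vecs by (auto simp: vecs_def)

lemma c_add_axis:
  "\<beta> \<in> \<Delta> \<Longrightarrow> c (\<alpha> + axis i 1) \<beta> = (\<Oplus>\<^bsub>B\<^esub>\<gamma>\<in>\<Delta>. c \<alpha> \<gamma> \<otimes>\<^bsub>B\<^esub> a (\<gamma> + axis i 1) \<beta>)"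
  by (simp add: c_step act_def c_vecs)

text \<open>Both sides satisfy the same recursion. It stays where \<open>a\<close> is controlled,
  because N \<union> N^(1) is standard and hence closed under going down.\<close>

lemma c_eq_a:
  assumes "\<alpha> \<in> N \<union> border N" "\<beta> \<in> \<Delta>"
  shows "c \<alpha> \<beta> = a \<alpha> \<beta>"
  using assms
proof (induction \<alpha> arbitrary: \<beta> rule: exponent_induct)
  case zero
  then show ?case by (auto simp: c_zero e0_def a_unit)
next
  case (step \<alpha> i)
  have \<alpha>: "\<alpha> \<in> N \<union> border N"
    using standard_setD[OF standard_set_Un_border[OF standard_N] step.prems(1)] .
  have "c (\<alpha> + axis i 1) \<beta> = (\<Oplus>\<^bsub>B\<^esub>\<gamma>\<in>\<Delta>. a \<alpha> \<gamma> \<otimes>\<^bsub>B\<^esub> a (\<gamma> + axis i 1) \<beta>)"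
    unfolding c_add_axis[OF step.prems(2)] using step.IH[OF \<alpha>] step.prems(2)
    by (intro B.finsum_cong') (auto intro: a_closed[OF \<alpha>])
  then show ?case using a_step[OF \<alpha> step.prems] by simp
qed

lemma c_unit: "\<alpha> \<in> \<Delta> \<Longrightarrow> \<beta> \<in> \<Delta> \<Longrightarrow> c \<alpha> \<beta> = (if \<alpha> = \<beta> then \<one>\<^bsub>B\<^esub> else \<zero>\<^bsub>B\<^esub>)"
  using c_eq_a[OF \<Delta>_in_N] a_unit by simp

text \<open>In matrices this is c (\<alpha> + \<alpha>') = c \<alpha>' M^\<alpha>, where row
  \<gamma> of M^\<alpha> is c (\<gamma> + \<alpha>): the basis vector at \<gamma> represents
  x^\<gamma>, and applying x^\<alpha> to it gives x^(\<gamma> + \<alpha>).\<close>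

lemma c_add:
  assumes "\<beta> \<in> \<Delta>"
  shows "c (\<alpha> + \<alpha>') \<beta> = (\<Oplus>\<^bsub>B\<^esub>\<gamma>\<in>\<Delta>. c \<alpha>' \<gamma> \<otimes>\<^bsub>B\<^esub> c (\<gamma> + \<alpha>) \<beta>)"
  using assms
proof (induction \<alpha> arbitrary: \<beta> rule: exponent_induct)
  case zero
  have "(\<Oplus>\<^bsub>B\<^esub>\<gamma>\<in>\<Delta>. c \<alpha>' \<gamma> \<otimes>\<^bsub>B\<^esub> c (\<gamma> + 0) \<beta>) = (\<Oplus>\<^bsub>B\<^esub>\<gamma>\<in>\<Delta>. if \<gamma> = \<beta> then c \<alpha>' \<beta> else \<zero>\<^bsub>B\<^esub>)"
    using zero by (intro B.finsum_cong') (auto simp: c_unit)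
  then show ?case using zero by (simp add: B.finsum_single)
next
  case (step \<alpha> i)
  note [simp] = \<open>\<beta> \<in> \<Delta>\<close>
  have "c (\<alpha> + axis i 1 + \<alpha>') \<beta> = (\<Oplus>\<^bsub>B\<^esub>\<delta>\<in>\<Delta>. c (\<alpha> + \<alpha>') \<delta> \<otimes>\<^bsub>B\<^esub> a (\<delta> + axis i 1) \<beta>)"
    using c_add_axis[of \<beta> "\<alpha> + \<alpha>'" i] by (simp add: ac_simps)
  also have "\<dots> = (\<Oplus>\<^bsub>B\<^esub>\<delta>\<in>\<Delta>. \<Oplus>\<^bsub>B\<^esub>\<gamma>\<in>\<Delta>. c \<alpha>' \<gamma> \<otimes>\<^bsub>B\<^esub> (c (\<gamma> + \<alpha>) \<delta> \<otimes>\<^bsub>B\<^esub> a (\<delta> + axis i 1) \<beta>))"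
    by (intro B.finsum_cong'[OF refl])
       (auto simp: step.IH B.finsum_ldistr B.m_assoc intro!: B.finsum_closed B.finsum_cong')
  also have "\<dots> = (\<Oplus>\<^bsub>B\<^esub>\<gamma>\<in>\<Delta>. \<Oplus>\<^bsub>B\<^esub>\<delta>\<in>\<Delta>. c \<alpha>' \<gamma> \<otimes>\<^bsub>B\<^esub> (c (\<gamma> + \<alpha>) \<delta> \<otimes>\<^bsub>B\<^esub> a (\<delta> + axis i 1) \<beta>))"
    by (intro B.finsum_swap) auto
  also have "\<dots> = (\<Oplus>\<^bsub>B\<^esub>\<gamma>\<in>\<Delta>. c \<alpha>' \<gamma> \<otimes>\<^bsub>B\<^esub> c (\<gamma> + \<alpha> + axis i 1) \<beta>)"
    by (intro B.finsum_cong'[OF refl])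
       (auto simp: c_add_axis B.finsum_rdistr)
  finally show ?case by (simp add: ac_simps)
qed

text \<open>In the recursion every summand vanishes: either \<alpha> \<prec> \<gamma> and the first
  factor is zero by induction, or \<gamma> + e_i is at most \<alpha> + e_i, hence below \<beta>, and
  the second factor is a vanishing entry of \<open>a\<close>.\<close>

lemma c_order:
  assumes "\<beta> \<in> \<Delta>" "lt \<alpha> \<beta>"
  shows "c \<alpha> \<beta> = \<zero>\<^bsub>B\<^esub>"
  using assms
proof (induction \<alpha> arbitrary: \<beta> rule: exponent_induct)
  case zero
  then show ?case using lt_irrefl by (auto simp: c_zero e0_def)
next
  case (step \<alpha> i)
  have "c \<alpha> \<gamma> \<otimes>\<^bsub>B\<^esub> a (\<gamma> + axis i 1) \<beta> = \<zero>\<^bsub>B\<^esub>" if \<gamma>: "\<gamma> \<in> \<Delta>" for \<gamma>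
  proof (cases "lt \<alpha> \<gamma>")
    case False
    then have "\<gamma> = \<alpha> \<or> lt (\<gamma> + axis i 1) (\<alpha> + axis i 1)" using lt_total lt_add by blast
    then have "lt (\<gamma> + axis i 1) \<beta>" using step.prems lt_trans by blast
    then show ?thesis using \<gamma> step.prems a_order[OF \<Delta>_add_axis[OF \<gamma>]] by simp
  qed (use step \<gamma> in simp)
  then show ?case
    unfolding c_add_axis[OF step.prems(1)] by (intro B.add.finprod_one_eqI)
qed

section \<open>Coordinates of polynomials and their common kernel\<close>

definition coord :: "(nat ^ 'n \<Rightarrow> 'b) \<Rightarrow> nat ^ 'n \<Rightarrow> 'b"
  where "coord p \<beta> = lin_ext B B1 (\<lambda>\<alpha>. c \<alpha> \<beta>) p"

lemma coord_closed [simp]: "p \<in> carrier PB \<Longrightarrow> \<beta> \<in> \<Delta> \<Longrightarrow> coord p \<beta> \<in> carrier B"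
  unfolding coord_def by (rule P.lin_self_closed) auto

lemma coord_single: "\<beta> \<in> \<Delta> \<Longrightarrow> coord (single B \<alpha>) \<beta> = c \<alpha> \<beta>"
  unfolding coord_def by (subst P.lin_ext_single[OF P.module_self]) auto

lemma coord_add: "p \<in> carrier PB \<Longrightarrow> q \<in> carrier PB \<Longrightarrow> \<beta> \<in> \<Delta> \<Longrightarrow>
  coord (p \<oplus>\<^bsub>PB\<^esub> q) \<beta> = coord p \<beta> \<oplus>\<^bsub>B\<^esub> coord q \<beta>"
  unfolding coord_def by (subst P.lin_ext_add[OF P.module_self]) auto

lemma coord_smult: "p \<in> carrier PB \<Longrightarrow> b \<in> carrier B \<Longrightarrow> \<beta> \<in> \<Delta> \<Longrightarrow>
  coord (b \<odot>\<^bsub>PB\<^esub> p) \<beta> = b \<otimes>\<^bsub>B\<^esub> coord p \<beta>"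
  unfolding coord_def by (subst P.lin_ext_smult[OF P.module_self]) auto

text \<open>By \<open>c_add\<close> the coordinates of p q are combinations of those of q, with
  weights that come from p. So a q with vanishing coordinates absorbs every p.\<close>

lemma coord_mult:
  assumes "p \<in> carrier PB" "q \<in> carrier PB" "\<beta> \<in> \<Delta>"
  shows "coord (p \<otimes>\<^bsub>PB\<^esub> q) \<beta> =
    lin_ext B B1 (\<lambda>u. \<Oplus>\<^bsub>B\<^esub>\<gamma>\<in>\<Delta>. coord q \<gamma> \<otimes>\<^bsub>B\<^esub> c (\<gamma> + u) \<beta>) p"
proof -
  have "lin_ext B B1 (\<lambda>v. c (u + v) \<beta>) q = (\<Oplus>\<^bsub>B\<^esub>\<gamma>\<in>\<Delta>. coord q \<gamma> \<otimes>\<^bsub>B\<^esub> c (\<gamma> + u) \<beta>)" for u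
  proof -
    have c_uv: "c (u + v) \<beta> = (\<Oplus>\<^bsub>B1\<^esub>\<gamma>\<in>\<Delta>. c v \<gamma> \<odot>\<^bsub>B1\<^esub> c (\<gamma> + u) \<beta>)" for v
      using c_add[OF assms(3), of u v] by simp
    have "lin_ext B B1 (\<lambda>v. c (u + v) \<beta>) q
        = lin_ext B B1 (\<lambda>v. \<Oplus>\<^bsub>B1\<^esub>\<gamma>\<in>\<Delta>. c v \<gamma> \<odot>\<^bsub>B1\<^esub> c (\<gamma> + u) \<beta>) q"
      by (simp only: c_uv)
    also have "\<dots> = (\<Oplus>\<^bsub>B1\<^esub>\<gamma>\<in>\<Delta>. lin_ext B B1 (\<lambda>v. c v \<gamma>) q \<odot>\<^bsub>B1\<^esub> c (\<gamma> + u) \<beta>)"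
      using assms by (intro P.lin_ext_finsum P.module_self) auto
    finally show ?thesis by (simp add: coord_def)
  qed
  then show ?thesis
    unfolding coord_def[of "p \<otimes>\<^bsub>PB\<^esub> q"] using assms
    by (subst P.lin_ext_mult[OF P.module_self]) auto
qed

text \<open>The annihilator of \<open>e0\<close> in B[x], as the common kernel of the functionals
  \<open>coord\<close>.\<close>

definition border_ideal :: "(nat ^ 'n \<Rightarrow> 'b) set"
  where "border_ideal = {p \<in> carrier PB. \<forall>\<beta>\<in>\<Delta>. coord p \<beta> = \<zero>\<^bsub>B\<^esub>}"

lemma ideal_border_ideal: "ideal border_ideal PB"
proof -
  have mult: "p \<otimes>\<^bsub>PB\<^esub> q \<in> border_ideal" if "p \<in> carrier PB" "q \<in> border_ideal" for p q
  proof -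
    have "coord (p \<otimes>\<^bsub>PB\<^esub> q) \<beta> = \<zero>\<^bsub>B\<^esub>" if "\<beta> \<in> \<Delta>" for \<beta>
    proof -
      have "(\<Oplus>\<^bsub>B\<^esub>\<gamma>\<in>\<Delta>. coord q \<gamma> \<otimes>\<^bsub>B\<^esub> c (\<gamma> + u) \<beta>) = \<zero>\<^bsub>B\<^esub>" for u
        using \<open>q \<in> border_ideal\<close> \<open>\<beta> \<in> \<Delta>\<close> by (intro B.add.finprod_one_eqI) (auto simp: border_ideal_def)
      then show ?thesis
        using \<open>p \<in> carrier PB\<close> \<open>q \<in> border_ideal\<close> \<open>\<beta> \<in> \<Delta>\<close> P.carrierD(1)[of p]
        by (subst coord_mult) (auto simp: border_ideal_def lin_ext_def intro!: B.add.finprod_one_eqI)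
    qed
    then show ?thesis using that by (auto simp: border_ideal_def)
  qed
  \<comment> \<open>Negation as a scalar multiple, so that linearity of \<open>coord\<close> also
    covers additive inverses.\<close>
  have minus: "\<ominus>\<^bsub>PB\<^esub> p = (\<ominus>\<^bsub>B\<^esub> \<one>\<^bsub>B\<^esub>) \<odot>\<^bsub>PB\<^esub> p" if "p \<in> carrier PB" for p
    using that by (simp add: PA.smult_l_minus)
  have mult': "q \<otimes>\<^bsub>PB\<^esub> p \<in> border_ideal" if "p \<in> carrier PB" "q \<in> border_ideal" for p q
    using mult[OF that] that PA.m_comm[of p q] by (simp add: border_ideal_def)
  show ?thesis
  proof (rule idealI)
    show "ring PB" by (rule PA.ring_axioms)
    show "subgroup border_ideal (add_monoid PB)"
    proof (rule PA.M.add.subgroupI)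
      have "coord \<zero>\<^bsub>PB\<^esub> \<beta> = \<zero>\<^bsub>B\<^esub>" if "\<beta> \<in> \<Delta>" for \<beta>
        using coord_smult[of "\<zero>\<^bsub>PB\<^esub>" "\<zero>\<^bsub>B\<^esub>" \<beta>] that by simp
      then show "border_ideal \<noteq> {}" by (auto simp: border_ideal_def)
      fix p q assume "p \<in> border_ideal" "q \<in> border_ideal"
      then show "\<ominus>\<^bsub>PB\<^esub> p \<in> border_ideal" "p \<oplus>\<^bsub>PB\<^esub> q \<in> border_ideal"
        by (auto simp: border_ideal_def minus coord_smult coord_add)
    qed (auto simp: border_ideal_def)
  qed (use mult mult' in auto)
qed

end

section \<open>Presentations with a given kernel\<close>

context poly_data
begin

text \<open>Embeds B^\<Delta> into B[x] as the polynomials supported on \<Delta>, which are the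
  possible normal forms.\<close>

definition cut :: "(nat ^ 'n \<Rightarrow> 'b) \<Rightarrow> nat ^ 'n \<Rightarrow> 'b"
  where "cut v = (\<lambda>u. if u \<in> \<Delta> then v u else \<zero>\<^bsub>B\<^esub>)"

lemma cut_closed [simp]: "(\<And>\<beta>. \<beta> \<in> \<Delta> \<Longrightarrow> v \<beta> \<in> carrier B) \<Longrightarrow> cut v \<in> carrier PB"
  by (auto simp: cut_def poly_algebra_def carrier_monoid_algebra intro: finite_subset[OF _ finite_\<Delta>])

lemma lin_ext_cut:
  assumes "module B C" "\<And>\<beta>. \<beta> \<in> \<Delta> \<Longrightarrow> v \<beta> \<in> carrier B" "\<And>u. l u \<in> carrier C"
  shows "lin_ext B C l (cut v) = (\<Oplus>\<^bsub>C\<^esub>\<beta>\<in>\<Delta>. v \<beta> \<odot>\<^bsub>C\<^esub> l \<beta>)"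
proof -
  interpret C: module B C by fact
  have "lin_ext B C l (cut v) = (\<Oplus>\<^bsub>C\<^esub>\<beta>\<in>\<Delta>. cut v \<beta> \<odot>\<^bsub>C\<^esub> l \<beta>)"
    using assms by (intro P.lin_ext_eq cut_closed) (auto simp: cut_def)
  also have "\<dots> = (\<Oplus>\<^bsub>C\<^esub>\<beta>\<in>\<Delta>. v \<beta> \<odot>\<^bsub>C\<^esub> l \<beta>)"
    using assms by (intro C.M.finsum_cong') (auto simp: cut_def)
  finally show ?thesis .
qed

lemma alg_hom_cut:
  assumes "algebra B C" "\<phi> \<in> alg_hom B PB C" "\<And>\<beta>. \<beta> \<in> \<Delta> \<Longrightarrow> v \<beta> \<in> carrier B"
  shows "\<phi> (cut v) = (\<Oplus>\<^bsub>C\<^esub>\<beta>\<in>\<Delta>. v \<beta> \<odot>\<^bsub>C\<^esub> \<phi> (single B \<beta>))"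
proof -
  interpret C: algebra B C by fact
  show ?thesis
    using assms P.alg_hom_eq_lin_ext[OF assms(1,2), of "cut v"]
    by (subst lin_ext_cut[OF C.module, symmetric]) (auto simp: alg_hom_def ring_hom_closed)
qed

lemma presentationD:
  assumes "(Q, \<phi>) \<in> hilb_presentations B lt \<Delta>"
  shows "algebra B Q" "\<phi> \<in> alg_hom B PB Q" "\<phi> ` carrier PB = carrier Q"
    "carrier B \<noteq> {\<zero>\<^bsub>B\<^esub>} \<Longrightarrow> monic_ideal B lt (a_kernel PB Q \<phi>)"
    "carrier B \<noteq> {\<zero>\<^bsub>B\<^esub>} \<Longrightarrow> attached_standard_set B lt (a_kernel PB Q \<phi>) = \<Delta>"
  using assms by (auto simp: hilb_presentations_def)

lemma presentation_kernel_iff: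
  assumes "(Q, \<phi>) \<in> hilb_presentations B lt \<Delta>"
  shows "p \<in> a_kernel PB Q \<phi> \<longleftrightarrow> p \<in> carrier PB \<and> \<phi> p = \<zero>\<^bsub>Q\<^esub>"
  by (rule a_kernel_iff[OF PA.algebra_axioms presentationD(1,2)[OF assms]])

text \<open>A relation is a polynomial in the kernel supported on \<Delta>. If it were nonzero, its
  leading exponent would lie in \<Delta>, whereas leading exponents of the kernel avoid the attached
  standard set.\<close>

lemma presentation_independent:
  assumes pres: "(Q, \<phi>) \<in> hilb_presentations B lt \<Delta>"
    and b: "\<And>\<beta>. \<beta> \<in> \<Delta> \<Longrightarrow> b \<beta> \<in> carrier B"
    and sum: "(\<Oplus>\<^bsub>Q\<^esub>\<beta>\<in>\<Delta>. b \<beta> \<odot>\<^bsub>Q\<^esub> \<phi> (single B \<beta>)) = \<zero>\<^bsub>Q\<^esub>" and "\<beta> \<in> \<Delta>"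
  shows "b \<beta> = \<zero>\<^bsub>B\<^esub>"
proof (cases "carrier B = {\<zero>\<^bsub>B\<^esub>}")
  case True
  then show ?thesis using b \<open>\<beta> \<in> \<Delta>\<close> by auto
next
  case False
  have ker: "cut b \<in> a_kernel PB Q \<phi>"
    using sum b by (simp add: presentation_kernel_iff[OF pres] alg_hom_cut[OF presentationD(1,2)[OF pres]])
  show ?thesis
  proof (rule ccontr)
    assume "b \<beta> \<noteq> \<zero>\<^bsub>B\<^esub>"
    then have nz: "cut b \<noteq> (\<lambda>_. \<zero>\<^bsub>B\<^esub>)" using \<open>\<beta> \<in> \<Delta>\<close> by (auto simp: cut_def fun_eq_iff)
    then have "lead_exp B lt (cut b) \<in> lead_exp B lt ` (a_kernel PB Q \<phi> - {\<zero>\<^bsub>PB\<^esub>})"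
      using ker by (intro imageI) (simp add: zero_PB)
    then have "lead_exp B lt (cut b) \<notin> \<Delta>"
      using presentationD(5)[OF pres False] unfolding attached_standard_set_def by blast
    moreover have "cut b (lead_exp B lt (cut b)) \<noteq> \<zero>\<^bsub>B\<^esub>"
      using nz b by (intro lead_exp P.carrierD(3)) auto
    ultimately show False by (simp add: cut_def)
  qed
qed

text \<open>Independence applied to the differences. Later, equations between matrix entries come
  from expanding one element of \<open>Q\<close> in two ways.\<close>

lemma presentation_coeffs_unique:
  assumes pres: "(Q, \<phi>) \<in> hilb_presentations B lt \<Delta>"
    and b: "\<And>\<beta>. \<beta> \<in> \<Delta> \<Longrightarrow> b \<beta> \<in> carrier B" "\<And>\<beta>. \<beta> \<in> \<Delta> \<Longrightarrow> b' \<beta> \<in> carrier B"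
    and sum: "(\<Oplus>\<^bsub>Q\<^esub>\<beta>\<in>\<Delta>. b \<beta> \<odot>\<^bsub>Q\<^esub> \<phi> (single B \<beta>)) = (\<Oplus>\<^bsub>Q\<^esub>\<beta>\<in>\<Delta>. b' \<beta> \<odot>\<^bsub>Q\<^esub> \<phi> (single B \<beta>))"
    and "\<beta> \<in> \<Delta>"
  shows "b \<beta> = b' \<beta>"
proof -
  interpret Q: algebra B Q by (rule presentationD[OF pres])
  have [simp]: "\<phi> (single B \<beta>) \<in> carrier Q" for \<beta>
    using presentationD(2)[OF pres] by (auto simp: alg_hom_def ring_hom_closed)
  have S: "(\<Oplus>\<^bsub>Q\<^esub>\<beta>\<in>\<Delta>. b' \<beta> \<odot>\<^bsub>Q\<^esub> \<phi> (single B \<beta>)) \<in> carrier Q"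
    using b by (intro Q.M.finsum_closed) auto
  have "(\<Oplus>\<^bsub>Q\<^esub>\<beta>\<in>\<Delta>. (b \<beta> \<ominus>\<^bsub>B\<^esub> b' \<beta>) \<odot>\<^bsub>Q\<^esub> \<phi> (single B \<beta>)) \<oplus>\<^bsub>Q\<^esub> (\<Oplus>\<^bsub>Q\<^esub>\<beta>\<in>\<Delta>. b' \<beta> \<odot>\<^bsub>Q\<^esub> \<phi> (single B \<beta>))
      = (\<Oplus>\<^bsub>Q\<^esub>\<beta>\<in>\<Delta>. (b \<beta> \<ominus>\<^bsub>B\<^esub> b' \<beta>) \<odot>\<^bsub>Q\<^esub> \<phi> (single B \<beta>) \<oplus>\<^bsub>Q\<^esub> b' \<beta> \<odot>\<^bsub>Q\<^esub> \<phi> (single B \<beta>))"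
    using b by (intro Q.M.finsum_addf[symmetric]) auto
  also have "\<dots> = (\<Oplus>\<^bsub>Q\<^esub>\<beta>\<in>\<Delta>. b \<beta> \<odot>\<^bsub>Q\<^esub> \<phi> (single B \<beta>))"
    using b by (intro Q.M.finsum_cong')
      (auto simp: Q.smult_l_distr[symmetric] a_minus_def B.a_assoc B.l_neg)
  finally have eq: "(\<Oplus>\<^bsub>Q\<^esub>\<beta>\<in>\<Delta>. (b \<beta> \<ominus>\<^bsub>B\<^esub> b' \<beta>) \<odot>\<^bsub>Q\<^esub> \<phi> (single B \<beta>))
      \<oplus>\<^bsub>Q\<^esub> (\<Oplus>\<^bsub>Q\<^esub>\<beta>\<in>\<Delta>. b' \<beta> \<odot>\<^bsub>Q\<^esub> \<phi> (single B \<beta>)) = (\<Oplus>\<^bsub>Q\<^esub>\<beta>\<in>\<Delta>. b' \<beta> \<odot>\<^bsub>Q\<^esub> \<phi> (single B \<beta>))"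
    unfolding sum .
  have "(\<Oplus>\<^bsub>Q\<^esub>\<beta>\<in>\<Delta>. (b \<beta> \<ominus>\<^bsub>B\<^esub> b' \<beta>) \<odot>\<^bsub>Q\<^esub> \<phi> (single B \<beta>)) \<in> carrier Q"
    using b by (intro Q.M.finsum_closed) auto
  then have zero: "(\<Oplus>\<^bsub>Q\<^esub>\<beta>\<in>\<Delta>. (b \<beta> \<ominus>\<^bsub>B\<^esub> b' \<beta>) \<odot>\<^bsub>Q\<^esub> \<phi> (single B \<beta>)) = \<zero>\<^bsub>Q\<^esub>"
    using Q.M.add.r_cancel_one[OF S] eq by simp
  have "b \<beta> \<ominus>\<^bsub>B\<^esub> b' \<beta> = \<zero>\<^bsub>B\<^esub>"
    by (rule presentation_independent[OF pres _ zero \<open>\<beta> \<in> \<Delta>\<close>]) (use b in blast)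
  then show ?thesis
    using b \<open>\<beta> \<in> \<Delta>\<close> by (simp add: B.minus_eq_zero_iff)
qed

text \<open>Division by monic elements, as well-founded induction: outside \<Delta> the kernel has
  an element with leading term x^\<alpha> and coefficient one, which rewrites x^\<alpha> by smaller
  monomials. The vanishing is carried along: u \<prec> \<alpha> and \<alpha> \<prec> \<beta> give u
  \<prec> \<beta>.\<close>

lemma presentation_span:
  assumes pres: "(Q, \<phi>) \<in> hilb_presentations B lt \<Delta>"
  shows "\<exists>b. (\<forall>\<beta>\<in>\<Delta>. b \<beta> \<in> carrier B \<and> (lt \<alpha> \<beta> \<longrightarrow> b \<beta> = \<zero>\<^bsub>B\<^esub>)) \<and>
    \<phi> (single B \<alpha>) = (\<Oplus>\<^bsub>Q\<^esub>\<beta>\<in>\<Delta>. b \<beta> \<odot>\<^bsub>Q\<^esub> \<phi> (single B \<beta>))"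
proof -
  interpret Q: algebra B Q by (rule presentationD[OF pres])
  interpret \<phi>: ring_hom_cring PB Q \<phi>
    by (rule alg_hom_ring_hom_cring[OF PA.algebra_axioms presentationD(1,2)[OF pres]])
  have [simp]: "\<phi> (single B \<beta>) \<in> carrier Q" for \<beta> by simp
  show ?thesis
  proof (cases "carrier B = {\<zero>\<^bsub>B\<^esub>}")
    case True
    \<comment> \<open>Over the zero ring 1 = 0 collapses \<open>Q\<close>, so zero coefficients
      do.\<close>
    then have one: "\<one>\<^bsub>B\<^esub> = \<zero>\<^bsub>B\<^esub>" by (simp add: B.carrier_one_zero[symmetric])
    have "x = \<zero>\<^bsub>Q\<^esub>" if "x \<in> carrier Q" for x
      using Q.smult_one[OF that] that unfolding one by simp
    moreover have "(\<Oplus>\<^bsub>Q\<^esub>\<beta>\<in>\<Delta>. \<zero>\<^bsub>B\<^esub> \<odot>\<^bsub>Q\<^esub> \<phi> (single B \<beta>)) \<in> carrier Q"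
      by (intro Q.M.finsum_closed) auto
    ultimately have "\<phi> (single B \<alpha>) = (\<Oplus>\<^bsub>Q\<^esub>\<beta>\<in>\<Delta>. \<zero>\<^bsub>B\<^esub> \<odot>\<^bsub>Q\<^esub> \<phi> (single B \<beta>))"
      by (metis \<open>\<And>\<beta>. \<phi> (single B \<beta>) \<in> carrier Q\<close>)
    then show ?thesis by (intro exI[of _ "\<lambda>_. \<zero>\<^bsub>B\<^esub>"]) simp
  next
    case False
    show ?thesis
    proof (induction \<alpha> rule: wfp_induct_rule[OF wfp_lt])
      case (1 \<alpha>)
      show ?case
      proof (cases "\<alpha> \<in> \<Delta>")
        case True
        have "(\<Oplus>\<^bsub>Q\<^esub>\<beta>\<in>\<Delta>. (if \<beta> = \<alpha> then \<one>\<^bsub>B\<^esub> else \<zero>\<^bsub>B\<^esub>) \<odot>\<^bsub>Q\<^esub> \<phi> (single B \<beta>))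
            = (\<Oplus>\<^bsub>Q\<^esub>\<beta>\<in>\<Delta>. if \<beta> = \<alpha> then \<phi> (single B \<alpha>) else \<zero>\<^bsub>Q\<^esub>)"
          by (intro Q.M.finsum_cong') auto
        then show ?thesis
          using True lt_irrefl
          by (intro exI[of _ "\<lambda>\<beta>. if \<beta> = \<alpha> then \<one>\<^bsub>B\<^esub> else \<zero>\<^bsub>B\<^esub>"]) (auto simp: Q.M.finsum_single)
      next
        case \<alpha>: False
        let ?K = "a_kernel PB Q \<phi>"
        have "\<alpha> \<in> lead_exp B lt ` (?K - {\<zero>\<^bsub>PB\<^esub>})"
          using \<alpha> presentationD(5)[OF pres False] unfolding attached_standard_set_def by blast
        then obtain p where p: "p \<in> ?K - {\<zero>\<^bsub>PB\<^esub>}" "lead_exp B lt p = \<alpha>" by blast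
        have lead: "p \<alpha> \<noteq> \<zero>\<^bsub>B\<^esub>" "\<And>u. p u \<noteq> \<zero>\<^bsub>B\<^esub> \<Longrightarrow> u \<noteq> \<alpha> \<Longrightarrow> lt u \<alpha>"
          if "p \<in> ?K - {\<zero>\<^bsub>PB\<^esub>}" "lead_exp B lt p = \<alpha>" for p
          using lead_exp[where p = p and B = B] P.carrierD(3)[of p] that
          by (auto simp: zero_PB presentation_kernel_iff[OF pres])
        \<comment> \<open>The leading coefficient of \<open>p\<close> is nonzero, which rules out
          the zero ideal in \<open>monic_ideal\<close>.\<close>
        have "p \<alpha> \<in> lead_coeff_ideal B lt ?K \<alpha>" using p by (auto simp: lead_coeff_ideal_def)
        then have "lead_coeff_ideal B lt ?K \<alpha> = carrier B"
          using presentationD(4)[OF pres False] lead(1)[OF p] unfolding monic_ideal_def by blast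
        then have "\<one>\<^bsub>B\<^esub> \<in> lead_coeff_ideal B lt ?K \<alpha>" by simp
        \<comment> \<open>As 1 \<noteq> 0, the unit is a true leading coefficient and not the zero
          that was adjoined.\<close>
        then obtain f where f: "f \<in> ?K - {\<zero>\<^bsub>PB\<^esub>}" "lead_exp B lt f = \<alpha>" "f \<alpha> = \<one>\<^bsub>B\<^esub>"
          unfolding lead_coeff_ideal_def using False[unfolded B.carrier_one_zero]
          by (elim UnE CollectE exE conjE) (simp_all add: that)
        have f_PB: "f \<in> carrier PB" and \<phi>f: "\<phi> f = \<zero>\<^bsub>Q\<^esub>"
          using f(1) by (auto simp: presentation_kernel_iff[OF pres])
        note [simp] = P.carrierD(1)[OF f_PB]
        define S where "S = {u. f u \<noteq> \<zero>\<^bsub>B\<^esub>} - {\<alpha>}"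
        have S: "finite S" "\<alpha> \<notin> S" "{u. f u \<noteq> \<zero>\<^bsub>B\<^esub>} = insert \<alpha> S"
          using P.carrierD(3)[OF f_PB] lead(1)[OF f(1,2)] by (auto simp: S_def)
        have lt: "lt u \<alpha>" if "u \<in> S" for u
          using that lead(2)[OF f(1,2)] by (auto simp: S_def)
        have "\<zero>\<^bsub>Q\<^esub> = lin_ext B Q (\<lambda>u. \<phi> (single B u)) f"
          using P.alg_hom_eq_lin_ext[OF presentationD(1,2)[OF pres] f_PB] \<phi>f by simp
        also have "\<dots> = \<phi> (single B \<alpha>) \<oplus>\<^bsub>Q\<^esub> (\<Oplus>\<^bsub>Q\<^esub>u\<in>S. f u \<odot>\<^bsub>Q\<^esub> \<phi> (single B u))"
          unfolding lin_ext_def S(3) using S f(3) by (subst Q.M.finsum_insert) auto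
        finally have \<phi>\<alpha>: "\<phi> (single B \<alpha>) = \<ominus>\<^bsub>Q\<^esub> (\<Oplus>\<^bsub>Q\<^esub>u\<in>S. f u \<odot>\<^bsub>Q\<^esub> \<phi> (single B u))"
          by (intro Q.sum_zero_eq_neg) (auto intro!: Q.M.finsum_closed)
        have "\<forall>u\<in>S. \<exists>b. (\<forall>\<beta>\<in>\<Delta>. b \<beta> \<in> carrier B \<and> (lt u \<beta> \<longrightarrow> b \<beta> = \<zero>\<^bsub>B\<^esub>)) \<and>
            \<phi> (single B u) = (\<Oplus>\<^bsub>Q\<^esub>\<beta>\<in>\<Delta>. b \<beta> \<odot>\<^bsub>Q\<^esub> \<phi> (single B \<beta>))"
          using 1 lt by blast
        from bchoice[OF this] obtain b where b: "\<And>u \<beta>. u \<in> S \<Longrightarrow> \<beta> \<in> \<Delta> \<Longrightarrow> b u \<beta> \<in> carrier B"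
          "\<And>u \<beta>. u \<in> S \<Longrightarrow> \<beta> \<in> \<Delta> \<Longrightarrow> lt u \<beta> \<Longrightarrow> b u \<beta> = \<zero>\<^bsub>B\<^esub>"
          "\<And>u. u \<in> S \<Longrightarrow> \<phi> (single B u) = (\<Oplus>\<^bsub>Q\<^esub>\<beta>\<in>\<Delta>. b u \<beta> \<odot>\<^bsub>Q\<^esub> \<phi> (single B \<beta>))"
          by blast
        \<comment> \<open>Read off from x^\<alpha> \<equiv> - \<Sum> f_u x^u after expanding every
          x^u.\<close>
        define b' where "b' \<beta> = \<ominus>\<^bsub>B\<^esub> (\<Oplus>\<^bsub>B\<^esub>u\<in>S. f u \<otimes>\<^bsub>B\<^esub> b u \<beta>)" for \<beta>
        have b'_closed: "b' \<beta> \<in> carrier B" if "\<beta> \<in> \<Delta>" for \<beta>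
          unfolding b'_def using b(1) that by (intro B.a_inv_closed B.finsum_closed) auto
        have "(\<Oplus>\<^bsub>Q\<^esub>u\<in>S. f u \<odot>\<^bsub>Q\<^esub> \<phi> (single B u))
            = (\<Oplus>\<^bsub>Q\<^esub>u\<in>S. \<Oplus>\<^bsub>Q\<^esub>\<beta>\<in>\<Delta>. (f u \<otimes>\<^bsub>B\<^esub> b u \<beta>) \<odot>\<^bsub>Q\<^esub> \<phi> (single B \<beta>))"
        proof (rule Q.M.finsum_cong'[OF refl])
          fix u assume u: "u \<in> S"
          have "f u \<odot>\<^bsub>Q\<^esub> \<phi> (single B u) = (\<Oplus>\<^bsub>Q\<^esub>\<beta>\<in>\<Delta>. f u \<odot>\<^bsub>Q\<^esub> (b u \<beta> \<odot>\<^bsub>Q\<^esub> \<phi> (single B \<beta>)))"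
            unfolding b(3)[OF u] using b(1) u by (intro Q.finsum_smult_ldistr) auto
          also have "\<dots> = (\<Oplus>\<^bsub>Q\<^esub>\<beta>\<in>\<Delta>. (f u \<otimes>\<^bsub>B\<^esub> b u \<beta>) \<odot>\<^bsub>Q\<^esub> \<phi> (single B \<beta>))"
            using b(1) u by (intro Q.M.finsum_cong'[OF refl]) (auto simp: Q.smult_assoc1)
          finally show "f u \<odot>\<^bsub>Q\<^esub> \<phi> (single B u) = (\<Oplus>\<^bsub>Q\<^esub>\<beta>\<in>\<Delta>. (f u \<otimes>\<^bsub>B\<^esub> b u \<beta>) \<odot>\<^bsub>Q\<^esub> \<phi> (single B \<beta>))" .
        qed (use b(1) in \<open>auto intro!: Q.M.finsum_closed\<close>)
        also have "\<dots> = (\<Oplus>\<^bsub>Q\<^esub>\<beta>\<in>\<Delta>. \<Oplus>\<^bsub>Q\<^esub>u\<in>S. (f u \<otimes>\<^bsub>B\<^esub> b u \<beta>) \<odot>\<^bsub>Q\<^esub> \<phi> (single B \<beta>))"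
          using S(1) b(1) by (intro Q.M.finsum_swap) auto
        also have "\<dots> = (\<Oplus>\<^bsub>Q\<^esub>\<beta>\<in>\<Delta>. (\<ominus>\<^bsub>B\<^esub> b' \<beta>) \<odot>\<^bsub>Q\<^esub> \<phi> (single B \<beta>))"
        proof (rule Q.M.finsum_cong'[OF refl])
          fix \<beta> assume \<beta>: "\<beta> \<in> \<Delta>"
          show "(\<Oplus>\<^bsub>Q\<^esub>u\<in>S. (f u \<otimes>\<^bsub>B\<^esub> b u \<beta>) \<odot>\<^bsub>Q\<^esub> \<phi> (single B \<beta>)) = (\<ominus>\<^bsub>B\<^esub> b' \<beta>) \<odot>\<^bsub>Q\<^esub> \<phi> (single B \<beta>)"
            unfolding b'_def using S(1) b(1) \<beta>
            by (subst Q.finsum_smult_rdistr[symmetric]) (auto simp: B.finsum_closed Pi_def)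
        qed (use b'_closed in auto)
        also have "\<dots> = (\<Oplus>\<^bsub>Q\<^esub>\<beta>\<in>\<Delta>. (\<ominus>\<^bsub>B\<^esub> \<one>\<^bsub>B\<^esub>) \<odot>\<^bsub>Q\<^esub> (b' \<beta> \<odot>\<^bsub>Q\<^esub> \<phi> (single B \<beta>)))"
          using b'_closed
          by (intro Q.M.finsum_cong'[OF refl]) (auto simp: Q.smult_l_minus)
        also have "\<dots> = (\<ominus>\<^bsub>B\<^esub> \<one>\<^bsub>B\<^esub>) \<odot>\<^bsub>Q\<^esub> (\<Oplus>\<^bsub>Q\<^esub>\<beta>\<in>\<Delta>. b' \<beta> \<odot>\<^bsub>Q\<^esub> \<phi> (single B \<beta>))"
          using b'_closed by (intro Q.finsum_smult_ldistr[symmetric]) auto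
        also have "\<dots> = \<ominus>\<^bsub>Q\<^esub> (\<Oplus>\<^bsub>Q\<^esub>\<beta>\<in>\<Delta>. b' \<beta> \<odot>\<^bsub>Q\<^esub> \<phi> (single B \<beta>))"
          using b'_closed by (subst Q.smult_l_minus) (auto intro!: Q.M.finsum_closed)
        finally have "\<phi> (single B \<alpha>) = (\<Oplus>\<^bsub>Q\<^esub>\<beta>\<in>\<Delta>. b' \<beta> \<odot>\<^bsub>Q\<^esub> \<phi> (single B \<beta>))"
          unfolding \<phi>\<alpha> using b'_closed by (simp add: Q.M.finsum_closed Pi_def)
        moreover have "b' \<beta> = \<zero>\<^bsub>B\<^esub>" if \<beta>: "\<beta> \<in> \<Delta>" "lt \<alpha> \<beta>" for \<beta>
        proof -
          have "(\<Oplus>\<^bsub>B\<^esub>u\<in>S. f u \<otimes>\<^bsub>B\<^esub> b u \<beta>) = \<zero>\<^bsub>B\<^esub>"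
            using b(2)[OF _ \<beta>(1) lt_trans[OF lt \<beta>(2)]] by (intro B.add.finprod_one_eqI) simp
          then show ?thesis by (simp add: b'_def)
        qed
        ultimately show ?thesis using b'_closed by (intro exI[of _ b']) auto
      qed
    qed
  qed
qed

definition kernel_class :: "(nat ^ 'n \<Rightarrow> 'b) set \<Rightarrow> ('b, 'n) presentation set"
  where "kernel_class I = {(Q, \<phi>) \<in> hilb_presentations B lt \<Delta>. a_kernel PB Q \<phi> = I}"

text \<open>Equivalence compares kernels only, so a point of the functor is recorded by an ideal of
  B[x].\<close>

lemma hilb_eq: "hilb B lt \<Delta> = {kernel_class (a_kernel PB Q \<phi>) | Q \<phi>. (Q, \<phi>) \<in> hilb_presentations B lt \<Delta>}"
proof -
  have "hilb_equiv B lt \<Delta> `` {(Q, \<phi>)} = kernel_class (a_kernel PB Q \<phi>)"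
    if "(Q, \<phi>) \<in> hilb_presentations B lt \<Delta>" for Q \<phi>
    using that by (auto simp: hilb_equiv_def kernel_class_def)
  then show ?thesis
    unfolding hilb_def quotient_def by (auto simp: set_eq_iff) (metis surj_pair)+
qed

end

section \<open>Presentations that satisfy the relations of a matrix\<close>

context border_matrix
begin

text \<open>The target is not tied to the type of presentations: the relations are also tested in
  the tensor product and in an algebra with restricted scalars.\<close>

definition satisfies :: "('b, 'q, 's) module_scheme \<Rightarrow> ((nat ^ 'n \<Rightarrow> 'b) \<Rightarrow> 'q) \<Rightarrow> bool"
  where "satisfies Q \<phi> \<longleftrightarrow> (\<forall>\<alpha>\<in>N \<union> border N. \<phi> (single B \<alpha>) = (\<Oplus>\<^bsub>Q\<^esub>\<beta>\<in>\<Delta>. a \<alpha> \<beta> \<odot>\<^bsub>Q\<^esub> \<phi> (single B \<beta>)))"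

text \<open>The relations are given on N \<union> N^(1) only but determine every monomial:
  multiplying a normal form by x_i leads to exponents \<gamma> + e_i with \<gamma> in \<Delta>,
  which are still covered. The result is the recursion of \<open>c\<close>.\<close>

lemma single_normal_form:
  assumes "algebra B Q" "\<phi> \<in> alg_hom B PB Q" "satisfies Q \<phi>"
  shows "\<phi> (single B \<alpha>) = (\<Oplus>\<^bsub>Q\<^esub>\<beta>\<in>\<Delta>. c \<alpha> \<beta> \<odot>\<^bsub>Q\<^esub> \<phi> (single B \<beta>))"
proof -
  interpret Q: algebra B Q by fact
  interpret \<phi>: ring_hom_cring PB Q \<phi>
    by (rule alg_hom_ring_hom_cring[OF PA.algebra_axioms assms(1,2)])
  have mult: "\<phi> (single B \<alpha>) \<otimes>\<^bsub>Q\<^esub> \<phi> (single B \<beta>) = \<phi> (single B (\<alpha> + \<beta>))" for \<alpha> \<beta>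
    using P.single_mult[of \<alpha> \<beta>] by (simp add: \<phi>.hom_mult[symmetric])
  show ?thesis
  proof (induction \<alpha> rule: exponent_induct)
    case zero
    have "(\<Oplus>\<^bsub>Q\<^esub>\<beta>\<in>\<Delta>. c 0 \<beta> \<odot>\<^bsub>Q\<^esub> \<phi> (single B \<beta>)) = (\<Oplus>\<^bsub>Q\<^esub>\<beta>\<in>\<Delta>. if \<beta> = 0 then \<phi> (single B 0) else \<zero>\<^bsub>Q\<^esub>)"
      by (intro Q.M.finsum_cong') (auto simp: c_zero e0_def)
    then show ?case by (simp add: Q.M.finsum_single)
  next
    case (step \<alpha> i)
    have "\<phi> (single B (\<alpha> + axis i 1)) = (\<Oplus>\<^bsub>Q\<^esub>\<gamma>\<in>\<Delta>. c \<alpha> \<gamma> \<odot>\<^bsub>Q\<^esub> \<phi> (single B \<gamma>)) \<otimes>\<^bsub>Q\<^esub> \<phi> (single B (axis i 1))"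
      by (simp add: mult[symmetric] step)
    also have "\<dots> = (\<Oplus>\<^bsub>Q\<^esub>\<gamma>\<in>\<Delta>. c \<alpha> \<gamma> \<odot>\<^bsub>Q\<^esub> \<phi> (single B \<gamma>) \<otimes>\<^bsub>Q\<^esub> \<phi> (single B (axis i 1)))"
      by (intro Q.finsum_ldistr) auto
    also have "\<dots> = (\<Oplus>\<^bsub>Q\<^esub>\<gamma>\<in>\<Delta>. \<Oplus>\<^bsub>Q\<^esub>\<beta>\<in>\<Delta>. (c \<alpha> \<gamma> \<otimes>\<^bsub>B\<^esub> a (\<gamma> + axis i 1) \<beta>) \<odot>\<^bsub>Q\<^esub> \<phi> (single B \<beta>))"
    proof (rule Q.M.finsum_cong'[OF refl])
      fix \<gamma> assume \<gamma>: "\<gamma> \<in> \<Delta>"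
      have "c \<alpha> \<gamma> \<odot>\<^bsub>Q\<^esub> \<phi> (single B \<gamma>) \<otimes>\<^bsub>Q\<^esub> \<phi> (single B (axis i 1)) = c \<alpha> \<gamma> \<odot>\<^bsub>Q\<^esub> \<phi> (single B (\<gamma> + axis i 1))"
        using \<gamma> by (subst Q.smult_assoc2) (auto simp: mult)
      also have "\<phi> (single B (\<gamma> + axis i 1)) = (\<Oplus>\<^bsub>Q\<^esub>\<beta>\<in>\<Delta>. a (\<gamma> + axis i 1) \<beta> \<odot>\<^bsub>Q\<^esub> \<phi> (single B \<beta>))"
        using assms(3) \<Delta>_add_axis[OF \<gamma>] unfolding satisfies_def by blast
      also have "c \<alpha> \<gamma> \<odot>\<^bsub>Q\<^esub> \<dots> = (\<Oplus>\<^bsub>Q\<^esub>\<beta>\<in>\<Delta>. c \<alpha> \<gamma> \<odot>\<^bsub>Q\<^esub> (a (\<gamma> + axis i 1) \<beta> \<odot>\<^bsub>Q\<^esub> \<phi> (single B \<beta>)))"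
        using \<gamma> by (intro Q.finsum_smult_ldistr) auto
      also have "\<dots> = (\<Oplus>\<^bsub>Q\<^esub>\<beta>\<in>\<Delta>. (c \<alpha> \<gamma> \<otimes>\<^bsub>B\<^esub> a (\<gamma> + axis i 1) \<beta>) \<odot>\<^bsub>Q\<^esub> \<phi> (single B \<beta>))"
        using \<gamma> by (intro Q.M.finsum_cong'[OF refl]) (auto simp: Q.smult_assoc1)
      finally show "c \<alpha> \<gamma> \<odot>\<^bsub>Q\<^esub> \<phi> (single B \<gamma>) \<otimes>\<^bsub>Q\<^esub> \<phi> (single B (axis i 1))
        = (\<Oplus>\<^bsub>Q\<^esub>\<beta>\<in>\<Delta>. (c \<alpha> \<gamma> \<otimes>\<^bsub>B\<^esub> a (\<gamma> + axis i 1) \<beta>) \<odot>\<^bsub>Q\<^esub> \<phi> (single B \<beta>))" .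
    qed (auto intro!: Q.M.finsum_closed)
    also have "\<dots> = (\<Oplus>\<^bsub>Q\<^esub>\<beta>\<in>\<Delta>. \<Oplus>\<^bsub>Q\<^esub>\<gamma>\<in>\<Delta>. (c \<alpha> \<gamma> \<otimes>\<^bsub>B\<^esub> a (\<gamma> + axis i 1) \<beta>) \<odot>\<^bsub>Q\<^esub> \<phi> (single B \<beta>))"
      by (intro Q.M.finsum_swap) auto
    also have "\<dots> = (\<Oplus>\<^bsub>Q\<^esub>\<beta>\<in>\<Delta>. c (\<alpha> + axis i 1) \<beta> \<odot>\<^bsub>Q\<^esub> \<phi> (single B \<beta>))"
    proof (rule Q.M.finsum_cong'[OF refl])
      fix \<beta> assume \<beta>: "\<beta> \<in> \<Delta>"
      show "(\<Oplus>\<^bsub>Q\<^esub>\<gamma>\<in>\<Delta>. (c \<alpha> \<gamma> \<otimes>\<^bsub>B\<^esub> a (\<gamma> + axis i 1) \<beta>) \<odot>\<^bsub>Q\<^esub> \<phi> (single B \<beta>)) = c (\<alpha> + axis i 1) \<beta> \<odot>\<^bsub>Q\<^esub> \<phi> (single B \<beta>)"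
        unfolding c_add_axis[OF \<beta>] using \<beta> by (intro Q.finsum_smult_rdistr[symmetric]) auto
    qed auto
    finally show ?case .
  qed
qed

lemma normal_form:
  assumes "algebra B Q" "\<phi> \<in> alg_hom B PB Q" "satisfies Q \<phi>" "p \<in> carrier PB"
  shows "\<phi> p = (\<Oplus>\<^bsub>Q\<^esub>\<beta>\<in>\<Delta>. coord p \<beta> \<odot>\<^bsub>Q\<^esub> \<phi> (single B \<beta>))"
proof -
  interpret Q: algebra B Q by fact
  have [simp]: "\<phi> (single B \<beta>) \<in> carrier Q" for \<beta>
    using assms(2) by (auto simp: alg_hom_def ring_hom_closed)
  have "\<phi> p = lin_ext B Q (\<lambda>\<alpha>. \<phi> (single B \<alpha>)) p"
    by (rule P.alg_hom_eq_lin_ext) fact+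
  also have "\<dots> = lin_ext B Q (\<lambda>\<alpha>. \<Oplus>\<^bsub>Q\<^esub>\<beta>\<in>\<Delta>. c \<alpha> \<beta> \<odot>\<^bsub>Q\<^esub> \<phi> (single B \<beta>)) p"
    by (intro P.lin_ext_cong Q.module single_normal_form[OF assms(1-3)] assms(4)) simp
  also have "\<dots> = (\<Oplus>\<^bsub>Q\<^esub>\<beta>\<in>\<Delta>. coord p \<beta> \<odot>\<^bsub>Q\<^esub> \<phi> (single B \<beta>))"
    unfolding coord_def using assms(4) by (intro P.lin_ext_finsum Q.module) auto
  finally show ?thesis .
qed

text \<open>All terms of the normal form vanish. This gives one inclusion of kernels in every
  algebra with these relations, also where the kernel is still unknown, as in the base
  change.\<close>

lemma satisfies_border_ideal:
  assumes "algebra B Q" "\<phi> \<in> alg_hom B PB Q" "satisfies Q \<phi>" "p \<in> border_ideal"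
  shows "\<phi> p = \<zero>\<^bsub>Q\<^esub>"
proof -
  interpret Q: algebra B Q by fact
  have [simp]: "\<phi> (single B \<beta>) \<in> carrier Q" for \<beta>
    using assms(2) by (auto simp: alg_hom_def ring_hom_closed)
  have p: "p \<in> carrier PB" "coord p \<beta> = \<zero>\<^bsub>B\<^esub>" if "\<beta> \<in> \<Delta>" for \<beta>
    using assms(4) that by (simp_all add: border_ideal_def)
  have "\<phi> p = (\<Oplus>\<^bsub>Q\<^esub>\<beta>\<in>\<Delta>. coord p \<beta> \<odot>\<^bsub>Q\<^esub> \<phi> (single B \<beta>))"
    by (rule normal_form[OF assms(1-3) p(1)[OF zero_in_\<Delta>]])
  also have "\<dots> = \<zero>\<^bsub>Q\<^esub>"
    by (rule Q.M.add.finprod_one_eqI) (simp add: p(2))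
  finally show ?thesis .
qed

lemma coord_cut:
  assumes "\<And>\<beta>. \<beta> \<in> \<Delta> \<Longrightarrow> v \<beta> \<in> carrier B" "\<beta> \<in> \<Delta>"
  shows "coord (cut v) \<beta> = v \<beta>"
proof -
  have "coord (cut v) \<beta> = lin_ext B B1 (\<lambda>\<alpha>. c \<alpha> \<beta>) (cut v)" by (simp add: coord_def)
  also have "\<dots> = (\<Oplus>\<^bsub>B1\<^esub>\<gamma>\<in>\<Delta>. v \<gamma> \<odot>\<^bsub>B1\<^esub> c \<gamma> \<beta>)"
    using assms by (intro lin_ext_cut P.module_self) auto
  also have "\<dots> = (\<Oplus>\<^bsub>B\<^esub>\<gamma>\<in>\<Delta>. if \<gamma> = \<beta> then v \<beta> else \<zero>\<^bsub>B\<^esub>)"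
    unfolding algebra_via_simps using assms by (intro B.finsum_cong') (auto simp: c_unit)
  finally show ?thesis using assms by (simp add: B.finsum_single)
qed

text \<open>For \<alpha> in \<open>border \<Delta>\<close> these are the members of the border
  basis. Subtraction is written with the scalar -1, so that linearity of \<open>coord\<close>
  applies directly.\<close>

definition border_poly :: "nat ^ 'n \<Rightarrow> nat ^ 'n \<Rightarrow> 'b"
  where "border_poly \<alpha> = single B \<alpha> \<oplus>\<^bsub>PB\<^esub> (\<ominus>\<^bsub>B\<^esub> \<one>\<^bsub>B\<^esub>) \<odot>\<^bsub>PB\<^esub> cut (c \<alpha>)"

lemma border_poly_mem: "border_poly \<alpha> \<in> border_ideal"
  by (auto simp: border_ideal_def border_poly_def coord_add coord_smult coord_single coord_cut B.l_minus B.r_neg)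

text \<open>Killing x^\<alpha> minus its normal form is the relation for \<alpha>, because on N
  \<union> N^(1) the normal form has the coefficients \<open>a \<alpha>\<close>.\<close>

lemma border_poly_satisfies:
  assumes "algebra B Q" "\<phi> \<in> alg_hom B PB Q" "\<And>p. p \<in> border_ideal \<Longrightarrow> \<phi> p = \<zero>\<^bsub>Q\<^esub>"
  shows "satisfies Q \<phi>"
  unfolding satisfies_def
proof
  interpret Q: algebra B Q by fact
  interpret \<phi>: ring_hom_cring PB Q \<phi>
    by (rule alg_hom_ring_hom_cring[OF PA.algebra_axioms assms(1,2)])
  fix \<alpha> assume \<alpha>: "\<alpha> \<in> N \<union> border N"
  have "\<zero>\<^bsub>Q\<^esub> = \<phi> (border_poly \<alpha>)" using assms(3)[OF border_poly_mem] by simp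
  also have "\<dots> = \<phi> (single B \<alpha>) \<oplus>\<^bsub>Q\<^esub> \<ominus>\<^bsub>Q\<^esub> \<phi> (cut (c \<alpha>))"
    unfolding border_poly_def
    by (simp add: alg_homD(3)[OF assms(2)] Q.smult_l_minus)
  finally have "\<phi> (single B \<alpha>) = \<phi> (cut (c \<alpha>))"
    using Q.M.minus_eq_zero_iff[of "\<phi> (single B \<alpha>)" "\<phi> (cut (c \<alpha>))"] by (simp add: a_minus_def)
  also have "\<dots> = (\<Oplus>\<^bsub>Q\<^esub>\<beta>\<in>\<Delta>. c \<alpha> \<beta> \<odot>\<^bsub>Q\<^esub> \<phi> (single B \<beta>))"
    by (rule alg_hom_cut[OF assms(1,2)]) simp
  also have "\<dots> = (\<Oplus>\<^bsub>Q\<^esub>\<beta>\<in>\<Delta>. a \<alpha> \<beta> \<odot>\<^bsub>Q\<^esub> \<phi> (single B \<beta>))"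
    by (intro Q.M.finsum_cong'[OF refl]) (auto simp: c_eq_a[OF \<alpha>] a_closed[OF \<alpha>])
  finally show "\<phi> (single B \<alpha>) = (\<Oplus>\<^bsub>Q\<^esub>\<beta>\<in>\<Delta>. a \<alpha> \<beta> \<odot>\<^bsub>Q\<^esub> \<phi> (single B \<beta>))" .
qed

text \<open>An element of the kernel has a normal form that is a relation among the x^\<beta>, and
  by independence its coordinates vanish. A matrix thus determines the kernel of its
  presentations.\<close>

lemma satisfies_iff_kernel:
  assumes pres: "(Q, \<phi>) \<in> hilb_presentations B lt \<Delta>"
  shows "satisfies Q \<phi> \<longleftrightarrow> a_kernel PB Q \<phi> = border_ideal"
proof
  note presD = presentationD[OF pres]
  assume sat: "satisfies Q \<phi>"
  have "p \<in> border_ideal" if p: "p \<in> carrier PB" "\<phi> p = \<zero>\<^bsub>Q\<^esub>" for p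
  proof -
    have "coord p \<beta> = \<zero>\<^bsub>B\<^esub>" if "\<beta> \<in> \<Delta>" for \<beta>
      using p that
      by (intro presentation_independent[OF pres, of "coord p"])
         (simp_all add: normal_form[OF presD(1,2) sat p(1), symmetric])
    then show ?thesis using p by (simp add: border_ideal_def)
  qed
  moreover have "p \<in> carrier PB" if "p \<in> border_ideal" for p
    using that by (simp add: border_ideal_def)
  ultimately show "a_kernel PB Q \<phi> = border_ideal"
    using satisfies_border_ideal[OF presD(1,2) sat] unfolding set_eq_iff presentation_kernel_iff[OF pres] by blast
next
  note presD = presentationD[OF pres]
  assume "a_kernel PB Q \<phi> = border_ideal"
  then have "\<phi> p = \<zero>\<^bsub>Q\<^esub>" if "p \<in> border_ideal" for p
    using presentation_kernel_iff[OF pres, of p] that by simp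
  then show "satisfies Q \<phi>"
    by (rule border_poly_satisfies[OF presD(1,2)])
qed

text \<open>If the leading exponent \<mu> were in \<Delta>, the coordinate of p at \<mu> would be
  the leading coefficient: smaller monomials contribute nothing by \<open>c_order\<close>, and
  x^\<mu> is its own normal form.\<close>

lemma lead_exp_border_ideal:
  assumes "p \<in> border_ideal" "p \<noteq> (\<lambda>_. \<zero>\<^bsub>B\<^esub>)"
  shows "lead_exp B lt p \<notin> \<Delta>"
proof
  let ?\<mu> = "lead_exp B lt p"
  assume \<mu>: "?\<mu> \<in> \<Delta>"
  have p: "p \<in> carrier PB" using assms by (simp add: border_ideal_def)
  note [simp] = P.carrierD(1)[OF p]
  note lead = lead_exp[OF P.carrierD(3)[OF p] assms(2)]
  have "coord p ?\<mu> = (\<Oplus>\<^bsub>B\<^esub>u\<in>{u. p u \<noteq> \<zero>\<^bsub>B\<^esub>}. p u \<otimes>\<^bsub>B\<^esub> c u ?\<mu>)"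
    by (simp add: coord_def lin_ext_def)
  also have "\<dots> = (\<Oplus>\<^bsub>B\<^esub>u\<in>{u. p u \<noteq> \<zero>\<^bsub>B\<^esub>}. if u = ?\<mu> then p ?\<mu> else \<zero>\<^bsub>B\<^esub>)"
  proof (rule B.finsum_cong'[OF refl])
    fix u assume "u \<in> {u. p u \<noteq> \<zero>\<^bsub>B\<^esub>}"
    then show "p u \<otimes>\<^bsub>B\<^esub> c u ?\<mu> = (if u = ?\<mu> then p ?\<mu> else \<zero>\<^bsub>B\<^esub>)"
      using lead(2)[of u] c_order[OF \<mu>, of u] c_unit[OF \<mu> \<mu>] by auto
  qed auto
  also have "\<dots> = p ?\<mu>" using lead(1) P.carrierD(3)[OF p] by (intro B.finsum_single) auto
  finally show False using assms(1) \<mu> lead(1) by (simp add: border_ideal_def)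
qed

text \<open>By \<open>c_order\<close> the normal form of x^\<alpha> involves only smaller exponents,
  so x^\<alpha> leads. The scalar \<open>b\<close> is there to realize every nonzero element of B as
  a leading coefficient.\<close>

lemma lead_border_poly:
  assumes "\<alpha> \<notin> \<Delta>" "b \<in> carrier B" "b \<noteq> \<zero>\<^bsub>B\<^esub>"
  shows "b \<odot>\<^bsub>PB\<^esub> border_poly \<alpha> \<in> border_ideal - {\<zero>\<^bsub>PB\<^esub>}" "lead_exp B lt (b \<odot>\<^bsub>PB\<^esub> border_poly \<alpha>) = \<alpha>"
    "(b \<odot>\<^bsub>PB\<^esub> border_poly \<alpha>) \<alpha> = b"
proof -
  let ?f = "b \<odot>\<^bsub>PB\<^esub> border_poly \<alpha>"
  have f: "?f u = b \<otimes>\<^bsub>B\<^esub> ((if u = \<alpha> then \<one>\<^bsub>B\<^esub> else \<zero>\<^bsub>B\<^esub>) \<oplus>\<^bsub>B\<^esub> \<ominus>\<^bsub>B\<^esub> \<one>\<^bsub>B\<^esub> \<otimes>\<^bsub>B\<^esub> (if u \<in> \<Delta> then c \<alpha> u else \<zero>\<^bsub>B\<^esub>))" for u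
    by (simp add: border_poly_def poly_algebra_def single_def cut_def)
  show *: "?f \<alpha> = b" using assms by (simp add: f)
  have "coord ?f \<beta> = \<zero>\<^bsub>B\<^esub>" if "\<beta> \<in> \<Delta>" for \<beta>
    using border_poly_mem[of \<alpha>] that assms by (auto simp: coord_smult border_ideal_def)
  then show "?f \<in> border_ideal - {\<zero>\<^bsub>PB\<^esub>}"
    using border_poly_mem[of \<alpha>] assms * by (auto simp: border_ideal_def zero_PB)
  show "lead_exp B lt ?f = \<alpha>"
  proof (rule lead_expI)
    show "?f \<alpha> \<noteq> \<zero>\<^bsub>B\<^esub>" using * assms by simp
    fix u assume u: "?f u \<noteq> \<zero>\<^bsub>B\<^esub>" "u \<noteq> \<alpha>"
    then have "u \<in> \<Delta>" "c \<alpha> u \<noteq> \<zero>\<^bsub>B\<^esub>" using assms by (auto simp: f split: if_splits)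
    then show "lt u \<alpha>" using c_order[of u \<alpha>] lt_total[of u \<alpha>] u(2) by blast
  qed
qed

text \<open>For B \<noteq> 0 the leading exponents of the ideal are exactly those outside \<Delta>,
  and there all coefficients occur. So the canonical presentation is a point, and the class of a
  matrix is nonempty.\<close>

lemma border_ideal_presentation:
  "(quot_algebra PB border_ideal, restrict (\<lambda>p. border_ideal +>\<^bsub>PB\<^esub> p) (carrier PB)) \<in> hilb_presentations B lt \<Delta>"
proof -
  have border_ideal_coeff: "p \<alpha> \<in> carrier B" if "p \<in> border_ideal" for p \<alpha>
    using that P.carrierD(1)[of p] by (simp add: border_ideal_def)
  interpret border_ideal: algebra_ideal B PB border_ideal
    by (intro algebra_ideal.intro PA.algebra_axioms ideal_border_ideal)
  have "attached_standard_set B lt border_ideal = \<Delta>" "monic_ideal B lt border_ideal" if nz: "carrier B \<noteq> {\<zero>\<^bsub>B\<^esub>}"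
  proof -
    have one: "\<one>\<^bsub>B\<^esub> \<noteq> \<zero>\<^bsub>B\<^esub>" using nz B.carrier_one_zero by blast
    have "\<alpha> \<in> lead_exp B lt ` (border_ideal - {\<zero>\<^bsub>PB\<^esub>})" if "\<alpha> \<notin> \<Delta>" for \<alpha>
      using lead_border_poly(1,2)[OF that B.one_closed one] by (metis imageI)
    then show "attached_standard_set B lt border_ideal = \<Delta>"
      using lead_exp_border_ideal by (auto simp: attached_standard_set_def zero_PB)
    have "lead_coeff_ideal B lt border_ideal \<alpha> = {\<zero>\<^bsub>B\<^esub>}" if "\<alpha> \<in> \<Delta>" for \<alpha>
      using lead_exp_border_ideal that by (auto simp: lead_coeff_ideal_def zero_PB)
    moreover have "lead_coeff_ideal B lt border_ideal \<alpha> = carrier B" if \<alpha>: "\<alpha> \<notin> \<Delta>" for \<alpha>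
    proof
      show "lead_coeff_ideal B lt border_ideal \<alpha> \<subseteq> carrier B"
        unfolding lead_coeff_ideal_def by (rule Un_least) (blast intro: B.zero_closed border_ideal_coeff)+
      show "carrier B \<subseteq> lead_coeff_ideal B lt border_ideal \<alpha>"
      proof
        fix b assume b: "b \<in> carrier B"
        show "b \<in> lead_coeff_ideal B lt border_ideal \<alpha>"
        proof (cases "b = \<zero>\<^bsub>B\<^esub>")
          case False
          from lead_border_poly[OF \<alpha> b this] show ?thesis
            unfolding lead_coeff_ideal_def by (intro UnI2 CollectI exI[of _ "b \<odot>\<^bsub>PB\<^esub> border_poly \<alpha>"]) simp
        qed (simp add: lead_coeff_ideal_def)
      qed
    qed
    ultimately show "monic_ideal B lt border_ideal" unfolding monic_ideal_def by blast
  qed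
  then show ?thesis
    using border_ideal.algebra_quot border_ideal.coset_alg_hom border_ideal.kernel_coset border_ideal.quot_carrier
    by (auto simp: hilb_presentations_def simp del: border_ideal.quot_simps)
qed

lemma kernel_coset_border_ideal:
  "a_kernel PB (quot_algebra PB border_ideal) (restrict (\<lambda>p. border_ideal +>\<^bsub>PB\<^esub> p) (carrier PB)) = border_ideal"
proof -
  interpret border_ideal: algebra_ideal B PB border_ideal
    by (intro algebra_ideal.intro PA.algebra_axioms ideal_border_ideal)
  show ?thesis by (rule border_ideal.kernel_coset)
qed

lemma kernel_class_border_ideal: "kernel_class border_ideal = {(Q, \<phi>) \<in> hilb_presentations B lt \<Delta>. satisfies Q \<phi>}"
  using satisfies_iff_kernel by (auto simp: kernel_class_def)

lemma kernel_class_border_ideal_hilb: "kernel_class border_ideal \<in> hilb B lt \<Delta>"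
  unfolding hilb_eq
  by (rule CollectI, intro exI conjI, rule arg_cong[OF kernel_coset_border_ideal[symmetric]], rule border_ideal_presentation)

end

text \<open>The matrix comes from \<open>presentation_span\<close>, chosen for all exponents at
  once. The equations compare two expansions of the same monomial; \<open>step\<close> is the
  expansion of x^(\<alpha> + e) obtained by multiplying that of x^\<alpha> by x^e.\<close>

lemma (in poly_data) presentation_border_matrix:
  assumes pres: "(Q, \<phi>) \<in> hilb_presentations B lt \<Delta>"
  obtains a where "border_matrix lt \<Delta> N B a" "border_matrix.satisfies \<Delta> N B a Q \<phi>"
proof -
  note presD = presentationD[OF pres]
  interpret Q: algebra B Q by (rule presD)
  interpret \<phi>: ring_hom_cring PB Q \<phi>
    by (rule alg_hom_ring_hom_cring[OF PA.algebra_axioms presD(1,2)])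
  have mult: "\<phi> (single B \<alpha>) \<otimes>\<^bsub>Q\<^esub> \<phi> (single B \<beta>) = \<phi> (single B (\<alpha> + \<beta>))" for \<alpha> \<beta>
    using P.single_mult[of \<alpha> \<beta>] by (simp add: \<phi>.hom_mult[symmetric])
  have "\<forall>\<alpha>. \<exists>b. (\<forall>\<beta>\<in>\<Delta>. b \<beta> \<in> carrier B \<and> (lt \<alpha> \<beta> \<longrightarrow> b \<beta> = \<zero>\<^bsub>B\<^esub>)) \<and>
      \<phi> (single B \<alpha>) = (\<Oplus>\<^bsub>Q\<^esub>\<beta>\<in>\<Delta>. b \<beta> \<odot>\<^bsub>Q\<^esub> \<phi> (single B \<beta>))"
    using presentation_span[OF pres] by blast
  from choice[OF this] obtain a where a: "\<And>\<alpha> \<beta>. \<beta> \<in> \<Delta> \<Longrightarrow> a \<alpha> \<beta> \<in> carrier B"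
    "\<And>\<alpha> \<beta>. \<beta> \<in> \<Delta> \<Longrightarrow> lt \<alpha> \<beta> \<Longrightarrow> a \<alpha> \<beta> = \<zero>\<^bsub>B\<^esub>"
    "\<And>\<alpha>. \<phi> (single B \<alpha>) = (\<Oplus>\<^bsub>Q\<^esub>\<beta>\<in>\<Delta>. a \<alpha> \<beta> \<odot>\<^bsub>Q\<^esub> \<phi> (single B \<beta>))"
    by blast
  have step: "\<phi> (single B (\<alpha> + e)) = (\<Oplus>\<^bsub>Q\<^esub>\<beta>\<in>\<Delta>. (\<Oplus>\<^bsub>B\<^esub>\<gamma>\<in>\<Delta>. a \<alpha> \<gamma> \<otimes>\<^bsub>B\<^esub> a (\<gamma> + e) \<beta>) \<odot>\<^bsub>Q\<^esub> \<phi> (single B \<beta>))" for \<alpha> e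
  proof -
    have "\<phi> (single B (\<alpha> + e)) = (\<Oplus>\<^bsub>Q\<^esub>\<gamma>\<in>\<Delta>. a \<alpha> \<gamma> \<odot>\<^bsub>Q\<^esub> \<phi> (single B \<gamma>)) \<otimes>\<^bsub>Q\<^esub> \<phi> (single B e)"
      unfolding mult[symmetric] by (subst a(3)) simp
    also have "\<dots> = (\<Oplus>\<^bsub>Q\<^esub>\<gamma>\<in>\<Delta>. a \<alpha> \<gamma> \<odot>\<^bsub>Q\<^esub> \<phi> (single B \<gamma>) \<otimes>\<^bsub>Q\<^esub> \<phi> (single B e))"
      using a(1) by (intro Q.finsum_ldistr) auto
    also have "\<dots> = (\<Oplus>\<^bsub>Q\<^esub>\<gamma>\<in>\<Delta>. \<Oplus>\<^bsub>Q\<^esub>\<beta>\<in>\<Delta>. (a \<alpha> \<gamma> \<otimes>\<^bsub>B\<^esub> a (\<gamma> + e) \<beta>) \<odot>\<^bsub>Q\<^esub> \<phi> (single B \<beta>))"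
    proof (rule Q.M.finsum_cong'[OF refl])
      fix \<gamma> assume \<gamma>: "\<gamma> \<in> \<Delta>"
      have "a \<alpha> \<gamma> \<odot>\<^bsub>Q\<^esub> \<phi> (single B \<gamma>) \<otimes>\<^bsub>Q\<^esub> \<phi> (single B e) = a \<alpha> \<gamma> \<odot>\<^bsub>Q\<^esub> \<phi> (single B (\<gamma> + e))"
        using \<gamma> a(1) by (subst Q.smult_assoc2) (auto simp: mult)
      also have "\<dots> = (\<Oplus>\<^bsub>Q\<^esub>\<beta>\<in>\<Delta>. a \<alpha> \<gamma> \<odot>\<^bsub>Q\<^esub> (a (\<gamma> + e) \<beta> \<odot>\<^bsub>Q\<^esub> \<phi> (single B \<beta>)))"
        by (subst a(3)[of "\<gamma> + e"]) (rule Q.finsum_smult_ldistr, use \<gamma> a(1) in auto)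
      also have "\<dots> = (\<Oplus>\<^bsub>Q\<^esub>\<beta>\<in>\<Delta>. (a \<alpha> \<gamma> \<otimes>\<^bsub>B\<^esub> a (\<gamma> + e) \<beta>) \<odot>\<^bsub>Q\<^esub> \<phi> (single B \<beta>))"
        using \<gamma> a(1) by (intro Q.M.finsum_cong'[OF refl]) (auto simp: Q.smult_assoc1)
      finally show "a \<alpha> \<gamma> \<odot>\<^bsub>Q\<^esub> \<phi> (single B \<gamma>) \<otimes>\<^bsub>Q\<^esub> \<phi> (single B e)
        = (\<Oplus>\<^bsub>Q\<^esub>\<beta>\<in>\<Delta>. (a \<alpha> \<gamma> \<otimes>\<^bsub>B\<^esub> a (\<gamma> + e) \<beta>) \<odot>\<^bsub>Q\<^esub> \<phi> (single B \<beta>))" .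
    qed (use a(1) in \<open>auto intro!: Q.M.finsum_closed\<close>)
    also have "\<dots> = (\<Oplus>\<^bsub>Q\<^esub>\<beta>\<in>\<Delta>. \<Oplus>\<^bsub>Q\<^esub>\<gamma>\<in>\<Delta>. (a \<alpha> \<gamma> \<otimes>\<^bsub>B\<^esub> a (\<gamma> + e) \<beta>) \<odot>\<^bsub>Q\<^esub> \<phi> (single B \<beta>))"
      using a(1) by (intro Q.M.finsum_swap) auto
    also have "\<dots> = (\<Oplus>\<^bsub>Q\<^esub>\<beta>\<in>\<Delta>. (\<Oplus>\<^bsub>B\<^esub>\<gamma>\<in>\<Delta>. a \<alpha> \<gamma> \<otimes>\<^bsub>B\<^esub> a (\<gamma> + e) \<beta>) \<odot>\<^bsub>Q\<^esub> \<phi> (single B \<beta>))"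
      using a(1)
      by (intro Q.M.finsum_cong'[OF refl] Q.finsum_smult_rdistr[symmetric])
         (auto intro!: Q.smult_closed B.finsum_closed)
    finally show ?thesis .
  qed
  have closed: "(\<Oplus>\<^bsub>B\<^esub>\<gamma>\<in>\<Delta>. a \<alpha> \<gamma> \<otimes>\<^bsub>B\<^esub> a (\<gamma> + e) \<beta>) \<in> carrier B" if "\<beta> \<in> \<Delta>" for \<alpha> e \<beta>
    using that a(1) by (intro B.finsum_closed) auto
  have matrix: "border_matrix lt \<Delta> N B a"
  proof unfold_locales
    fix \<alpha> \<beta> assume \<alpha>\<beta>: "\<alpha> \<in> \<Delta>" "\<beta> \<in> \<Delta>"
    have "(\<Oplus>\<^bsub>Q\<^esub>\<gamma>\<in>\<Delta>. (if \<alpha> = \<gamma> then \<one>\<^bsub>B\<^esub> else \<zero>\<^bsub>B\<^esub>) \<odot>\<^bsub>Q\<^esub> \<phi> (single B \<gamma>))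
        = (\<Oplus>\<^bsub>Q\<^esub>\<gamma>\<in>\<Delta>. if \<gamma> = \<alpha> then \<phi> (single B \<alpha>) else \<zero>\<^bsub>Q\<^esub>)"
      by (intro Q.M.finsum_cong') auto
    also have "\<dots> = \<phi> (single B \<alpha>)"
      using \<alpha>\<beta>(1) by (intro Q.M.finsum_single) auto
    also have "\<dots> = (\<Oplus>\<^bsub>Q\<^esub>\<gamma>\<in>\<Delta>. a \<alpha> \<gamma> \<odot>\<^bsub>Q\<^esub> \<phi> (single B \<gamma>))"
      by (rule a(3))
    finally show "a \<alpha> \<beta> = (if \<alpha> = \<beta> then \<one>\<^bsub>B\<^esub> else \<zero>\<^bsub>B\<^esub>)"
      by (intro presentation_coeffs_unique[OF pres, of "a \<alpha>"]) (use a(1) \<alpha>\<beta> in auto)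
  next
    fix \<alpha> i \<beta> assume "\<beta> \<in> \<Delta>"
    then show "a (\<alpha> + axis i 1) \<beta> = (\<Oplus>\<^bsub>B\<^esub>\<gamma>\<in>\<Delta>. a \<alpha> \<gamma> \<otimes>\<^bsub>B\<^esub> a (\<gamma> + axis i 1) \<beta>)"
      by (intro presentation_coeffs_unique[OF pres a(1) closed trans[OF a(3)[symmetric] step]])
  next
    \<comment> \<open>Both sums are coefficients of the one monomial with exponent \<alpha> + e_i =
      \<alpha>' + e_j.\<close>
    fix \<alpha> \<alpha>' :: "nat ^ 'n" and i j \<beta> assume "\<alpha> + axis i 1 = \<alpha>' + axis j 1" "\<beta> \<in> \<Delta>"
    then show "(\<Oplus>\<^bsub>B\<^esub>\<gamma>\<in>\<Delta>. a \<alpha> \<gamma> \<otimes>\<^bsub>B\<^esub> a (\<gamma> + axis i 1) \<beta>) = (\<Oplus>\<^bsub>B\<^esub>\<gamma>\<in>\<Delta>. a \<alpha>' \<gamma> \<otimes>\<^bsub>B\<^esub> a (\<gamma> + axis j 1) \<beta>)"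
      using step[of \<alpha> "axis i 1"] step[of \<alpha>' "axis j 1"]
      by (intro presentation_coeffs_unique[OF pres closed closed]) (simp_all only:)
  qed (use a in auto)
  moreover have "border_matrix.satisfies \<Delta> N B a Q \<phi>"
    using a(3) unfolding border_matrix.satisfies_def[OF matrix] by blast
  ultimately show ?thesis by (rule that)
qed

section \<open>The coordinate ring\<close>

lemma (in ring) ideal_sum_subset_iff:
  assumes "ideal I R" "ideal J R" "ideal L R"
  shows "I <+> J \<subseteq> L \<longleftrightarrow> I \<subseteq> L \<and> J \<subseteq> L"
proof -
  have "I \<union> J \<subseteq> carrier R"
    using ideal.Icarr[OF assms(1)] ideal.Icarr[OF assms(2)] by blast
  then have "Idl (I \<union> J) \<subseteq> L \<longleftrightarrow> I \<union> J \<subseteq> L"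
    by (rule Idl_subset_ideal[OF assms(3)])
  then show ?thesis using union_genideal[OF assms(1,2)] by simp
qed

locale coordinate_ring = hilb_data lt \<Delta> N + K: cring K
  for lt :: "nat ^ 'n::finite \<Rightarrow> nat ^ 'n \<Rightarrow> bool" and \<Delta> N and K :: "('k, 'r) ring_scheme" (structure)
begin

abbreviation "RK \<equiv> R_ring K N \<Delta>"

abbreviation "V \<equiv> T_index N \<Delta>"

abbreviation "I \<equiv> I_prec_Delta K lt N \<Delta>"

abbreviation "RI \<equiv> R_prec_Delta K lt N \<Delta>"

sublocale R: monoid_ring K "exponent_monoid {m. set_mset m \<subseteq> V}"
  rewrites "monoid_algebra K (exponent_monoid {m. set_mset m \<subseteq> V}) = RK"
    and "carrier (exponent_monoid {m. set_mset m \<subseteq> V}) = {m. set_mset m \<subseteq> V}"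
    and "mult (exponent_monoid {m. set_mset m \<subseteq> V}) = (+)"
    and "one (exponent_monoid {m. set_mset m \<subseteq> V}) = {#}"
proof -
  show "monoid_ring K (exponent_monoid {m. set_mset m \<subseteq> V})"
    by (intro monoid_ring.intro K.is_cring comm_monoid_exponent_monoid) auto
qed (auto simp: R_ring_def var_poly_algebra_def)

sublocale RA: algebra K RK
  by (rule R.algebra_P)

lemma T_var_closed [simp]: "\<alpha> \<in> N \<union> border N \<Longrightarrow> \<beta> \<in> \<Delta> \<Longrightarrow> T_var K \<alpha> \<beta> \<in> carrier RK"
  unfolding T_var_def by (rule R.single_closed) (auto simp: T_index_def)

lemma T_product_sum_closed [simp]:
  "\<alpha> \<in> N \<union> border N \<Longrightarrow> \<beta> \<in> \<Delta> \<Longrightarrow> T_product_sum K N \<Delta> \<alpha> (axis i 1) \<beta> \<in> carrier RK"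
  unfolding T_product_sum_def
  by (intro RA.M.finsum_closed) (auto intro!: RA.m_closed T_var_closed simp: \<Delta>_add_axis simp del: Un_iff)

lemma coordinate_hom_eqI:
  assumes C: "algebra K C" and h: "h \<in> alg_hom K RK C" "h' \<in> alg_hom K RK C"
    and eq: "\<And>\<alpha> \<beta>. \<alpha> \<in> N \<union> border N \<Longrightarrow> \<beta> \<in> \<Delta> \<Longrightarrow> h (T_var K \<alpha> \<beta>) = h' (T_var K \<alpha> \<beta>)"
  shows "h = h'"
proof (rule R.alg_hom_eqI[OF C h])
  interpret h: ring_hom_cring RK C h by (rule alg_hom_ring_hom_cring[OF RA.algebra_axioms C h(1)])
  interpret h': ring_hom_cring RK C h' by (rule alg_hom_ring_hom_cring[OF RA.algebra_axioms C h(2)])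
  have one: "\<one>\<^bsub>RK\<^esub> = single K {#}"
    unfolding R_ring_def var_poly_algebra_def by (simp add: one_monoid_algebra flip: zero_multiset_def)
  fix m assume "m \<in> {m. set_mset m \<subseteq> V}"
  then show "h (single K m) = h' (single K m)"
  proof (induction m)
    case empty
    then show ?case using h.hom_one h'.hom_one unfolding one by simp
  next
    case (add x m)
    obtain \<alpha> \<beta> where x: "x = (\<alpha>, \<beta>)" by fastforce
    then have \<alpha>\<beta>: "\<alpha> \<in> N \<union> border N" "\<beta> \<in> \<Delta>" and m: "m \<in> {m. set_mset m \<subseteq> V}"
      using add.prems by (auto simp: T_index_def)
    have "single K (add_mset x m) = T_var K \<alpha> \<beta> \<otimes>\<^bsub>RK\<^esub> single K m"
      unfolding T_var_def using R.single_mult[of "{#(\<alpha>, \<beta>)#}" m] \<alpha>\<beta> m x by (simp add: T_index_def)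
    then show ?case
      using \<alpha>\<beta> m add.IH[OF m] eq[OF \<alpha>\<beta>] R.single_closed[OF m] by simp
  qed
qed

text \<open>The universal property of polynomials: a monomial goes to the product of powers of the
  prescribed values.\<close>

lemma coordinate_hom_exists:
  assumes C: "algebra K C" and a: "\<And>\<alpha> \<beta>. \<alpha> \<in> N \<union> border N \<Longrightarrow> \<beta> \<in> \<Delta> \<Longrightarrow> a \<alpha> \<beta> \<in> carrier C"
  obtains h where "h \<in> alg_hom K RK C"
    "\<And>\<alpha> \<beta>. \<alpha> \<in> N \<union> border N \<Longrightarrow> \<beta> \<in> \<Delta> \<Longrightarrow> h (T_var K \<alpha> \<beta>) = a \<alpha> \<beta>"
proof -
  interpret C: algebra K C by fact
  define b where "b t = (case t of (\<alpha>, \<beta>) \<Rightarrow> a \<alpha> \<beta>)" for t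
  have b: "b t \<in> carrier C" if "t \<in> V" for t
    using that a by (auto simp: b_def T_index_def)
  define \<mu> where "\<mu> m = (\<Otimes>\<^bsub>C\<^esub>t\<in>set_mset m. b t [^]\<^bsub>C\<^esub> count m t)" for m
  \<comment> \<open>Padding with zeroth powers lets two monomials share the index set
    \<open>?S\<close>, as multiplicativity of \<open>\<mu>\<close> requires.\<close>
  have \<mu>_eq: "\<mu> m = (\<Otimes>\<^bsub>C\<^esub>t\<in>S. b t [^]\<^bsub>C\<^esub> count m t)" if "finite S" "set_mset m \<subseteq> S" "S \<subseteq> V" for m S
    unfolding \<mu>_def using that b
    by (intro C.finprod_mono_neutral_cong_left) (auto simp: not_in_iff subset_eq intro!: C.nat_pow_closed)
  have \<mu>_closed: "\<mu> \<in> {m. set_mset m \<subseteq> V} \<rightarrow> carrier C"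
    by (auto simp: \<mu>_def intro!: C.finprod_closed C.nat_pow_closed b dest: subsetD)
  have "restrict (lin_ext K C \<mu>) (carrier RK) \<in> alg_hom K RK C"
  proof (rule R.lin_ext_alg_hom[OF C])
    show "\<mu> \<in> {m. set_mset m \<subseteq> V} \<rightarrow> carrier C" by (rule \<mu>_closed)
    show "\<mu> {#} = \<one>\<^bsub>C\<^esub>" by (simp add: \<mu>_def)
    fix m m' assume m: "m \<in> {m. set_mset m \<subseteq> V}" "m' \<in> {m. set_mset m \<subseteq> V}"
    let ?S = "set_mset m \<union> set_mset m'"
    have "\<mu> (m + m') = (\<Otimes>\<^bsub>C\<^esub>t\<in>?S. b t [^]\<^bsub>C\<^esub> count m t \<otimes>\<^bsub>C\<^esub> b t [^]\<^bsub>C\<^esub> count m' t)"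
      unfolding \<mu>_def using m b
      by (intro C.finprod_cong') (auto simp: C.nat_pow_mult subset_eq intro!: C.nat_pow_closed C.m_closed)
    also have "\<dots> = (\<Otimes>\<^bsub>C\<^esub>t\<in>?S. b t [^]\<^bsub>C\<^esub> count m t) \<otimes>\<^bsub>C\<^esub> (\<Otimes>\<^bsub>C\<^esub>t\<in>?S. b t [^]\<^bsub>C\<^esub> count m' t)"
      using m b by (intro C.finprod_multf) (auto simp: subset_eq intro!: C.nat_pow_closed)
    also have "\<dots> = \<mu> m \<otimes>\<^bsub>C\<^esub> \<mu> m'"
      using m \<mu>_eq[of ?S m] \<mu>_eq[of ?S m'] by simp
    finally show "\<mu> (m + m') = \<mu> m \<otimes>\<^bsub>C\<^esub> \<mu> m'" .
  qed
  moreover have "restrict (lin_ext K C \<mu>) (carrier RK) (T_var K \<alpha> \<beta>) = a \<alpha> \<beta>"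
    if \<alpha>\<beta>: "\<alpha> \<in> N \<union> border N" "\<beta> \<in> \<Delta>" for \<alpha> \<beta>
  proof -
    have "lin_ext K C \<mu> (single K {#(\<alpha>, \<beta>)#}) = \<mu> {#(\<alpha>, \<beta>)#}"
      using \<alpha>\<beta> by (intro R.lin_ext_single C.module \<mu>_closed) (simp add: T_index_def)
    also have "\<dots> = a \<alpha> \<beta>" using a[OF \<alpha>\<beta>] by (simp add: \<mu>_def b_def)
    finally show ?thesis using T_var_closed[OF \<alpha>\<beta>] by (simp add: T_var_def)
  qed
  ultimately show ?thesis by (rule that)
qed

text \<open>A sum of ideals lies in \<open>J\<close> iff the summands do, and a generated ideal iff
  its generators do. Containment of \<open>I\<close> in a kernel thereby becomes a list of
  equations.\<close>

lemma I_subset_iff: "ideal J RK \<Longrightarrow> I \<subseteq> J \<longleftrightarrow>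
    {T_var K \<alpha> \<beta> \<ominus>\<^bsub>RK\<^esub> (if \<alpha> = \<beta> then \<one>\<^bsub>RK\<^esub> else \<zero>\<^bsub>RK\<^esub>) | \<alpha> \<beta>. \<alpha> \<in> \<Delta> \<and> \<beta> \<in> \<Delta>} \<subseteq> J \<and>
    {T_var K (\<alpha> + e) \<beta> \<ominus>\<^bsub>RK\<^esub> T_product_sum K N \<Delta> \<alpha> e \<beta> | \<alpha> e \<beta>.
      \<alpha> \<in> N \<union> border N \<and> e \<in> range (\<lambda>i. axis i 1) \<and> \<alpha> + e \<in> N \<union> border N \<and> \<beta> \<in> \<Delta>} \<subseteq> J \<and>
    {T_product_sum K N \<Delta> \<alpha> e \<beta> \<ominus>\<^bsub>RK\<^esub> T_product_sum K N \<Delta> \<alpha>' e' \<beta> | \<alpha> e \<alpha>' e' \<beta>.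
      \<alpha> \<in> border N \<and> \<alpha>' \<in> border N \<and> e \<in> range (\<lambda>i. axis i 1) \<and> e' \<in> range (\<lambda>i. axis i 1) \<and>
      \<alpha> + e = \<alpha>' + e' \<and> \<alpha> + e \<in> border2 N \<and> \<beta> \<in> \<Delta>} \<subseteq> J \<and>
    {T_var K \<alpha> \<beta> | \<alpha> \<beta>. \<alpha> \<in> N \<union> border N \<and> \<beta> \<in> \<Delta> \<and> lt \<alpha> \<beta>} \<subseteq> J" (is "_ \<Longrightarrow> _ \<longleftrightarrow> ?G1 \<subseteq> J \<and> ?G2 \<subseteq> J \<and> ?G3 \<subseteq> J \<and> ?G4 \<subseteq> J")
  and ideal_I: "ideal I RK"
proof -
  have G1: "?G1 \<subseteq> carrier RK"
    by (auto intro!: RA.M.minus_closed T_var_closed[OF \<Delta>_in_N])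
  have G2: "?G2 \<subseteq> carrier RK"
    by (auto simp del: Un_iff intro!: RA.M.minus_closed T_var_closed T_product_sum_closed)
  have G3: "?G3 \<subseteq> carrier RK"
    by (auto simp del: Un_iff intro!: RA.M.minus_closed T_product_sum_closed[OF UnI2])
  have G4: "?G4 \<subseteq> carrier RK"
    by (auto simp del: Un_iff intro!: T_var_closed)
  note G = G1 G2 G3 G4
  have ids: "ideal (I1 K N \<Delta>) RK" "ideal (I2 K N \<Delta>) RK" "ideal (I3 K N \<Delta>) RK" "ideal (Idl\<^bsub>RK\<^esub> ?G4) RK"
    unfolding I1_def I2_def I3_def Let_def by (intro RA.genideal_ideal G)+
  have sums: "ideal (I1 K N \<Delta> <+>\<^bsub>RK\<^esub> I2 K N \<Delta>) RK" "ideal (I_Delta K N \<Delta>) RK"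
    unfolding I_Delta_def by (intro RA.add_ideals ids)+
  show "ideal I RK"
    unfolding I_prec_Delta_def by (intro RA.add_ideals sums ids)
  assume J: "ideal J RK"
  have "I1 K N \<Delta> \<subseteq> J \<longleftrightarrow> ?G1 \<subseteq> J" "I2 K N \<Delta> \<subseteq> J \<longleftrightarrow> ?G2 \<subseteq> J" "I3 K N \<Delta> \<subseteq> J \<longleftrightarrow> ?G3 \<subseteq> J"
    "Idl\<^bsub>RK\<^esub> ?G4 \<subseteq> J \<longleftrightarrow> ?G4 \<subseteq> J"
    unfolding I1_def I2_def I3_def Let_def by (intro RA.Idl_subset_ideal J G)+
  moreover have "I \<subseteq> J \<longleftrightarrow> (I1 K N \<Delta> \<subseteq> J \<and> I2 K N \<Delta> \<subseteq> J \<and> I3 K N \<Delta> \<subseteq> J) \<and> Idl\<^bsub>RK\<^esub> ?G4 \<subseteq> J"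
    unfolding I_prec_Delta_def RA.ideal_sum_subset_iff[OF sums(2) ids(4) J]
    unfolding I_Delta_def RA.ideal_sum_subset_iff[OF sums(1) ids(3) J] RA.ideal_sum_subset_iff[OF ids(1,2) J]
    by (simp only: conj_assoc)
  ultimately show "I \<subseteq> J \<longleftrightarrow> ?G1 \<subseteq> J \<and> ?G2 \<subseteq> J \<and> ?G3 \<subseteq> J \<and> ?G4 \<subseteq> J"
    by (simp only: conj_assoc)
qed

sublocale RI: algebra_ideal K RK I
  rewrites "quot_algebra RK I = RI"
  by (intro algebra_ideal.intro RA.algebra_axioms ideal_I) (simp add: R_prec_Delta_def)

text \<open>Every generator of \<open>I\<close> is a variable or a difference, so it vanishes under
  \<open>H\<close> iff one equation between entries holds. The four families give
  \<open>a_unit\<close>, \<open>a_step\<close>, \<open>a_border\<close> and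
  \<open>a_order\<close>.\<close>

lemma kernel_contains_I_iff:
  assumes C: "algebra K C" and H: "H \<in> alg_hom K RK C"
  shows "I \<subseteq> a_kernel RK C H \<longleftrightarrow> border_matrix lt \<Delta> N C (\<lambda>\<alpha> \<beta>. H (T_var K \<alpha> \<beta>))"
proof -
  interpret C: algebra K C by fact
  interpret H: ring_hom_cring RK C H by (rule alg_hom_ring_hom_cring[OF RA.algebra_axioms C H])
  note ker = a_kernel_iff[OF RA.algebra_axioms C H]
  let ?a = "\<lambda>\<alpha> \<beta>. H (T_var K \<alpha> \<beta>)"
  let ?s = "\<lambda>\<alpha> i \<beta>. \<Oplus>\<^bsub>C\<^esub>\<gamma>\<in>\<Delta>. ?a \<alpha> \<gamma> \<otimes>\<^bsub>C\<^esub> ?a (\<gamma> + axis i 1) \<beta>"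
  have diff: "x \<ominus>\<^bsub>RK\<^esub> y \<in> a_kernel RK C H \<longleftrightarrow> H x = H y" if "x \<in> carrier RK" "y \<in> carrier RK" for x y
    unfolding ker using that C.M.minus_eq_zero_iff[of "H x" "H y"] by (simp add: a_minus_def)
  have T\<Delta>: "T_var K \<alpha> \<beta> \<in> carrier RK" if "\<alpha> \<in> \<Delta>" "\<beta> \<in> \<Delta>" for \<alpha> \<beta>
    using that \<Delta>_in_N by (intro T_var_closed)
  have sum: "H (T_product_sum K N \<Delta> \<alpha> (axis i 1) \<beta>) = ?s \<alpha> i \<beta>" if "\<alpha> \<in> N \<union> border N" "\<beta> \<in> \<Delta>" for \<alpha> i \<beta>
  proof -
    have "H (T_product_sum K N \<Delta> \<alpha> (axis i 1) \<beta>)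
        = (\<Oplus>\<^bsub>C\<^esub>\<gamma>\<in>\<Delta>. H (T_var K \<alpha> \<gamma> \<otimes>\<^bsub>RK\<^esub> T_var K (\<gamma> + axis i 1) \<beta>))"
      unfolding T_product_sum_def using that \<Delta>_add_axis
      by (subst H.hom_finsum) (auto intro!: RA.m_closed T_var_closed simp: comp_def simp del: Un_iff)
    also have "\<dots> = ?s \<alpha> i \<beta>"
      using that \<Delta>_add_axis
      by (intro C.M.finsum_cong'[OF refl])
         (auto intro!: C.m_closed H.hom_closed H.hom_mult T_var_closed simp del: Un_iff)
    finally show ?thesis .
  qed
  have "I \<subseteq> a_kernel RK C H \<longleftrightarrow>
      (\<forall>\<alpha>\<in>\<Delta>. \<forall>\<beta>\<in>\<Delta>. ?a \<alpha> \<beta> = (if \<alpha> = \<beta> then \<one>\<^bsub>C\<^esub> else \<zero>\<^bsub>C\<^esub>)) \<and>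
      (\<forall>\<alpha>\<in>N \<union> border N. \<forall>i. \<alpha> + axis i 1 \<in> N \<union> border N \<longrightarrow> (\<forall>\<beta>\<in>\<Delta>. ?a (\<alpha> + axis i 1) \<beta> = ?s \<alpha> i \<beta>)) \<and>
      (\<forall>\<alpha>\<in>border N. \<forall>\<alpha>'\<in>border N. \<forall>i j. \<alpha> + axis i 1 = \<alpha>' + axis j 1 \<longrightarrow> \<alpha> + axis i 1 \<in> border2 N \<longrightarrow>
        (\<forall>\<beta>\<in>\<Delta>. ?s \<alpha> i \<beta> = ?s \<alpha>' j \<beta>)) \<and>
      (\<forall>\<alpha>\<in>N \<union> border N. \<forall>\<beta>\<in>\<Delta>. lt \<alpha> \<beta> \<longrightarrow> ?a \<alpha> \<beta> = \<zero>\<^bsub>C\<^esub>)"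
  proof (subst I_subset_iff[OF a_kernel_ideal[OF RA.algebra_axioms C H]], intro arg_cong2[where f = "(\<and>)"])
    let ?J = "a_kernel RK C H"
    have "T_var K \<alpha> \<beta> \<ominus>\<^bsub>RK\<^esub> (if \<alpha> = \<beta> then \<one>\<^bsub>RK\<^esub> else \<zero>\<^bsub>RK\<^esub>) \<in> ?J
        \<longleftrightarrow> ?a \<alpha> \<beta> = (if \<alpha> = \<beta> then \<one>\<^bsub>C\<^esub> else \<zero>\<^bsub>C\<^esub>)" if "\<alpha> \<in> \<Delta>" "\<beta> \<in> \<Delta>" for \<alpha> \<beta>
      using diff[OF T\<Delta>[OF that], of "if \<alpha> = \<beta> then \<one>\<^bsub>RK\<^esub> else \<zero>\<^bsub>RK\<^esub>"] by auto
    then show "{T_var K \<alpha> \<beta> \<ominus>\<^bsub>RK\<^esub> (if \<alpha> = \<beta> then \<one>\<^bsub>RK\<^esub> else \<zero>\<^bsub>RK\<^esub>) | \<alpha> \<beta>. \<alpha> \<in> \<Delta> \<and> \<beta> \<in> \<Delta>} \<subseteq> ?J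
        \<longleftrightarrow> (\<forall>\<alpha>\<in>\<Delta>. \<forall>\<beta>\<in>\<Delta>. ?a \<alpha> \<beta> = (if \<alpha> = \<beta> then \<one>\<^bsub>C\<^esub> else \<zero>\<^bsub>C\<^esub>))" by blast
    have "T_var K (\<alpha> + axis i 1) \<beta> \<ominus>\<^bsub>RK\<^esub> T_product_sum K N \<Delta> \<alpha> (axis i 1) \<beta> \<in> ?J
        \<longleftrightarrow> ?a (\<alpha> + axis i 1) \<beta> = ?s \<alpha> i \<beta>"
      if "\<alpha> \<in> N \<union> border N" "\<alpha> + axis i 1 \<in> N \<union> border N" "\<beta> \<in> \<Delta>" for \<alpha> i \<beta>
      unfolding diff[OF T_var_closed[OF that(2,3)] T_product_sum_closed[OF that(1,3)]] sum[OF that(1,3)] ..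
    then show "{T_var K (\<alpha> + e) \<beta> \<ominus>\<^bsub>RK\<^esub> T_product_sum K N \<Delta> \<alpha> e \<beta> | \<alpha> e \<beta>.
        \<alpha> \<in> N \<union> border N \<and> e \<in> range (\<lambda>i. axis i 1) \<and> \<alpha> + e \<in> N \<union> border N \<and> \<beta> \<in> \<Delta>} \<subseteq> ?J
      \<longleftrightarrow> (\<forall>\<alpha>\<in>N \<union> border N. \<forall>i. \<alpha> + axis i 1 \<in> N \<union> border N \<longrightarrow> (\<forall>\<beta>\<in>\<Delta>. ?a (\<alpha> + axis i 1) \<beta> = ?s \<alpha> i \<beta>))"
      by blast
    have "T_product_sum K N \<Delta> \<alpha> (axis i 1) \<beta> \<ominus>\<^bsub>RK\<^esub> T_product_sum K N \<Delta> \<alpha>' (axis j 1) \<beta> \<in> ?J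
        \<longleftrightarrow> ?s \<alpha> i \<beta> = ?s \<alpha>' j \<beta>" if "\<alpha> \<in> border N" "\<alpha>' \<in> border N" "\<beta> \<in> \<Delta>" for \<alpha> \<alpha>' i j \<beta>
      unfolding diff[OF T_product_sum_closed[OF UnI2[OF that(1)] that(3)] T_product_sum_closed[OF UnI2[OF that(2)] that(3)]]
        sum[OF UnI2[OF that(1)] that(3)] sum[OF UnI2[OF that(2)] that(3)] ..
    then show "{T_product_sum K N \<Delta> \<alpha> e \<beta> \<ominus>\<^bsub>RK\<^esub> T_product_sum K N \<Delta> \<alpha>' e' \<beta> | \<alpha> e \<alpha>' e' \<beta>.
        \<alpha> \<in> border N \<and> \<alpha>' \<in> border N \<and> e \<in> range (\<lambda>i. axis i 1) \<and> e' \<in> range (\<lambda>i. axis i 1) \<and>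
        \<alpha> + e = \<alpha>' + e' \<and> \<alpha> + e \<in> border2 N \<and> \<beta> \<in> \<Delta>} \<subseteq> ?J
      \<longleftrightarrow> (\<forall>\<alpha>\<in>border N. \<forall>\<alpha>'\<in>border N. \<forall>i j. \<alpha> + axis i 1 = \<alpha>' + axis j 1 \<longrightarrow> \<alpha> + axis i 1 \<in> border2 N \<longrightarrow>
        (\<forall>\<beta>\<in>\<Delta>. ?s \<alpha> i \<beta> = ?s \<alpha>' j \<beta>))"
      by blast
    have "T_var K \<alpha> \<beta> \<in> ?J \<longleftrightarrow> ?a \<alpha> \<beta> = \<zero>\<^bsub>C\<^esub>" if "\<alpha> \<in> N \<union> border N" "\<beta> \<in> \<Delta>" for \<alpha> \<beta>
      unfolding ker using T_var_closed[OF that] by simp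
    then show "{T_var K \<alpha> \<beta> | \<alpha> \<beta>. \<alpha> \<in> N \<union> border N \<and> \<beta> \<in> \<Delta> \<and> lt \<alpha> \<beta>} \<subseteq> ?J
      \<longleftrightarrow> (\<forall>\<alpha>\<in>N \<union> border N. \<forall>\<beta>\<in>\<Delta>. lt \<alpha> \<beta> \<longrightarrow> ?a \<alpha> \<beta> = \<zero>\<^bsub>C\<^esub>)"
      by blast
  qed
  also have "\<dots> \<longleftrightarrow> border_matrix lt \<Delta> N C ?a"
  proof -
    have "poly_data lt \<Delta> N C"
      by (intro poly_data.intro hilb_data_axioms C.M_cring)
    moreover have "?a \<alpha> \<beta> \<in> carrier C" if "\<alpha> \<in> N \<union> border N" "\<beta> \<in> \<Delta>" for \<alpha> \<beta>
      using T_var_closed[OF that] by simp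
    ultimately show ?thesis
      unfolding border_matrix_def border_matrix_axioms_def by blast
  qed
  finally show ?thesis .
qed

section \<open>Homomorphisms out of the quotient ring and points of the functor\<close>

abbreviation "Tc \<equiv> T_class K lt N \<Delta>"

lemma Tc_closed: "\<alpha> \<in> N \<union> border N \<Longrightarrow> \<beta> \<in> \<Delta> \<Longrightarrow> Tc \<alpha> \<beta> \<in> carrier RI"
  unfolding T_class_def by (intro RI.coset_closed T_var_closed)

lemma algebra_RI: "algebra K RI"
  by (rule RI.algebra_quot)

lemma RI_hom_compose:
  assumes "algebra K C" "h \<in> alg_hom K RI C"
  defines "H \<equiv> compose (carrier RK) h (restrict (\<lambda>x. I +>\<^bsub>RK\<^esub> x) (carrier RK))"
  shows "H \<in> alg_hom K RK C" "\<And>x. x \<in> carrier RK \<Longrightarrow> H x = h (I +>\<^bsub>RK\<^esub> x)"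
  unfolding H_def using alg_hom_compose[OF RI.coset_alg_hom assms(2) RA.algebra_axioms]
  by (simp_all add: compose_eq)

text \<open>Pulled back to the polynomial ring, \<open>h\<close> kills \<open>I\<close>, and this is
  the system of equations.\<close>

lemma RI_hom_matrix:
  assumes C: "algebra K C" and h: "h \<in> alg_hom K RI C"
  shows "border_matrix lt \<Delta> N C (\<lambda>\<alpha> \<beta>. h (Tc \<alpha> \<beta>))"
proof -
  let ?H = "compose (carrier RK) h (restrict (\<lambda>x. I +>\<^bsub>RK\<^esub> x) (carrier RK))"
  interpret C: algebra K C by (rule C)
  interpret h: ring_hom_cring RI C h by (rule alg_hom_ring_hom_cring[OF algebra_RI C h])
  note H = RI_hom_compose[OF C h]
  have "I \<subseteq> a_kernel RK C ?H"
  proof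
    fix x assume x: "x \<in> I"
    then have xc: "x \<in> carrier RK" by (rule RI.Icarr)
    have "I +>\<^bsub>RK\<^esub> x = \<zero>\<^bsub>RI\<^esub>" using x RI.coset_zero_iff[OF xc] by simp
    then show "x \<in> a_kernel RK C ?H"
      using H(2)[OF xc] xc h.hom_zero by (simp add: a_kernel_iff[OF RA.algebra_axioms C H(1)] del: RI.quot_simps)
  qed
  then have M: "border_matrix lt \<Delta> N C (\<lambda>\<alpha> \<beta>. ?H (T_var K \<alpha> \<beta>))"
    using kernel_contains_I_iff[OF C H(1)] by blast
  show ?thesis
  proof (rule border_matrix.border_matrix_cong[OF M])
    fix \<alpha> \<beta> assume "\<alpha> \<in> N \<union> border N" "\<beta> \<in> \<Delta>"
    then show "h (Tc \<alpha> \<beta>) = ?H (T_var K \<alpha> \<beta>)"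
      using H(2)[OF T_var_closed[of \<alpha> \<beta>]] by (simp add: T_class_def)
  qed
qed

text \<open>Values for the variables may be chosen freely; the equations say that the resulting map
  kills \<open>I\<close>, so it descends.\<close>

lemma RI_hom_exists:
  assumes C: "algebra K C" and M: "border_matrix lt \<Delta> N C a"
  obtains h where "h \<in> alg_hom K RI C"
    "\<And>\<alpha> \<beta>. \<alpha> \<in> N \<union> border N \<Longrightarrow> \<beta> \<in> \<Delta> \<Longrightarrow> h (Tc \<alpha> \<beta>) = a \<alpha> \<beta>"
proof -
  interpret C: algebra K C by (rule C)
  interpret M: border_matrix lt \<Delta> N C a by (rule M)
  obtain H where H: "H \<in> alg_hom K RK C"
    "\<And>\<alpha> \<beta>. \<alpha> \<in> N \<union> border N \<Longrightarrow> \<beta> \<in> \<Delta> \<Longrightarrow> H (T_var K \<alpha> \<beta>) = a \<alpha> \<beta>"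
    by (rule coordinate_hom_exists[OF C, of a]) (use M.a_closed in auto)
  \<comment> \<open>\<open>H\<close> is compared with \<open>a\<close> only on the index set of the
    variables, so the equations have to be transported.\<close>
  have "border_matrix lt \<Delta> N C (\<lambda>\<alpha> \<beta>. H (T_var K \<alpha> \<beta>))"
    using H(2) by (rule M.border_matrix_cong)
  then have I_ker: "I \<subseteq> a_kernel RK C H"
    using kernel_contains_I_iff[OF C H(1)] by blast
  have img: "restrict (\<lambda>x. I +>\<^bsub>RK\<^esub> x) (carrier RK) ` carrier RK = carrier RI"
    unfolding RI.quot_carrier by (auto intro!: image_cong)
  have ker: "H x = \<zero>\<^bsub>C\<^esub>"
    if x: "x \<in> carrier RK" "restrict (\<lambda>x. I +>\<^bsub>RK\<^esub> x) (carrier RK) x = \<zero>\<^bsub>RI\<^esub>" for x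
  proof -
    have "x \<in> I" using x RI.coset_zero_iff[OF x(1)] by simp
    then show ?thesis using I_ker by (auto simp: a_kernel_iff[OF RA.algebra_axioms C H(1)])
  qed
  obtain h where h: "h \<in> alg_hom K RI C"
    and h_coset: "\<And>x. x \<in> carrier RK \<Longrightarrow> h (restrict (\<lambda>x. I +>\<^bsub>RK\<^esub> x) (carrier RK) x) = H x"
  proof (rule alg_hom_factor[OF RA.algebra_axioms algebra_RI C RI.coset_alg_hom img H(1)])
    fix x assume "x \<in> carrier RK" "restrict (\<lambda>x. I +>\<^bsub>RK\<^esub> x) (carrier RK) x = \<zero>\<^bsub>RI\<^esub>"
    then show "H x = \<zero>\<^bsub>C\<^esub>" by (rule ker)
  qed (rule that)
  have "h (Tc \<alpha> \<beta>) = a \<alpha> \<beta>" if "\<alpha> \<in> N \<union> border N" "\<beta> \<in> \<Delta>" for \<alpha> \<beta>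
    using h_coset[OF T_var_closed[OF that]] T_var_closed[OF that] H(2)[OF that] by (simp add: T_class_def)
  with h show ?thesis by (rule that)
qed

lemma RI_hom_eqI:
  assumes C: "algebra K C" and h: "h \<in> alg_hom K RI C" "h' \<in> alg_hom K RI C"
    and eq: "\<And>\<alpha> \<beta>. \<alpha> \<in> N \<union> border N \<Longrightarrow> \<beta> \<in> \<Delta> \<Longrightarrow> h (Tc \<alpha> \<beta>) = h' (Tc \<alpha> \<beta>)"
  shows "h = h'"
proof (rule extensionalityI)
  show "h \<in> extensional (carrier RI)" "h' \<in> extensional (carrier RI)"
    using alg_homD(2) h by blast+
  fix y assume "y \<in> carrier RI"
  then obtain x where x: "x \<in> carrier RK" "y = I +>\<^bsub>RK\<^esub> x" unfolding RI.quot_carrier by blast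
  note H = RI_hom_compose[OF C h(1)] and H' = RI_hom_compose[OF C h(2)]
  have "compose (carrier RK) h (restrict (\<lambda>x. I +>\<^bsub>RK\<^esub> x) (carrier RK))
      = compose (carrier RK) h' (restrict (\<lambda>x. I +>\<^bsub>RK\<^esub> x) (carrier RK))"
  proof (rule coordinate_hom_eqI[OF C H(1) H'(1)])
    fix \<alpha> \<beta> assume \<alpha>\<beta>: "\<alpha> \<in> N \<union> border N" "\<beta> \<in> \<Delta>"
    show "compose (carrier RK) h (restrict (\<lambda>x. I +>\<^bsub>RK\<^esub> x) (carrier RK)) (T_var K \<alpha> \<beta>)
      = compose (carrier RK) h' (restrict (\<lambda>x. I +>\<^bsub>RK\<^esub> x) (carrier RK)) (T_var K \<alpha> \<beta>)"
      using H(2)[OF T_var_closed[OF \<alpha>\<beta>]] H'(2)[OF T_var_closed[OF \<alpha>\<beta>]] eq[OF \<alpha>\<beta>]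
      by (simp add: T_class_def)
  qed
  then show "h y = h' y" using H(2)[OF x(1)] H'(2)[OF x(1)] x(2) by simp
qed

lemma hilb_pointD:
  assumes "(Q, \<phi>) \<in> hilb_point K lt N \<Delta> B h" "\<alpha> \<in> N \<union> border N"
  shows "\<phi> (single B \<alpha>) = (\<Oplus>\<^bsub>Q\<^esub>\<beta>\<in>\<Delta>. h (Tc \<alpha> \<beta>) \<odot>\<^bsub>Q\<^esub> \<phi> (single B \<beta>))"
  using assms unfolding hilb_point_def by blast

text \<open>Identifies \<open>hilb_point\<close> as one equivalence class: its relations hold
  exactly for the presentations whose kernel is the ideal of the matrix.\<close>

lemma hilb_point_eq_kernel_class:
  assumes B: "algebra K B" and h: "h \<in> alg_hom K RI B"
  shows "hilb_point K lt N \<Delta> B h =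
    poly_data.kernel_class lt \<Delta> B (border_matrix.border_ideal \<Delta> B (\<lambda>\<alpha> \<beta>. h (Tc \<alpha> \<beta>)))"
proof -
  interpret M: border_matrix lt \<Delta> N B "\<lambda>\<alpha> \<beta>. h (Tc \<alpha> \<beta>)" by (rule RI_hom_matrix[OF B h])
  show ?thesis unfolding M.kernel_class_border_ideal hilb_point_def M.satisfies_def ..
qed

text \<open>Injective, because homomorphisms with the same class share a presentation and expansions
  in it are unique; surjective, because a presentation yields a matrix and hence a
  homomorphism.\<close>

lemma bij_betw_hilb_point:
  fixes B :: "('k, 'b, 's) module_scheme"
  assumes B: "algebra K B"
  shows "bij_betw (hilb_point K lt N \<Delta> B) (alg_hom K RI B) (hilb B lt \<Delta>)"
proof -
  interpret poly_data lt \<Delta> N B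
    by (intro poly_data.intro hilb_data_axioms algebra.M_cring[OF B])
  have "h = h'" if h: "h \<in> alg_hom K RI B" "h' \<in> alg_hom K RI B"
    and eq: "hilb_point K lt N \<Delta> B h = hilb_point K lt N \<Delta> B h'" for h h'
  proof (rule RI_hom_eqI[OF B h])
    fix \<alpha> \<beta> assume \<alpha>\<beta>: "\<alpha> \<in> N \<union> border N" "\<beta> \<in> \<Delta>"
    interpret M: border_matrix lt \<Delta> N B "\<lambda>\<alpha> \<beta>. h (Tc \<alpha> \<beta>)" by (rule RI_hom_matrix[OF B h(1)])
    interpret M': border_matrix lt \<Delta> N B "\<lambda>\<alpha> \<beta>. h' (Tc \<alpha> \<beta>)" by (rule RI_hom_matrix[OF B h(2)])
    let ?Q = "quot_algebra PB M.border_ideal" and ?\<phi> = "restrict (\<lambda>p. M.border_ideal +>\<^bsub>PB\<^esub> p) (carrier PB)"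
    have "(?Q, ?\<phi>) \<in> hilb_point K lt N \<Delta> B h"
      unfolding hilb_point_eq_kernel_class[OF B h(1)] kernel_class_def
      using M.border_ideal_presentation M.kernel_coset_border_ideal by blast
    \<comment> \<open>The canonical presentation of \<open>h\<close> lies in the class of
      \<open>h'\<close> as well, so x^\<alpha> has two expansions in it.\<close>
    note this this[unfolded eq]
    from trans[OF hilb_pointD[OF this(1) \<alpha>\<beta>(1), symmetric] hilb_pointD[OF this(2) \<alpha>\<beta>(1)]]
    have "(\<Oplus>\<^bsub>?Q\<^esub>\<beta>\<in>\<Delta>. h (Tc \<alpha> \<beta>) \<odot>\<^bsub>?Q\<^esub> ?\<phi> (single B \<beta>)) = (\<Oplus>\<^bsub>?Q\<^esub>\<beta>\<in>\<Delta>. h' (Tc \<alpha> \<beta>) \<odot>\<^bsub>?Q\<^esub> ?\<phi> (single B \<beta>))" .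
    from presentation_coeffs_unique[OF M.border_ideal_presentation M.a_closed[OF \<alpha>\<beta>(1)] M'.a_closed[OF \<alpha>\<beta>(1)] this \<alpha>\<beta>(2)]
    show "h (Tc \<alpha> \<beta>) = h' (Tc \<alpha> \<beta>)" .
  qed
  moreover have "hilb_point K lt N \<Delta> B h \<in> hilb B lt \<Delta>" if h: "h \<in> alg_hom K RI B" for h
  proof -
    interpret M: border_matrix lt \<Delta> N B "\<lambda>\<alpha> \<beta>. h (Tc \<alpha> \<beta>)" by (rule RI_hom_matrix[OF B h])
    show ?thesis unfolding hilb_point_eq_kernel_class[OF B h] by (rule M.kernel_class_border_ideal_hilb)
  qed
  moreover have "\<exists>h\<in>alg_hom K RI B. hilb_point K lt N \<Delta> B h = X" if X: "X \<in> hilb B lt \<Delta>" for X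
  proof -
    obtain Q \<phi> where pres: "(Q, \<phi>) \<in> hilb_presentations B lt \<Delta>" and X: "X = kernel_class (a_kernel PB Q \<phi>)"
      using X unfolding hilb_eq by blast
    obtain a where M: "border_matrix lt \<Delta> N B a" and sat: "border_matrix.satisfies \<Delta> N B a Q \<phi>"
      by (rule presentation_border_matrix[OF pres])
    obtain h where h: "h \<in> alg_hom K RI B"
      "\<And>\<alpha> \<beta>. \<alpha> \<in> N \<union> border N \<Longrightarrow> \<beta> \<in> \<Delta> \<Longrightarrow> h (Tc \<alpha> \<beta>) = a \<alpha> \<beta>"
      by (rule RI_hom_exists[OF B M]) (rule that)
    interpret M: border_matrix lt \<Delta> N B a by (rule M)
    interpret M': border_matrix lt \<Delta> N B "\<lambda>\<alpha> \<beta>. h (Tc \<alpha> \<beta>)" by (rule RI_hom_matrix[OF B h(1)])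
    interpret Q: algebra B Q by (rule presentationD[OF pres])
    have [simp]: "\<phi> (single B \<beta>) \<in> carrier Q" for \<beta>
      using presentationD(2)[OF pres] by (auto simp: alg_hom_def ring_hom_closed)
    \<comment> \<open>\<open>h\<close> is known to reproduce \<open>a\<close> on N \<union> N^(1),
      which is where the relations are stated.\<close>
    have "M'.satisfies Q \<phi>"
      unfolding M'.satisfies_def
    proof
      fix \<alpha> assume \<alpha>: "\<alpha> \<in> N \<union> border N"
      have "\<phi> (single B \<alpha>) = (\<Oplus>\<^bsub>Q\<^esub>\<beta>\<in>\<Delta>. a \<alpha> \<beta> \<odot>\<^bsub>Q\<^esub> \<phi> (single B \<beta>))"
        using sat \<alpha> unfolding M.satisfies_def by blast
      also have "\<dots> = (\<Oplus>\<^bsub>Q\<^esub>\<beta>\<in>\<Delta>. h (Tc \<alpha> \<beta>) \<odot>\<^bsub>Q\<^esub> \<phi> (single B \<beta>))"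
        using h(2)[OF \<alpha>] M'.a_closed[OF \<alpha>] by (intro Q.M.finsum_cong'[OF refl]) auto
      finally show "\<phi> (single B \<alpha>) = (\<Oplus>\<^bsub>Q\<^esub>\<beta>\<in>\<Delta>. h (Tc \<alpha> \<beta>) \<odot>\<^bsub>Q\<^esub> \<phi> (single B \<beta>))" .
    qed
    then have "a_kernel PB Q \<phi> = M'.border_ideal" by (simp only: M'.satisfies_iff_kernel[OF pres])
    then show ?thesis using h(1) X hilb_point_eq_kernel_class[OF B h(1)] by auto
  qed
  ultimately show ?thesis
    unfolding bij_betw_def inj_on_def by (intro conjI ballI impI equalityI subsetI) (blast+)
qed

end

section \<open>Base change\<close>

text \<open>
  Write \<open>K\<close> and \<open>K'\<close> for the ideals of \<open>a\<close> and \<open>a' = f \<circ> a\<close>.  Reduction to normal form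
  in \<open>Q \<otimes>\<^sub>B B'\<close> shows that \<open>K'\<close> is killed.  For the other inclusion, \<open>B'[x]/K'\<close> viewed as a
  \<open>B\<close>-algebra receives a map \<open>G\<close> from \<open>Q = B[x]/K\<close>; extended \<open>B'\<close>-linearly to \<open>B'[Q]\<close>
  it kills the relations of the tensor product.
\<close>

lemma kernel_base_change:
  assumes M: "border_matrix lt \<Delta> N B a" and M': "border_matrix lt \<Delta> N B' a'"
    and f: "f \<in> ring_hom B B'"
    and a': "\<And>\<alpha> \<beta>. \<alpha> \<in> N \<union> border N \<Longrightarrow> \<beta> \<in> \<Delta> \<Longrightarrow> a' \<alpha> \<beta> = f (a \<alpha> \<beta>)"
    and Q: "algebra B Q" and \<phi>: "\<phi> \<in> alg_hom B (poly_algebra B) Q" "\<phi> ` carrier (poly_algebra B) = carrier Q"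
    and sat: "border_matrix.satisfies \<Delta> N B a Q \<phi>"
    and ker: "\<And>p. p \<in> carrier (poly_algebra B) \<Longrightarrow> \<phi> p = \<zero>\<^bsub>Q\<^esub> \<Longrightarrow> p \<in> border_matrix.border_ideal \<Delta> B a"
  shows "a_kernel (poly_algebra B') (base_change B B' f Q) (base_change_map B B' f Q \<phi>)
    = border_matrix.border_ideal \<Delta> B' a'"
proof -
  interpret M: border_matrix lt \<Delta> N B a by (rule M)
  interpret M': border_matrix lt \<Delta> N B' a' by (rule M')
  interpret Q: algebra B Q by (rule Q)
  interpret f: ring_hom_cring B B' f
    by (intro ring_hom_cring.intro ring_hom_cring_axioms.intro f M.B.is_cring M'.B.is_cring)
  interpret \<phi>: ring_hom_cring M.PB Q \<phi>
    by (rule alg_hom_ring_hom_cring[OF M.PA.algebra_axioms Q \<phi>(1)])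
  \<comment> \<open>The index monoid is the multiplicative monoid of \<open>Q\<close>; addition and
    scalars of \<open>Q\<close> enter only through the relations in \<open>?J\<close>.\<close>
  interpret A: monoid_ring B' Q
    by (intro monoid_ring.intro M'.B.is_cring Q.comm_monoid_axioms)
  let ?A = "monoid_algebra B' Q" and ?J = "base_change_ideal B B' f Q" and ?BC = "base_change B B' f Q"
  interpret AA: algebra B' ?A by (rule A.algebra_P)
  let ?G1 = "{single B' (q \<oplus>\<^bsub>Q\<^esub> q') \<ominus>\<^bsub>?A\<^esub> (single B' q \<oplus>\<^bsub>?A\<^esub> single B' q') | q q'.
      q \<in> carrier Q \<and> q' \<in> carrier Q}"
  let ?G2 = "{single B' (b \<odot>\<^bsub>Q\<^esub> q) \<ominus>\<^bsub>?A\<^esub> (f b \<odot>\<^bsub>?A\<^esub> single B' q) | b q. b \<in> carrier B \<and> q \<in> carrier Q}"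
  have J_def: "?J = Idl\<^bsub>?A\<^esub> (?G1 \<union> ?G2)"
    unfolding base_change_ideal_def Let_def ..
  have sA: "single B' q \<oplus>\<^bsub>?A\<^esub> single B' q' \<in> carrier ?A" if "q \<in> carrier Q" "q' \<in> carrier Q" for q q'
    by (rule AA.M.a_closed) (use that in auto)
  have sM: "f b \<odot>\<^bsub>?A\<^esub> single B' q \<in> carrier ?A" if "b \<in> carrier B" "q \<in> carrier Q" for b q
    by (rule AA.smult_closed) (use that in auto)
  have gens: "?G1 \<union> ?G2 \<subseteq> carrier ?A"
    by (auto simp del: monoid_algebra_simps intro!: AA.M.minus_closed sA sM)
  interpret J: algebra_ideal B' ?A ?J
    rewrites "quot_algebra ?A ?J = ?BC"
    by (intro algebra_ideal.intro AA.algebra_axioms, unfold J_def, rule AA.genideal_ideal[OF gens])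
       (simp add: base_change_def J_def)
  note genJ = subsetD[OF AA.genideal_self[OF gens], folded J_def]
  \<comment> \<open>The map q \<mapsto> q \<otimes> 1, additive and semilinear along
    \<open>f\<close> by the two kinds of generators of \<open>?J\<close>.\<close>
  define \<tau> where "\<tau> q = ?J +>\<^bsub>?A\<^esub> single B' q" for q
  have \<tau>_closed: "\<tau> q \<in> carrier ?BC" if "q \<in> carrier Q" for q
    unfolding \<tau>_def using that by (intro J.coset_closed) auto
  interpret BC: algebra B' ?BC by (rule J.algebra_quot)
  have \<tau>_add: "\<tau> (q \<oplus>\<^bsub>Q\<^esub> q') = \<tau> q \<oplus>\<^bsub>?BC\<^esub> \<tau> q'" if "q \<in> carrier Q" "q' \<in> carrier Q" for q q'
  proof -
    have "\<tau> (q \<oplus>\<^bsub>Q\<^esub> q') = ?J +>\<^bsub>?A\<^esub> (single B' q \<oplus>\<^bsub>?A\<^esub> single B' q')"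
      unfolding \<tau>_def using that
      by (subst J.coset_eq_iff[OF _ sA]) (auto simp del: monoid_algebra_simps intro!: genJ)
    then show ?thesis using that unfolding \<tau>_def by (subst J.quot_add) auto
  qed
  have \<tau>_smult: "\<tau> (b \<odot>\<^bsub>Q\<^esub> q) = f b \<odot>\<^bsub>?BC\<^esub> \<tau> q" if "b \<in> carrier B" "q \<in> carrier Q" for b q
  proof -
    have "\<tau> (b \<odot>\<^bsub>Q\<^esub> q) = ?J +>\<^bsub>?A\<^esub> (f b \<odot>\<^bsub>?A\<^esub> single B' q)"
      unfolding \<tau>_def using that
      by (subst J.coset_eq_iff[OF _ sM]) (auto simp del: monoid_algebra_simps intro!: genJ)
    then show ?thesis using that unfolding \<tau>_def by (subst J.quot_smult) auto
  qed
  \<comment> \<open>Not among the generators; it is semilinearity with the scalar zero.\<close>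
  have \<tau>_zero: "\<tau> \<zero>\<^bsub>Q\<^esub> = \<zero>\<^bsub>?BC\<^esub>"
    using \<tau>_smult[of "\<zero>\<^bsub>B\<^esub>" "\<zero>\<^bsub>Q\<^esub>"] BC.smult_l_null[OF \<tau>_closed[OF Q.M.zero_closed]]
    by (simp del: J.quot_simps)
  have \<phi>s [simp]: "\<phi> (single B \<alpha>) \<in> carrier Q" for \<alpha> by simp

  \<comment> \<open>The lift of \<phi> \<otimes> id to B'[Q], before the relations are imposed. It
    is multiplicative because \<alpha> \<mapsto> \<phi>(x^\<alpha>) is.\<close>
  define L where "L = restrict (lin_ext B' ?A (\<lambda>\<alpha>. single B' (\<phi> (single B \<alpha>)))) (carrier M'.PB)"
  have L: "L \<in> alg_hom B' M'.PB ?A"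
    unfolding L_def
  proof (rule M'.P.lin_ext_alg_hom[OF AA.algebra_axioms])
    have "single B 0 = \<one>\<^bsub>M.PB\<^esub>" by (simp add: poly_algebra_def one_monoid_algebra)
    then show "single B' (\<phi> (single B 0)) = \<one>\<^bsub>?A\<^esub>" by (simp add: one_monoid_algebra)
    fix \<alpha> \<beta> :: "nat ^ 'a"
    have "\<phi> (single B (\<alpha> + \<beta>)) = \<phi> (single B \<alpha>) \<otimes>\<^bsub>Q\<^esub> \<phi> (single B \<beta>)"
      using M.P.single_mult[of \<alpha> \<beta>] by (simp add: \<phi>.hom_mult[symmetric])
    then show "single B' (\<phi> (single B (\<alpha> + \<beta>))) = single B' (\<phi> (single B \<alpha>)) \<otimes>\<^bsub>?A\<^esub> single B' (\<phi> (single B \<beta>))"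
      using A.single_mult[of "\<phi> (single B \<alpha>)" "\<phi> (single B \<beta>)"] by simp
  qed auto
  have L_closed: "L p \<in> carrier ?A" if "p \<in> carrier M'.PB" for p
    using alg_homD(1)[OF L] that by (rule ring_hom_closed)
  have L_single: "L (single B' \<alpha>) = single B' (\<phi> (single B \<alpha>))" for \<alpha>
    unfolding L_def using M'.P.lin_ext_single[OF AA.module, of \<alpha> "\<lambda>\<alpha>. single B' (\<phi> (single B \<alpha>))"] by auto
  define \<psi> where "\<psi> = compose (carrier M'.PB) (restrict (\<lambda>x. ?J +>\<^bsub>?A\<^esub> x) (carrier ?A)) L"
  have \<psi>: "\<psi> \<in> alg_hom B' M'.PB ?BC"
    unfolding \<psi>_def by (rule alg_hom_compose[OF L J.coset_alg_hom M'.PA.algebra_axioms])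
  have \<psi>_eq: "\<psi> p = ?J +>\<^bsub>?A\<^esub> L p" if "p \<in> carrier M'.PB" for p
    using that L_closed by (simp add: \<psi>_def compose_eq)
  \<comment> \<open>The two functions may differ outside the carrier, where only
    \<open>\<psi>\<close> is forced to be \<open>undefined\<close>; the kernel does not see
    this.\<close>
  have map_eq: "base_change_map B B' f Q \<phi> p = \<psi> p" if "p \<in> carrier M'.PB" for p
    unfolding \<psi>_eq[OF that] using that by (simp add: base_change_map_def L_def lin_ext_def Let_def)
  have kernel: "a_kernel M'.PB ?BC (base_change_map B B' f Q \<phi>) = {p \<in> carrier M'.PB. \<psi> p = \<zero>\<^bsub>?BC\<^esub>}"
    using map_eq by (auto simp: a_kernel_def' simp del: J.quot_simps)

  \<comment> \<open>Apply q \<mapsto> q \<otimes> 1 to the relations in \<open>Q\<close>;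
    semilinearity turns the coefficients \<open>a\<close> into \<open>a'\<close>.\<close>
  have "M'.satisfies ?BC \<psi>"
    unfolding M'.satisfies_def
  proof
    fix \<alpha> assume \<alpha>: "\<alpha> \<in> N \<union> border N"
    have \<psi>_single: "\<psi> (single B' \<beta>) = \<tau> (\<phi> (single B \<beta>))" for \<beta>
      by (simp add: \<psi>_eq L_single \<tau>_def)
    have "\<psi> (single B' \<alpha>) = \<tau> (\<Oplus>\<^bsub>Q\<^esub>\<beta>\<in>\<Delta>. a \<alpha> \<beta> \<odot>\<^bsub>Q\<^esub> \<phi> (single B \<beta>))"
      unfolding \<psi>_single using sat \<alpha> unfolding M.satisfies_def by simp
    also have "\<dots> = (\<Oplus>\<^bsub>?BC\<^esub>\<beta>\<in>\<Delta>. \<tau> (a \<alpha> \<beta> \<odot>\<^bsub>Q\<^esub> \<phi> (single B \<beta>)))"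
      using \<tau>_closed \<tau>_zero \<tau>_add M.a_closed[OF \<alpha>]
      by (intro finsum_additive Q.M.abelian_monoid_axioms BC.M.abelian_monoid_axioms) auto
    also have "\<dots> = (\<Oplus>\<^bsub>?BC\<^esub>\<beta>\<in>\<Delta>. a' \<alpha> \<beta> \<odot>\<^bsub>?BC\<^esub> \<psi> (single B' \<beta>))"
      using M.a_closed[OF \<alpha>] M'.a_closed[OF \<alpha>] a'[OF \<alpha>]
      by (intro BC.M.finsum_cong'[OF refl])
         (auto simp: \<tau>_smult \<psi>_single simp del: J.quot_simps intro!: BC.smult_closed \<tau>_closed)
    finally show "\<psi> (single B' \<alpha>) = (\<Oplus>\<^bsub>?BC\<^esub>\<beta>\<in>\<Delta>. a' \<alpha> \<beta> \<odot>\<^bsub>?BC\<^esub> \<psi> (single B' \<beta>))" .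
  qed
  note border_ideal_le = M'.satisfies_border_ideal[OF BC.algebra_axioms \<psi> this]

  let ?C = "quot_algebra M'.PB M'.border_ideal"
  interpret border_ideal': algebra_ideal B' M'.PB M'.border_ideal
    by (intro algebra_ideal.intro M'.PA.algebra_axioms M'.ideal_border_ideal)
  interpret C: algebra B' ?C by (rule border_ideal'.algebra_quot)
  let ?\<pi> = "restrict (\<lambda>p. M'.border_ideal +>\<^bsub>M'.PB\<^esub> p) (carrier M'.PB)"
  note \<pi> = border_ideal'.coset_alg_hom
  have \<pi>_sat: "M'.satisfies ?C ?\<pi>"
    using M'.satisfies_iff_kernel[OF M'.border_ideal_presentation] M'.kernel_coset_border_ideal by blast
  \<comment> \<open>The structure map from B through B' to the quotient, along which scalars are
    restricted.\<close>
  define g where "g b = f b \<odot>\<^bsub>?C\<^esub> \<one>\<^bsub>?C\<^esub>" for b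
  have g_mult: "g b \<otimes>\<^bsub>?C\<^esub> x = f b \<odot>\<^bsub>?C\<^esub> x" if "b \<in> carrier B" "x \<in> carrier ?C" for b x
    unfolding g_def using that by (subst C.smult_assoc2) (auto simp del: border_ideal'.quot_simps)
  have "g \<in> ring_hom B ?C"
  proof (rule ring_hom_memI)
    fix x y assume xy: "x \<in> carrier B" "y \<in> carrier B"
    then show "g x \<in> carrier ?C" by (auto simp: g_def simp del: border_ideal'.quot_simps)
    show "g (x \<oplus>\<^bsub>B\<^esub> y) = g x \<oplus>\<^bsub>?C\<^esub> g y"
      using xy by (simp add: g_def C.smult_l_distr del: border_ideal'.quot_simps)
    have "g x \<otimes>\<^bsub>?C\<^esub> g y = f x \<odot>\<^bsub>?C\<^esub> (f y \<odot>\<^bsub>?C\<^esub> \<one>\<^bsub>?C\<^esub>)"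
      using xy by (subst g_mult) (auto simp: g_def simp del: border_ideal'.quot_simps)
    then show "g (x \<otimes>\<^bsub>B\<^esub> y) = g x \<otimes>\<^bsub>?C\<^esub> g y"
      using xy by (simp add: g_def C.smult_assoc1 del: border_ideal'.quot_simps)
  qed (simp add: g_def del: border_ideal'.quot_simps)
  then have Cg: "algebra B (algebra_via g ?C)"
    by (rule algebra_algebra_via[OF M.B.is_cring C.M_cring])
  interpret Cg: algebra B "algebra_via g ?C" by (rule Cg)
  have \<pi>_closed: "?\<pi> (single B' \<alpha>) \<in> carrier ?C" for \<alpha>
    using alg_homD(1)[OF \<pi>] by (rule ring_hom_closed) simp
  \<comment> \<open>Coefficients are pushed along \<open>f\<close> and monomials are taken modulo
    K'.\<close>
  define F where "F = restrict (lin_ext B (algebra_via g ?C) (\<lambda>\<alpha>. ?\<pi> (single B' \<alpha>))) (carrier M.PB)"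
  have F: "F \<in> alg_hom B M.PB (algebra_via g ?C)"
    unfolding F_def
  proof (rule M.P.lin_ext_alg_hom[OF Cg])
    show "(\<lambda>\<alpha>. ?\<pi> (single B' \<alpha>)) \<in> UNIV \<rightarrow> carrier (algebra_via g ?C)"
      using \<pi>_closed by simp
    have "single B' 0 = \<one>\<^bsub>M'.PB\<^esub>" by (simp add: poly_algebra_def one_monoid_algebra)
    then show "?\<pi> (single B' 0) = \<one>\<^bsub>algebra_via g ?C\<^esub>"
      using ring_hom_one[OF alg_homD(1)[OF \<pi>]] by (simp del: border_ideal'.quot_simps)
    fix \<alpha> \<beta> :: "nat ^ 'a"
    show "?\<pi> (single B' (\<alpha> + \<beta>)) = ?\<pi> (single B' \<alpha>) \<otimes>\<^bsub>algebra_via g ?C\<^esub> ?\<pi> (single B' \<beta>)"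
      using ring_hom_mult[OF alg_homD(1)[OF \<pi>], of "single B' \<alpha>" "single B' \<beta>"] M'.P.single_mult[of \<alpha> \<beta>]
      by (simp del: border_ideal'.quot_simps restrict_apply)
  qed
  have F_single: "F (single B \<alpha>) = ?\<pi> (single B' \<alpha>)" for \<alpha>
    unfolding F_def using M.P.lin_ext_single[OF Cg.module, of \<alpha> "\<lambda>\<alpha>. ?\<pi> (single B' \<alpha>)"] \<pi>_closed
    by (simp del: border_ideal'.quot_simps restrict_apply add: restrict_apply'[OF M.single_in_PB])
  \<comment> \<open>After restriction of scalars the relations of \<open>a'\<close> become those of
    \<open>a\<close>, so \<open>F\<close> kills K and factors through \<open>Q\<close>.\<close>
  have "M.satisfies (algebra_via g ?C) F"
    unfolding M.satisfies_def
  proof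
    fix \<alpha> assume \<alpha>: "\<alpha> \<in> N \<union> border N"
    have "F (single B \<alpha>) = (\<Oplus>\<^bsub>?C\<^esub>\<beta>\<in>\<Delta>. a' \<alpha> \<beta> \<odot>\<^bsub>?C\<^esub> ?\<pi> (single B' \<beta>))"
      unfolding F_single using \<pi>_sat \<alpha> unfolding M'.satisfies_def by blast
    also have "\<dots> = (\<Oplus>\<^bsub>algebra_via g ?C\<^esub>\<beta>\<in>\<Delta>. a \<alpha> \<beta> \<odot>\<^bsub>algebra_via g ?C\<^esub> F (single B \<beta>))"
      unfolding algebra_via_simps F_single
    proof (rule C.M.finsum_cong'[OF refl])
      fix \<beta> assume \<beta>: "\<beta> \<in> \<Delta>"
      show "a' \<alpha> \<beta> \<odot>\<^bsub>?C\<^esub> ?\<pi> (single B' \<beta>) = g (a \<alpha> \<beta>) \<otimes>\<^bsub>?C\<^esub> ?\<pi> (single B' \<beta>)"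
        using g_mult[OF M.a_closed[OF \<alpha> \<beta>] \<pi>_closed] a'[OF \<alpha> \<beta>] by (simp only:)
    next
      show "(\<lambda>\<beta>. g (a \<alpha> \<beta>) \<otimes>\<^bsub>?C\<^esub> ?\<pi> (single B' \<beta>)) \<in> \<Delta> \<rightarrow> carrier ?C"
        using g_mult[OF M.a_closed[OF \<alpha>] \<pi>_closed] M.a_closed[OF \<alpha>] \<pi>_closed
        by (auto simp del: border_ideal'.quot_simps restrict_apply intro!: C.smult_closed)
    qed
    finally show "F (single B \<alpha>) = (\<Oplus>\<^bsub>algebra_via g ?C\<^esub>\<beta>\<in>\<Delta>. a \<alpha> \<beta> \<odot>\<^bsub>algebra_via g ?C\<^esub> F (single B \<beta>))" .
  qed
  note F_border_ideal = M.satisfies_border_ideal[OF Cg F this]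
  obtain G where G: "G \<in> alg_hom B Q (algebra_via g ?C)" "\<And>p. p \<in> carrier M.PB \<Longrightarrow> G (\<phi> p) = F p"
  proof (rule alg_hom_factor[OF M.PA.algebra_axioms Q Cg \<phi> F])
    fix p assume "p \<in> carrier M.PB" "\<phi> p = \<zero>\<^bsub>Q\<^esub>"
    then show "F p = \<zero>\<^bsub>algebra_via g ?C\<^esub>" by (intro F_border_ideal ker)
  qed (rule that)
  note Gr = alg_homD(1)[OF G(1)]
  have G_closed: "G q \<in> carrier ?C" if "q \<in> carrier Q" for q
    using ring_hom_closed[OF Gr that] by simp
  define \<Theta> where "\<Theta> = restrict (lin_ext B' ?C G) (carrier ?A)"
  have \<Theta>: "\<Theta> \<in> alg_hom B' ?A ?C"
    unfolding \<Theta>_def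
    using ring_hom_mult[OF Gr] ring_hom_one[OF Gr] G_closed
    by (intro A.lin_ext_alg_hom C.algebra_axioms) (auto simp del: border_ideal'.quot_simps)
  interpret \<Theta>: ring_hom_cring ?A ?C \<Theta> by (rule alg_hom_ring_hom_cring[OF AA.algebra_axioms C.algebra_axioms \<Theta>])
  have \<Theta>_single: "\<Theta> (single B' q) = G q" if "q \<in> carrier Q" for q
    unfolding \<Theta>_def using A.lin_ext_single[OF C.module that, of G] G_closed that
    by (auto simp del: border_ideal'.quot_simps)
  have \<Theta>_diff: "x \<ominus>\<^bsub>?A\<^esub> y \<in> a_kernel ?A ?C \<Theta>" if "x \<in> carrier ?A" "y \<in> carrier ?A" "\<Theta> x = \<Theta> y" for x y
    unfolding a_kernel_iff[OF AA.algebra_axioms C.algebra_axioms \<Theta>]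
    using that C.M.minus_eq_zero_iff[of "\<Theta> x" "\<Theta> y"]
    by (simp add: a_minus_def del: border_ideal'.quot_simps monoid_algebra_simps)
  have J_ker: "?J \<subseteq> a_kernel ?A ?C \<Theta>"
    unfolding J_def
  proof (rule AA.genideal_minimal[OF a_kernel_ideal[OF AA.algebra_axioms C.algebra_axioms \<Theta>]])
    have "single B' (q \<oplus>\<^bsub>Q\<^esub> q') \<ominus>\<^bsub>?A\<^esub> (single B' q \<oplus>\<^bsub>?A\<^esub> single B' q') \<in> a_kernel ?A ?C \<Theta>"
      if q: "q \<in> carrier Q" "q' \<in> carrier Q" for q q'
    proof (rule \<Theta>_diff[OF _ sA[OF q]])
      have "\<Theta> (single B' q \<oplus>\<^bsub>?A\<^esub> single B' q') = G q \<oplus>\<^bsub>?C\<^esub> G q'"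
        using q by (subst \<Theta>.hom_add) (auto simp: \<Theta>_single simp del: border_ideal'.quot_simps)
      then show "\<Theta> (single B' (q \<oplus>\<^bsub>Q\<^esub> q')) = \<Theta> (single B' q \<oplus>\<^bsub>?A\<^esub> single B' q')"
        using q ring_hom_add[OF Gr q] by (simp add: \<Theta>_single del: border_ideal'.quot_simps monoid_algebra_simps)
    qed (use q in auto)
    moreover have "single B' (b \<odot>\<^bsub>Q\<^esub> q) \<ominus>\<^bsub>?A\<^esub> (f b \<odot>\<^bsub>?A\<^esub> single B' q) \<in> a_kernel ?A ?C \<Theta>"
      if q: "b \<in> carrier B" "q \<in> carrier Q" for b q
    proof (rule \<Theta>_diff[OF _ sM[OF q]])
      have "\<Theta> (f b \<odot>\<^bsub>?A\<^esub> single B' q) = f b \<odot>\<^bsub>?C\<^esub> G q"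
        using q by (subst alg_homD(3)[OF \<Theta>]) (auto simp: \<Theta>_single simp del: border_ideal'.quot_simps)
      also have "\<dots> = G (b \<odot>\<^bsub>Q\<^esub> q)"
        using alg_homD(3)[OF G(1) q] g_mult[OF q(1) G_closed[OF q(2)]] by simp
      finally show "\<Theta> (single B' (b \<odot>\<^bsub>Q\<^esub> q)) = \<Theta> (f b \<odot>\<^bsub>?A\<^esub> single B' q)"
        using q by (simp add: \<Theta>_single del: border_ideal'.quot_simps monoid_algebra_simps)
    qed (use q in auto)
    ultimately show "?G1 \<union> ?G2 \<subseteq> a_kernel ?A ?C \<Theta>" by blast
  qed
  \<comment> \<open>Both are B'-algebra maps on B'[x] and agree on monomials. So an element whose
    lift lies in \<open>?J\<close> is zero modulo K'.\<close>
  have \<Theta>L: "compose (carrier M'.PB) \<Theta> L = ?\<pi>"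
  proof (rule M'.P.alg_hom_eqI[OF C.algebra_axioms alg_hom_compose[OF L \<Theta> M'.PA.algebra_axioms] \<pi>])
    fix \<alpha>
    show "compose (carrier M'.PB) \<Theta> L (single B' \<alpha>) = ?\<pi> (single B' \<alpha>)"
      using G(2)[OF M.single_in_PB, of \<alpha>]
      by (simp only: compose_eq M'.single_in_PB L_single \<Theta>_single[OF \<phi>s] F_single)
  qed
  have "p \<in> M'.border_ideal" if p: "p \<in> carrier M'.PB" "\<psi> p = \<zero>\<^bsub>?BC\<^esub>" for p
  proof -
    have "L p \<in> ?J"
      using p J.coset_zero_iff[OF L_closed[OF p(1)]] by (simp add: \<psi>_eq)
    then have "\<Theta> (L p) = \<zero>\<^bsub>?C\<^esub>"
      using J_ker a_kernel_iff[OF AA.algebra_axioms C.algebra_axioms \<Theta>, of "L p"] by blast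
    then have "?\<pi> p = \<zero>\<^bsub>?C\<^esub>"
      using p(1) by (simp add: \<Theta>L[symmetric] compose_eq del: border_ideal'.quot_simps)
    then show ?thesis using p(1) border_ideal'.coset_zero_iff[OF p(1)] by simp
  qed
  then show ?thesis
    unfolding kernel using border_ideal_le M'.border_ideal_def by blast
qed

theorem corollary1:
  fixes k :: "'k ring"
    and lt :: "nat ^ 'n::finite \<Rightarrow> nat ^ 'n \<Rightarrow> bool"
    and \<Delta> N :: "(nat ^ 'n) set"
  assumes "cring k"
    and "monomial_order lt"
    and "standard_set \<Delta>" and "finite \<Delta>" and "card \<Delta> \<ge> 1"
    and "standard_set N" and "\<Delta> \<subseteq> N"
  shows "algebra k (R_prec_Delta k lt N \<Delta>) \<and>
    (\<forall>B :: ('k, 'b) module. algebra k B \<longrightarrow>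
      bij_betw (hilb_point k lt N \<Delta> B) (alg_hom k (R_prec_Delta k lt N \<Delta>) B) (hilb B lt \<Delta>)) \<and>
    (\<forall>(B :: ('k, 'b) module) (B' :: ('k, 'c) module). \<forall>f \<in> alg_hom k B B'.
      algebra k B \<and> algebra k B' \<longrightarrow>
      hilb_map B B' lt \<Delta> f \<in> hilb B lt \<Delta> \<rightarrow> hilb B' lt \<Delta> \<and>
      (\<forall>h \<in> alg_hom k (R_prec_Delta k lt N \<Delta>) B.
        hilb_map B B' lt \<Delta> f (hilb_point k lt N \<Delta> B h) =
        hilb_point k lt N \<Delta> B' (compose (carrier (R_prec_Delta k lt N \<Delta>)) f h)))"
proof -
  have "\<Delta> \<noteq> {}" using assms(5) by auto
  then interpret coordinate_ring lt \<Delta> N k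
    by (intro coordinate_ring.intro hilb_data.intro hilb_data_axioms.intro monomial_ordering.intro assms)
  \<comment> \<open>All members of the class acquire the same kernel after base change, namely the
    ideal of the image matrix, so the two classes are compared by kernels.\<close>
  have natural: "hilb_map B B' lt \<Delta> f (hilb_point k lt N \<Delta> B h) = hilb_point k lt N \<Delta> B' (compose (carrier RI) f h)"
    if B: "algebra k B" and B': "algebra k B'" and f: "f \<in> alg_hom k B B'" and h: "h \<in> alg_hom k RI B"
    for B :: "('k, 'b) module" and B' :: "('k, 'c) module" and f h
  proof -
    let ?h' = "compose (carrier RI) f h"
    have h': "?h' \<in> alg_hom k RI B'" by (rule alg_hom_compose[OF h f algebra_RI])
    note M = RI_hom_matrix[OF B h] and M' = RI_hom_matrix[OF B' h']
    interpret M: border_matrix lt \<Delta> N B "\<lambda>\<alpha> \<beta>. h (Tc \<alpha> \<beta>)" by (rule M)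
    interpret M': border_matrix lt \<Delta> N B' "\<lambda>\<alpha> \<beta>. ?h' (Tc \<alpha> \<beta>)" by (rule M')
    have kernel: "a_kernel (poly_algebra B') (base_change B B' f Q) (base_change_map B B' f Q \<phi>) = M'.border_ideal"
      if Q: "(Q, \<phi>) \<in> hilb_point k lt N \<Delta> B h" for Q \<phi>
    proof -
      have pres: "(Q, \<phi>) \<in> hilb_presentations B lt \<Delta>"
        using Q by (simp add: hilb_point_def)
      have sat: "M.satisfies Q \<phi>"
        using Q hilb_point_eq_kernel_class[OF B h] M.kernel_class_border_ideal by simp
      show ?thesis
      proof (rule kernel_base_change[OF M M' alg_homD(1)[OF f] _ M.presentationD(1-3)[OF pres] sat])
        fix \<alpha> \<beta> assume "\<alpha> \<in> N \<union> border N" "\<beta> \<in> \<Delta>"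
        from Tc_closed[OF this] show "?h' (Tc \<alpha> \<beta>) = f (h (Tc \<alpha> \<beta>))" by (rule compose_eq)
      next
        fix p assume "p \<in> carrier M.PB" "\<phi> p = \<zero>\<^bsub>Q\<^esub>"
        then show "p \<in> M.border_ideal"
          using M.satisfies_iff_kernel[OF pres] sat M.presentation_kernel_iff[OF pres] by blast
      qed
    qed
    \<comment> \<open>\<open>hilb_map\<close> quantifies existentially over the class, so a member
      has to be exhibited.\<close>
    obtain Q \<phi> where Q\<phi>: "(Q, \<phi>) \<in> hilb_point k lt N \<Delta> B h"
      unfolding hilb_point_eq_kernel_class[OF B h] M.kernel_class_def
      using M.border_ideal_presentation M.kernel_coset_border_ideal by blast
    have "(\<exists>(Q, \<phi>)\<in>hilb_point k lt N \<Delta> B h. L =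
        a_kernel (poly_algebra B') (base_change B B' f Q) (base_change_map B B' f Q \<phi>)) \<longleftrightarrow> L = M'.border_ideal" for L
      using kernel kernel[OF Q\<phi>] Q\<phi> by blast
    then have "hilb_map B B' lt \<Delta> f (hilb_point k lt N \<Delta> B h) = M'.kernel_class M'.border_ideal"
      unfolding hilb_map_def M'.kernel_class_def by (simp only:)
    then show ?thesis using hilb_point_eq_kernel_class[OF B' h'] by simp
  qed
  \<comment> \<open>Every point comes from some \<open>h\<close>, so naturality also shows that base
    change lands in the functor.\<close>
  moreover have "hilb_map B B' lt \<Delta> f X \<in> hilb B' lt \<Delta>"
    if B: "algebra k B" and B': "algebra k B'" and f: "f \<in> alg_hom k B B'" and X: "X \<in> hilb B lt \<Delta>"
    for B :: "('k, 'b) module" and B' :: "('k, 'c) module" and f X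
  proof -
    obtain h where h: "h \<in> alg_hom k RI B" "X = hilb_point k lt N \<Delta> B h"
      using X bij_betw_imp_surj_on[OF bij_betw_hilb_point[OF B]] by blast
    show ?thesis
      unfolding h(2) natural[OF B B' f h(1)]
      by (rule bij_betw_apply[OF bij_betw_hilb_point[OF B'] alg_hom_compose[OF h(1) f algebra_RI]])
  qed
  ultimately show ?thesis
    using algebra_RI bij_betw_hilb_point by (intro conjI allI impI ballI Pi_I) auto
qed

end
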